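(* Let $\mathrm{M}$ be a loopless matroid on a finite set $E$ with lattice of flats $\mathcal{L}$, let $\mathcal{G}$ be a building set with $(\mathrm{M},\mathcal{G})$ irreducible, and let $\vartriangleleft$ be a total order on $E$ such that $(\mathrm{M},\mathcal{G})$ is $\vartriangleleft$-complete. Let $V=\mathcal{G}\setminus\big(C_\vartriangleleft(\hat0,\hat1)\cup\{\text{atoms of }\mathcal{L}\}\big)$ and \[ \Gamma_\vartriangleleft(\mathrm{M},\mathcal{G})=\{\mathrm{Des}(\mathcal{S}) : \mathcal{S}\in\mathcal{N}(\mathrm{M},\mathcal{G})^{\max}_{\mathrm{stable}}\}\subseteq\mathcal{P}(V). \] Then $\Gamma_\vartriangleleft(\mathrm{M},\mathcal{G})$ is a simplicial complex (a family of subsets closed under taking subsets), and for every $i\geqslant0$ the number of its members of cardinality $i$ equals the coefficient $\gamma_i$ of $t^i$ in the $\gamma$-polynomial of the Chow polynomial $\mathrm{H}(\mathrm{M},\mathcal{G})(t)$.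
   Context: $\mathcal{L}$ is ordered by inclusion, $\hat0=\varnothing$, $\hat1=E$, $F\vee G=\operatorname{cl}_{\mathrm{M}}(F\cup G)$, $F\vee e=\operatorname{cl}_{\mathrm{M}}(F\cup\{e\})$. A building set is $\mathcal{G}\subseteq\mathcal{L}\setminus\{\hat0\}$ such that for every $F\neq\hat0$ the join map $\prod_{G\in\max\mathcal{G}_{\leqslant F}}[\hat0,G]\to[\hat0,F]$ is a poset isomorphism ($\max\mathcal{G}_{\leqslant F}$ = maximal elements of $\{G\in\mathcal{G}:G\leqslant F\}$); irreducible means $E\in\mathcal{G}$. $\mathcal{S}\subseteq\mathcal{G}$ is nested if for every antichain $A\subseteq\mathcal{S}$ and every $\{S_1,\dots,S_k\}\subseteq A$, $k\geqslant2$, $S_1\vee\dots\vee S_k\notin\mathcal{G}$; maximal nested sets are inclusion-maximal ones. Chow ring $\mathrm{CH}(\mathrm{M},\mathcal{G})=\mathbb{Q}[x_G:G\in\mathcal{G}]/(I+J)$ with $I$ generated by $x_{G_1}\cdots x_{G_k}$ for non-nested $\{G_1,\dots,G_k\}$ and $J$ by $\sum_{G\in\mathcal{G},G\geqslant a}x_G$ for atoms $a$; $\mathrm{H}(\mathrm{M},\mathcal{G})(t)=\sum_i\dim\mathrm{CH}^i t^i$ is palindromic of degree $d$, $\mathrm{H}=\sum_i\gamma_it^i(1+t)^{d-2i}$, and $\sum_i\gamma_it^i$ is its $\gamma$-polynomial. $C_\vartriangleleft(F,G)$ for flats $F\leqslant G$: with $G\setminus F=\{e_1\vartriangleleft\dots\vartriangleleft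 e_k\}$, $F_i=\operatorname{cl}_{\mathrm{M}}(F\cup\{e_1,\dots,e_i\})$, $C_\vartriangleleft(F,G)=\{F,F_1,\dots,F_k\}$. With $\mathcal{G}_F=\{F\vee H:H\in\mathcal{G}\}\setminus\{F\}$, $\mathcal{G}_F^G=\mathcal{G}_F\cap[F,G]$, $\vartriangleleft$-complete means $C_\vartriangleleft(F,G)\subseteq\mathcal{G}_F^G\cup\{F\}$ for all flats $F$ and $G\in\mathcal{G}$ with $F\leqslant G$. For a maximal nested set $\mathcal{S}$ and $G\in\mathcal{S}$: $J^G=\bigvee\{H\in\mathcal{S}:H<G\}$, which satisfies $\operatorname{rk}G-\operatorname{rk}J^G=1$; $\lambda_{\mathcal{S}}(G)=\min_\vartriangleleft\{e:J^G\vee e=G\}$; for $G$ not maximal in $\mathcal{S}$, $p(G)$ is the unique minimum of $\{H\in\mathcal{S}:H>G\}$ (children of $H$ are the $G$ with $p(G)=H$). $G$ is a descent if it is not maximal in $\mathcal{S}$ and $\lambda_{\mathcal{S}}(p(G))\vartriangleleft\lambda_{\mathcal{S}}(G)$; a bottom descent if moreover minimal in $\mathcal{S}$; a double descent if a descent, not minimal in $\mathcal{S}$, all of whose children are descents. $\mathrm{Des}(\mathcal{S})$ = set of descents; $\mathcal{N}(\mathrm{M},\mathcal{G})^{\max}_{\mathrm{stable}}$ = maximal nested sets without bottom or double descents. *)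

theory Defs
  imports Main "HOL-Library.Function_Algebras" "HOL-Library.Multiset"
    "HOL-Library.FuncSet" "HOL-Computational_Algebra.Polynomial"
begin

definition matroid :: "'a set \<Rightarrow> ('a set \<Rightarrow> bool) \<Rightarrow> bool" where
  "matroid E indep \<longleftrightarrow> finite E \<and> indep {} \<and>
     (\<forall>I. indep I \<longrightarrow> I \<subseteq> E) \<and>
     (\<forall>I J. indep J \<and> I \<subseteq> J \<longrightarrow> indep I) \<and>
     (\<forall>I J. indep I \<and> indep J \<and> card I < card J \<longrightarrow> (\<exists>e\<in>J - I. indep (insert e I)))"

definition loopless :: "'a set \<Rightarrow> ('a set \<Rightarrow> bool) \<Rightarrow> bool" where
  "loopless E indep \<longleftrightarrow> (\<forall>e\<in>E. indep {e})"

definition mrank :: "('a set \<Rightarrow> bool) \<Rightarrow> 'a set \<Rightarrow> nat" where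
  "mrank indep X = Max {card I | I. I \<subseteq> X \<and> indep I}"

definition mcl :: "'a set \<Rightarrow> ('a set \<Rightarrow> bool) \<Rightarrow> 'a set \<Rightarrow> 'a set" where
  "mcl E indep X = {e\<in>E. mrank indep (insert e X) = mrank indep X}"

definition flats :: "'a set \<Rightarrow> ('a set \<Rightarrow> bool) \<Rightarrow> 'a set set" where
  "flats E indep = {F. F \<subseteq> E \<and> mcl E indep F = F}"

definition atoms :: "'a set \<Rightarrow> ('a set \<Rightarrow> bool) \<Rightarrow> 'a set set" where
  "atoms E indep = {F\<in>flats E indep. mrank indep F = 1}"

definition fjoin :: "'a set \<Rightarrow> ('a set \<Rightarrow> bool) \<Rightarrow> 'a set set \<Rightarrow> 'a set" where
  "fjoin E indep T = mcl E indep (\<Union>T)"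

definition maxs_below :: "'a set set \<Rightarrow> 'a set \<Rightarrow> 'a set set" where
  "maxs_below \<G> F = {G\<in>\<G>. G \<subseteq> F \<and> \<not>(\<exists>H\<in>\<G>. H \<subseteq> F \<and> G \<subset> H)}"

definition building_set :: "'a set \<Rightarrow> ('a set \<Rightarrow> bool) \<Rightarrow> 'a set set \<Rightarrow> bool" where
  "building_set E indep \<G> \<longleftrightarrow> \<G> \<subseteq> flats E indep - {{}} \<and>
    (\<forall>F\<in>flats E indep. F \<noteq> {} \<longrightarrow>
      (let Ms = maxs_below \<G> F;
           P = (\<Pi>\<^sub>E G\<in>Ms. {H\<in>flats E indep. H \<subseteq> G});
           j = (\<lambda>x. fjoin E indep (x ` Ms))
       in bij_betw j P {H\<in>flats E indep. H \<subseteq> F} \<and>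
          (\<forall>x\<in>P. \<forall>y\<in>P. (j x \<subseteq> j y) \<longleftrightarrow> (\<forall>G\<in>Ms. x G \<subseteq> y G))))"

definition antichain_sets :: "'a set set \<Rightarrow> bool" where
  "antichain_sets A \<longleftrightarrow> (\<forall>X\<in>A. \<forall>Y\<in>A. X \<subseteq> Y \<longrightarrow> X = Y)"

definition nested :: "'a set \<Rightarrow> ('a set \<Rightarrow> bool) \<Rightarrow> 'a set set \<Rightarrow> 'a set set \<Rightarrow> bool" where
  "nested E indep \<G> S \<longleftrightarrow> S \<subseteq> \<G> \<and>
     (\<forall>A\<subseteq>S. antichain_sets A \<longrightarrow>
        (\<forall>T\<subseteq>A. finite T \<and> card T \<ge> 2 \<longrightarrow> fjoin E indep T \<notin> \<G>))"

definition max_nested :: "'a set \<Rightarrow> ('a set \<Rightarrow> bool) \<Rightarrow> 'a set set \<Rightarrow> 'a set set \<Rightarrow> bool" where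
  "max_nested E indep \<G> S \<longleftrightarrow> nested E indep \<G> S \<and>
     (\<forall>S'. nested E indep \<G> S' \<and> S \<subseteq> S' \<longrightarrow> S' = S)"

text \<open>Polynomials in the variables x_G (G in \<G>) over Q are represented as functions
  from monomials (multisets of variables) to coefficients; the vector space structure
  is pointwise.\<close>

definition qscale :: "rat \<Rightarrow> ('a set multiset \<Rightarrow> rat) \<Rightarrow> ('a set multiset \<Rightarrow> rat)" where
  "qscale c f = (\<lambda>\<mu>. c * f \<mu>)"

definition mono_fn :: "'a set multiset \<Rightarrow> ('a set multiset \<Rightarrow> rat)" where
  "mono_fn m = (\<lambda>\<mu>. if \<mu> = m then 1 else 0)"

text \<open>All monomial multiples of the generators of I and J; their linear span is the
  ideal I + J.\<close>
definition chow_ideal_gens ::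
  "'a set \<Rightarrow> ('a set \<Rightarrow> bool) \<Rightarrow> 'a set set \<Rightarrow> ('a set multiset \<Rightarrow> rat) set" where
  "chow_ideal_gens E indep \<G> =
     {mono_fn (m + mset_set T) | m T. set_mset m \<subseteq> \<G> \<and> T \<subseteq> \<G> \<and> \<not> nested E indep \<G> T}
     \<union> {(\<lambda>\<mu>. \<Sum>G\<in>{G\<in>\<G>. a \<subseteq> G}. mono_fn (m + {#G#}) \<mu>) | m a.
          set_mset m \<subseteq> \<G> \<and> a \<in> atoms E indep}"

definition chow_ideal ::
  "'a set \<Rightarrow> ('a set \<Rightarrow> bool) \<Rightarrow> 'a set set \<Rightarrow> ('a set multiset \<Rightarrow> rat) set" where
  "chow_ideal E indep \<G> = module.span qscale (chow_ideal_gens E indep \<G>)"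

definition hom_polys :: "'a set set \<Rightarrow> nat \<Rightarrow> ('a set multiset \<Rightarrow> rat) set" where
  "hom_polys \<G> i = {f. \<forall>\<mu>. f \<mu> \<noteq> 0 \<longrightarrow> set_mset \<mu> \<subseteq> \<G> \<and> size \<mu> = i}"

definition chow_dim :: "'a set \<Rightarrow> ('a set \<Rightarrow> bool) \<Rightarrow> 'a set set \<Rightarrow> nat \<Rightarrow> nat" where
  "chow_dim E indep \<G> i =
     vector_space.dim qscale (hom_polys \<G> i)
     - vector_space.dim qscale (chow_ideal E indep \<G> \<inter> hom_polys \<G> i)"

definition chow_poly :: "'a set \<Rightarrow> ('a set \<Rightarrow> bool) \<Rightarrow> 'a set set \<Rightarrow> rat poly" where
  "chow_poly E indep \<G> = (THE p. \<forall>i. coeff p i = of_nat (chow_dim E indep \<G> i))"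

definition gamma_poly :: "rat poly \<Rightarrow> rat poly" where
  "gamma_poly f = (THE g. 2 * degree g \<le> degree f \<and>
      f = (\<Sum>i\<le>degree f div 2. smult (coeff g i) (monom 1 i * [:1, 1:] ^ (degree f - 2 * i))))"

text \<open>R is a (reflexive) linear order on E; the strict order is e \<lhd> e' iff (e,e') \<in> R, e \<noteq> e'.\<close>
definition olt :: "('a \<times> 'a) set \<Rightarrow> 'a \<Rightarrow> 'a \<Rightarrow> bool" where
  "olt R x y \<longleftrightarrow> (x, y) \<in> R \<and> x \<noteq> y"

definition omin :: "('a \<times> 'a) set \<Rightarrow> 'a set \<Rightarrow> 'a" where
  "omin R S = (THE m. m \<in> S \<and> (\<forall>e\<in>S. (m, e) \<in> R))"

text \<open>C(F,G) = {F, F_1, ..., F_k} with F_i = cl(F \<union> {e_1..e_i}).\<close>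
definition Cchain :: "'a set \<Rightarrow> ('a set \<Rightarrow> bool) \<Rightarrow> ('a \<times> 'a) set \<Rightarrow> 'a set \<Rightarrow> 'a set \<Rightarrow> 'a set set" where
  "Cchain E indep R F G =
     insert F {mcl E indep (F \<union> {e\<in>G - F. (e, x) \<in> R}) | x. x \<in> G - F}"

definition GF :: "'a set \<Rightarrow> ('a set \<Rightarrow> bool) \<Rightarrow> 'a set set \<Rightarrow> 'a set \<Rightarrow> 'a set set" where
  "GF E indep \<G> F = {fjoin E indep {F, H} | H. H \<in> \<G>} - {F}"

definition GFG :: "'a set \<Rightarrow> ('a set \<Rightarrow> bool) \<Rightarrow> 'a set set \<Rightarrow> 'a set \<Rightarrow> 'a set \<Rightarrow> 'a set set" where
  "GFG E indep \<G> F G = {K\<in>GF E indep \<G> F. F \<subseteq> K \<and> K \<subseteq> G}"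

definition tri_complete :: "'a set \<Rightarrow> ('a set \<Rightarrow> bool) \<Rightarrow> 'a set set \<Rightarrow> ('a \<times> 'a) set \<Rightarrow> bool" where
  "tri_complete E indep \<G> R \<longleftrightarrow>
     (\<forall>F\<in>flats E indep. \<forall>G\<in>\<G>. F \<subseteq> G \<longrightarrow>
        Cchain E indep R F G \<subseteq> GFG E indep \<G> F G \<union> {F})"

definition Jbelow :: "'a set \<Rightarrow> ('a set \<Rightarrow> bool) \<Rightarrow> 'a set set \<Rightarrow> 'a set \<Rightarrow> 'a set" where
  "Jbelow E indep S G = fjoin E indep {H\<in>S. H \<subset> G}"

definition lam :: "'a set \<Rightarrow> ('a set \<Rightarrow> bool) \<Rightarrow> ('a \<times> 'a) set \<Rightarrow> 'a set set \<Rightarrow> 'a set \<Rightarrow> 'a" where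
  "lam E indep R S G =
     omin R {e\<in>E. mcl E indep (insert e (Jbelow E indep S G)) = G}"

definition is_max_in :: "'a set set \<Rightarrow> 'a set \<Rightarrow> bool" where
  "is_max_in S G \<longleftrightarrow> G \<in> S \<and> \<not>(\<exists>H\<in>S. G \<subset> H)"

definition is_min_in :: "'a set set \<Rightarrow> 'a set \<Rightarrow> bool" where
  "is_min_in S G \<longleftrightarrow> G \<in> S \<and> \<not>(\<exists>H\<in>S. H \<subset> G)"

definition par :: "'a set set \<Rightarrow> 'a set \<Rightarrow> 'a set" where
  "par S G = (THE H. H \<in> S \<and> G \<subset> H \<and> (\<forall>H'\<in>S. G \<subset> H' \<longrightarrow> H \<subseteq> H'))"

definition descent :: "'a set \<Rightarrow> ('a set \<Rightarrow> bool) \<Rightarrow> ('a \<times> 'a) set \<Rightarrow> 'a set set \<Rightarrow> 'a set \<Rightarrow> bool" where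
  "descent E indep R S G \<longleftrightarrow> G \<in> S \<and> \<not> is_max_in S G \<and>
     olt R (lam E indep R S (par S G)) (lam E indep R S G)"

definition bottom_descent :: "'a set \<Rightarrow> ('a set \<Rightarrow> bool) \<Rightarrow> ('a \<times> 'a) set \<Rightarrow> 'a set set \<Rightarrow> 'a set \<Rightarrow> bool" where
  "bottom_descent E indep R S G \<longleftrightarrow> descent E indep R S G \<and> is_min_in S G"

definition double_descent :: "'a set \<Rightarrow> ('a set \<Rightarrow> bool) \<Rightarrow> ('a \<times> 'a) set \<Rightarrow> 'a set set \<Rightarrow> 'a set \<Rightarrow> bool" where
  "double_descent E indep R S G \<longleftrightarrow> descent E indep R S G \<and> \<not> is_min_in S G \<and>
     (\<forall>C\<in>S. \<not> is_max_in S C \<and> par S C = G \<longrightarrow> descent E indep R S C)"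

definition Des :: "'a set \<Rightarrow> ('a set \<Rightarrow> bool) \<Rightarrow> ('a \<times> 'a) set \<Rightarrow> 'a set set \<Rightarrow> 'a set set" where
  "Des E indep R S = {G\<in>S. descent E indep R S G}"

definition stable_max_nested :: "'a set \<Rightarrow> ('a set \<Rightarrow> bool) \<Rightarrow> 'a set set \<Rightarrow> ('a \<times> 'a) set \<Rightarrow> 'a set set set" where
  "stable_max_nested E indep \<G> R =
     {S. max_nested E indep \<G> S \<and>
         \<not>(\<exists>G\<in>S. bottom_descent E indep R S G) \<and> \<not>(\<exists>G\<in>S. double_descent E indep R S G)}"

definition Gamma_cx :: "'a set \<Rightarrow> ('a set \<Rightarrow> bool) \<Rightarrow> 'a set set \<Rightarrow> ('a \<times> 'a) set \<Rightarrow> 'a set set set" where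
  "Gamma_cx E indep \<G> R = Des E indep R ` stable_max_nested E indep \<G> R"

definition Vset :: "'a set \<Rightarrow> ('a set \<Rightarrow> bool) \<Rightarrow> 'a set set \<Rightarrow> ('a \<times> 'a) set \<Rightarrow> 'a set set" where
  "Vset E indep \<G> R = \<G> - (Cchain E indep R {} E \<union> atoms E indep)"

end

theory Submission
  imports Defs "HOL-Library.Poly_Mapping"
begin

text \<open>The Chow ring has the Feichtner-Yuzvinsky monomial basis. This is proved by adding the variables in
  order of decreasing flats: when a minimal F with local rank k is added, the sum s of the variables above F
  satisfies \<open>s\<^sup>k K' \<subseteq> K\<close>, where K and \<open>K'\<close> are the ideals of relations without and with the
  requirement that \<open>x\<^sub>F\<close> divides, so dividing by the monic polynomial \<open>(x\<^sub>F + s)\<^sup>k\<close> splits off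
  \<open>1, x\<^sub>F, \<dots>, x\<^sub>F\<^sup>k\<^sup>-\<^sup>1\<close>. Hence the Chow polynomial is a sum over nested sets D containing E of a product of
  local weights.

  Every such D lies in exactly one maximal nested set S all of whose descents belong to D; by completeness
  the missing elements can be filled in one at a time, in a forced way. Every element of S has at most one
  child that is not a descent, so the interval between the descents of S and S is a product of chains, over
  which the weights sum to \<open>t\<^sup>i (1 + t)\<^sup>d\<^sup>-\<^sup>2\<^sup>i\<close> if S is stable, and to 0
  otherwise, where i is the number of descents and \<open>d = rk E - 1\<close>. Closure under subsets follows by comparing S with the maximal nested set completing a subset B
  of its descents: if some G in B were not a descent there, completeness applied to the local join of G
  would yield an element of the building set meeting two different children of one element.\<close>

section \<open>Matroid rank and closure\<close>

text \<open>The linear relations at atoms do not survive the removal of variables: once the smaller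
  flats are gone, only powers of the sums above larger flats remain. Hence the redundant generators
  \<open>mo m * sig U B ^ dl\<close>, whose exponent is the local rank of B over the support of m
  and N; the set N records divisibility by variables that are no longer in play. The overview's
  inclusion for s is then submodularity of the rank: inserting F lowers a local rank by at most k.

  E is put into every D, so its exponent runs from 0 and all others from 1; this gives the two kinds
  of weights. Filling in is forced because adding the elements of G in order to the join below G
  reaches, just before G, a hyperplane \<open>pre D G\<close> of G. By completeness it is the join
  with a single member of \<G>, so only one of its factors is new, and in any S that adds only
  non-descents to D it is the join below G. For D between the descents and S, the local rank at G is
  one plus the number of consecutive elements missing from D below G in its chain; a descent whose
  chain is a single point has weight 0.\<close>

locale loopless_matroid =
  fixes E :: "'a set" and indep :: "'a set \<Rightarrow> bool"
  assumes is_matroid: "matroid E indep" and is_loopless: "loopless E indep"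
begin

abbreviation rk where "rk \<equiv> mrank indep"
abbreviation cl where "cl \<equiv> mcl E indep"
abbreviation Fl where "Fl \<equiv> flats E indep"

lemma finE: "finite E" using is_matroid by (simp add: matroid_def)
lemma ind_empty: "indep {}" using is_matroid by (simp add: matroid_def)
lemma ind_sub: "indep I \<Longrightarrow> I \<subseteq> E" using is_matroid by (simp add: matroid_def)
lemma ind_mono: "indep J \<Longrightarrow> I \<subseteq> J \<Longrightarrow> indep I"
  by (rule is_matroid[unfolded matroid_def, THEN conjunct2, THEN conjunct2, THEN conjunct2, THEN conjunct1,
      rule_format, OF conjI])
lemma ind_aug: "indep I \<Longrightarrow> indep J \<Longrightarrow> card I < card J \<Longrightarrow> \<exists>e\<in>J - I. indep (insert e I)"
  by (rule is_matroid[unfolded matroid_def, THEN conjunct2, THEN conjunct2, THEN conjunct2, THEN conjunct2,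
      rule_format, OF conjI[OF _ conjI]])
lemma ind_fin: "indep I \<Longrightarrow> finite I" by (rule finite_subset[OF ind_sub finE])

lemma rk_set_fin: "finite {card I | I. I \<subseteq> X \<and> indep I}"
proof (rule finite_subset)
  show "{card I | I. I \<subseteq> X \<and> indep I} \<subseteq> {..card E}"
    using card_mono[OF finE ind_sub] by auto
qed simp

lemma rk_ge: "I \<subseteq> X \<Longrightarrow> indep I \<Longrightarrow> card I \<le> rk X"
  unfolding mrank_def by (rule Max_ge[OF rk_set_fin]) blast

lemma rk_basis: obtains I where "I \<subseteq> X" "indep I" "card I = rk X"
proof -
  have "rk X \<in> {card I | I. I \<subseteq> X \<and> indep I}"
    unfolding mrank_def by (rule Max_in[OF rk_set_fin]) (use ind_empty in blast)
  then obtain I where "rk X = card I" "I \<subseteq> X" "indep I" by blast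
  then show ?thesis by (intro that[of I]) simp_all
qed

lemma basis_extend:
  assumes "indep I" "I \<subseteq> X" obtains B where "I \<subseteq> B" "B \<subseteq> X" "indep B" "card B = rk X"
proof -
  have "\<exists>B. I \<subseteq> B \<and> B \<subseteq> X \<and> indep B \<and> card B = rk X"
    using assms
  proof (induction "rk X - card I" arbitrary: I rule: less_induct)
    case less
    show ?case
    proof (cases "card I = rk X")
      case True then show ?thesis using less.prems by blast
    next
      case False
      then have lt: "card I < rk X" using rk_ge[OF less.prems(2,1)] by simp
      obtain K where K: "K \<subseteq> X" "indep K" "card K = rk X" by (rule rk_basis)
      obtain e where e: "e \<in> K - I" "indep (insert e I)" using ind_aug[OF less.prems(1) K(2)] lt K(3) by auto
      have c: "card (insert e I) = Suc (card I)" using e ind_fin[OF less.prems(1)] by simp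
      have "\<exists>B. insert e I \<subseteq> B \<and> B \<subseteq> X \<and> indep B \<and> card B = rk X"
        by (rule less.hyps) (use c lt e K less.prems in auto)
      then show ?thesis by blast
    qed
  qed
  then show ?thesis using that by blast
qed

lemma rk_mono: "X \<subseteq> Y \<Longrightarrow> rk X \<le> rk Y"
proof -
  assume "X \<subseteq> Y"
  moreover obtain I where "I \<subseteq> X" "indep I" "card I = rk X" by (rule rk_basis)
  ultimately show ?thesis using rk_ge[of I Y] by auto
qed

text \<open>Extend a basis of the intersection to a basis B of the union; B meets X and Y in
  independent sets whose overlap contains the first basis.\<close>

lemma rk_submod: "rk (X \<union> Y) + rk (X \<inter> Y) \<le> rk X + rk Y"
proof -
  obtain I where I: "I \<subseteq> X \<inter> Y" "indep I" "card I = rk (X \<inter> Y)" by (rule rk_basis)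
  obtain B where B: "I \<subseteq> B" "B \<subseteq> X \<union> Y" "indep B" "card B = rk (X \<union> Y)"
    using basis_extend[of I "X \<union> Y"] I by auto
  have fB: "finite B" by (rule ind_fin[OF B(3)])
  have 1: "card (B \<inter> X) \<le> rk X" "card (B \<inter> Y) \<le> rk Y"
    using rk_ge ind_mono[OF B(3)] by (meson inf_le1 inf_le2)+
  have "B \<inter> X \<union> B \<inter> Y = B" using B by auto
  then have "card (B \<inter> X) + card (B \<inter> Y) = card B + card (B \<inter> X \<inter> (B \<inter> Y))"
    using card_Un_Int[of "B \<inter> X" "B \<inter> Y"] fB by simp
  moreover have "card I \<le> card (B \<inter> X \<inter> (B \<inter> Y))" by (rule card_mono) (use fB I B in auto)
  ultimately show ?thesis using 1 I B by linarith
qed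

lemma rk_submod_le: "Z \<subseteq> X \<inter> Y \<Longrightarrow> rk (X \<union> Y) + rk Z \<le> rk X + rk Y"
  using rk_submod[of X Y] rk_mono[of Z "X \<inter> Y"] by linarith

lemma rk_empty [simp]: "rk {} = 0"
proof -
  obtain I where "I \<subseteq> {}" "indep I" "card I = rk {}" by (rule rk_basis)
  then show ?thesis by simp
qed

lemma rk_single: "e \<in> E \<Longrightarrow> rk {e} = 1"
proof -
  assume e: "e \<in> E"
  obtain I where "I \<subseteq> {e}" "indep I" "card I = rk {e}" by (rule rk_basis)
  then have "rk {e} \<le> 1" using card_mono[of "{e}" I] by simp
  moreover have "card {e} \<le> rk {e}" by (rule rk_ge) (use e is_loopless in \<open>auto simp: loopless_def\<close>)
  ultimately show ?thesis by simp
qed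

lemma rk_insert: "e \<in> E \<Longrightarrow> rk (insert e X) \<le> Suc (rk X)"
  using rk_submod_le[of "{}" X "{e}"] rk_single[of e] by simp

lemma cl_sub_E: "cl X \<subseteq> E" by (auto simp: mcl_def)
lemma cl_ext: "X \<subseteq> E \<Longrightarrow> X \<subseteq> cl X" by (auto simp: mcl_def insert_absorb)

lemma cl_mono: assumes "X \<subseteq> Y" shows "cl X \<subseteq> cl Y"
proof
  fix e assume e: "e \<in> cl X"
  have "rk (Y \<union> insert e X) + rk X \<le> rk Y + rk (insert e X)" by (rule rk_submod_le) (use assms in auto)
  moreover have "Y \<union> insert e X = insert e Y" using assms by auto
  ultimately have "rk (insert e Y) \<le> rk Y" using e by (simp add: mcl_def)
  then show "e \<in> cl Y" using e rk_mono[OF subset_insertI, of Y e] by (simp add: mcl_def)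
qed

lemma rk_cl_Un: "finite Z \<Longrightarrow> Z \<subseteq> cl X \<Longrightarrow> rk (X \<union> Z) = rk X"
proof (induction Z rule: finite_induct)
  case (insert e Z)
  have "e \<in> cl (X \<union> Z)" using insert cl_mono[of X "X \<union> Z"] by auto
  then show ?case using insert by (simp add: mcl_def)
qed simp

lemma rk_cl: "rk (cl X) = rk X"
proof -
  have "rk (X \<union> cl X) = rk X" by (rule rk_cl_Un) (use finite_subset[OF cl_sub_E finE] in auto)
  moreover obtain I where "I \<subseteq> X" "indep I" "card I = rk X" by (rule rk_basis)
  \<comment> \<open>X is not assumed to lie in E, but independent sets do; the comparison passes
    through \<open>X \<inter> E\<close>, which \<open>cl X\<close> contains.\<close>
  then have "rk (X \<inter> E) \<ge> rk X" using rk_ge[of I "X \<inter> E"] ind_sub[of I] by simp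
  moreover have "X \<inter> E \<subseteq> cl X" using cl_ext[of "X \<inter> E"] cl_mono[of "X \<inter> E" X] by auto
  ultimately show ?thesis using rk_mono[of "X \<inter> E" "cl X"] rk_mono[of "cl X" "X \<union> cl X"] by simp
qed

lemma cl_idem: assumes "X \<subseteq> E" shows "cl (cl X) = cl X"
proof
  show "cl (cl X) \<subseteq> cl X"
  proof
    fix e assume e: "e \<in> cl (cl X)"
    have "rk (insert e X) \<le> rk (insert e (cl X))" by (rule rk_mono) (use cl_ext assms in auto)
    then have "rk (insert e X) \<le> rk X" using e rk_cl[of X] by (simp add: mcl_def)
    then show "e \<in> cl X" using e rk_mono[OF subset_insertI, of X e] by (simp add: mcl_def)
  qed
qed (use cl_ext cl_sub_E in auto)

lemma Fl_E: "F \<in> Fl \<Longrightarrow> F \<subseteq> E" and Fl_cl: "F \<in> Fl \<Longrightarrow> cl F = F" by (auto simp: flats_def)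
lemma cl_Fl: "X \<subseteq> E \<Longrightarrow> cl X \<in> Fl" by (simp add: flats_def cl_idem cl_sub_E)
lemma cl_least: "X \<subseteq> F \<Longrightarrow> F \<in> Fl \<Longrightarrow> cl X \<subseteq> F" using cl_mono Fl_cl by blast
lemma cl_empty: "cl {} = {}" using rk_single by (force simp: mcl_def)
lemma empty_Fl: "{} \<in> Fl" using cl_empty by (simp add: flats_def)
lemma Fl_fin: "F \<in> Fl \<Longrightarrow> finite F" by (rule finite_subset[OF Fl_E finE])
lemma finFl: "finite Fl" using finE by (auto simp: flats_def)

lemma rk_flat_insert: "F \<in> Fl \<Longrightarrow> e \<in> E \<Longrightarrow> e \<notin> F \<Longrightarrow> rk (insert e F) = Suc (rk F)"
proof -
  assume a: "F \<in> Fl" "e \<in> E" "e \<notin> F"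
  have "rk (insert e F) \<noteq> rk F" using a Fl_cl[OF a(1)] by (auto simp: mcl_def)
  then show ?thesis using rk_mono[of F "insert e F"] rk_insert[OF a(2), of F] by fastforce
qed

lemma rk_strict: "F \<in> Fl \<Longrightarrow> F \<subset> G \<Longrightarrow> G \<subseteq> E \<Longrightarrow> rk F < rk G"
proof -
  assume a: "F \<in> Fl" "F \<subset> G" "G \<subseteq> E"
  then obtain e where e: "e \<in> G" "e \<notin> F" by auto
  have "Suc (rk F) = rk (insert e F)" using rk_flat_insert a e by auto
  also have "\<dots> \<le> rk G" by (rule rk_mono) (use a e in auto)
  finally show ?thesis by simp
qed

lemma rk_pos: "X \<subseteq> E \<Longrightarrow> X \<noteq> {} \<Longrightarrow> 0 < rk X" using rk_strict[OF empty_Fl, of X] by (simp add: psubset_eq)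

lemma cl_eq_of_rk: "X \<subseteq> F \<Longrightarrow> F \<in> Fl \<Longrightarrow> rk F \<le> rk X \<Longrightarrow> cl X = F"
proof -
  assume a: "X \<subseteq> F" "F \<in> Fl" "rk F \<le> rk X"
  have XE: "X \<subseteq> E" using a Fl_E by auto
  have "cl X \<subseteq> F" using cl_least a by auto
  moreover have "\<not> cl X \<subset> F" using rk_strict[OF cl_Fl[OF XE], of F] a rk_cl[of X] Fl_E by auto
  ultimately show ?thesis by auto
qed

lemma cl_Un_cl: "X \<subseteq> E \<Longrightarrow> Y \<subseteq> E \<Longrightarrow> cl (X \<union> cl Y) = cl (X \<union> Y)"
proof
  assume a: "X \<subseteq> E" "Y \<subseteq> E"
  show "cl (X \<union> cl Y) \<subseteq> cl (X \<union> Y)"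
    by (rule cl_least) (use a cl_Fl cl_mono[of Y "X \<union> Y"] cl_ext[of "X \<union> Y"] in auto)
  show "cl (X \<union> Y) \<subseteq> cl (X \<union> cl Y)" by (rule cl_mono) (use a cl_ext in auto)
qed

lemma atom_iff: "a \<in> atoms E indep \<longleftrightarrow> (\<exists>e\<in>E. a = cl {e})"
proof
  assume a: "a \<in> atoms E indep"
  then have fl: "a \<in> Fl" and r: "rk a = 1" by (auto simp: atoms_def)
  have "a \<noteq> {}" using r by auto
  then obtain e where e: "e \<in> a" by auto
  then have "e \<in> E" using Fl_E[OF fl] by auto
  then have "cl {e} = a" using cl_eq_of_rk[of "{e}" a] fl r rk_single[of e] e by simp
  then show "\<exists>e\<in>E. a = cl {e}" using e fl Fl_E by blast
next
  assume "\<exists>e\<in>E. a = cl {e}"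
  then show "a \<in> atoms E indep" using cl_Fl rk_cl rk_single by (auto simp: atoms_def)
qed

end

section \<open>Building sets\<close>

locale building = loopless_matroid +
  fixes \<G> :: "'a set set"
  assumes is_building: "building_set E indep \<G>"
begin

lemma G_Fl: "G \<in> \<G> \<Longrightarrow> G \<in> Fl" and G_ne: "G \<in> \<G> \<Longrightarrow> G \<noteq> {}"
  using is_building by (auto simp: building_set_def)
lemma G_E: "G \<in> \<G> \<Longrightarrow> G \<subseteq> E" using G_Fl Fl_E by blast
lemma finG: "finite \<G>" using finFl G_Fl by (meson finite_subset subsetI)

lemma UG_E: "T \<subseteq> \<G> \<Longrightarrow> \<Union>T \<subseteq> E" using G_E by blast

abbreviation factors where "factors \<equiv> maxs_below \<G>"

lemma facsD: assumes "K \<in> factors F"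
  shows "K \<in> \<G>" "K \<subseteq> F" "\<And>H. H \<in> \<G> \<Longrightarrow> H \<subseteq> F \<Longrightarrow> K \<subseteq> H \<Longrightarrow> H = K"
  using assms by (auto simp: maxs_below_def)

lemma facsI: "K \<in> \<G> \<Longrightarrow> K \<subseteq> F \<Longrightarrow> (\<And>H. H \<in> \<G> \<Longrightarrow> H \<subseteq> F \<Longrightarrow> K \<subseteq> H \<Longrightarrow> H = K) \<Longrightarrow> K \<in> factors F"
  by (auto simp: maxs_below_def)

lemma factors_sub: "factors F \<subseteq> \<G>" by (auto simp: maxs_below_def)
lemma factors_fin: "finite (factors F)" using factors_sub finG by (rule finite_subset)

lemma factors_above: assumes "H \<in> \<G>" "H \<subseteq> F" obtains K where "K \<in> factors F" "H \<subseteq> K"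
proof -
  let ?A = "{G\<in>\<G>. G \<subseteq> F \<and> H \<subseteq> G}"
  have "finite ?A" "?A \<noteq> {}" using finG assms by auto
  then obtain K where K: "K \<in> ?A" "\<And>G. G \<in> ?A \<Longrightarrow> K \<subseteq> G \<Longrightarrow> G = K"
    using finite_has_maximal[of ?A] by (metis (no_types, lifting))
  have "K \<in> factors F"
  proof (rule facsI)
    fix G assume "G \<in> \<G>" "G \<subseteq> F" "K \<subseteq> G"
    then show "G = K" using K(1) by (intro K(2)) auto
  qed (use K(1) in auto)
  then show ?thesis using K(1) by (intro that) auto
qed

lemma join_props:
  assumes "F \<in> Fl" "F \<noteq> {}"
  defines "P \<equiv> \<Pi>\<^sub>E G\<in>factors F. {H\<in>Fl. H \<subseteq> G}"
  defines "j \<equiv> \<lambda>x. cl (\<Union>(x ` factors F))"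
  shows "bij_betw j P {H\<in>Fl. H \<subseteq> F}" "\<And>x y. x \<in> P \<Longrightarrow> y \<in> P \<Longrightarrow> j x \<subseteq> j y \<longleftrightarrow> (\<forall>G\<in>factors F. x G \<subseteq> y G)"
  using is_building assms unfolding building_set_def Let_def fjoin_def P_def j_def by auto

text \<open>Tuple of the product of intervals with H at the factor K and the bottom elsewhere. Its
  join is \<open>cl H\<close>, so the order isomorphism can be tested on one factor at a
  time.\<close>

definition one_at :: "'a set \<Rightarrow> 'a set \<Rightarrow> 'a set \<Rightarrow> 'a set \<Rightarrow> 'a set" where
  "one_at F K H = restrict (\<lambda>M. if M = K then H else {}) (factors F)"

lemma one_at_in: "K \<in> factors F \<Longrightarrow> H \<in> Fl \<Longrightarrow> H \<subseteq> K \<Longrightarrow> one_at F K H \<in> (\<Pi>\<^sub>E G\<in>factors F. {H\<in>Fl. H \<subseteq> G})"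
  using empty_Fl by (auto simp: one_at_def)

lemma one_at_Un: "K \<in> factors F \<Longrightarrow> \<Union>(one_at F K H ` factors F) = H"
  by (auto simp: one_at_def split: if_splits)

lemma one_at_self: "K \<in> factors F \<Longrightarrow> one_at F K H K = H" by (simp add: one_at_def)
lemma one_at_other: "M \<in> factors F \<Longrightarrow> M \<noteq> K \<Longrightarrow> one_at F K H M = {}" by (simp add: one_at_def)

text \<open>For a common point e, the flat \<open>cl {e}\<close> is the join of two tuples, one
  supported at K and one at M; comparing them at K would put \<open>cl {e}\<close> below the empty
  flat.\<close>

lemma factors_disjoint:
  assumes F: "F \<in> Fl" and K: "K \<in> factors F" "M \<in> factors F" "K \<noteq> M" shows "K \<inter> M = {}"
proof (rule ccontr)
  assume "K \<inter> M \<noteq> {}"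
  then obtain e where e: "e \<in> K" "e \<in> M" by auto
  have eE: "e \<in> E" using e facsD(1)[OF K(1)] G_E by auto
  let ?a = "cl {e}"
  have a: "?a \<in> Fl" "?a \<subseteq> K" "?a \<subseteq> M" "e \<in> ?a"
    using eE e cl_Fl[of "{e}"] cl_least[of "{e}"] G_Fl facsD(1) K cl_ext[of "{e}"] by auto
  have ne: "F \<noteq> {}" using e facsD(2)[OF K(1)] by auto
  have "one_at F K ?a K \<subseteq> one_at F M ?a K"
    using join_props(2)[OF F ne one_at_in[OF K(1) a(1,2)] one_at_in[OF K(2) a(1,3)]] K
    by (simp only: one_at_Un) blast
  then show False using K a one_at_self one_at_other by auto
qed

text \<open>Without factors the product of intervals would be a single point, while the interval
  below an atom has two. So some member of \<G> lies below the atom, and rank 1 forces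
  equality.\<close>

lemma atom_G: assumes "e \<in> E" shows "cl {e} \<in> \<G>"
proof -
  let ?a = "cl {e}"
  have a: "?a \<in> Fl" "e \<in> ?a" using assms cl_Fl[of "{e}"] cl_ext[of "{e}"] by auto
  then have ne: "?a \<noteq> {}" by auto
  have "factors ?a \<noteq> {}"
  proof
    assume "factors ?a = {}"
    then have "bij_betw (\<lambda>x. cl {}) ({\<lambda>x. undefined} :: ('a set \<Rightarrow> 'a set) set) {H\<in>Fl. H \<subseteq> ?a}" using join_props(1)[OF a(1) ne]
      by (simp add: PiE_empty_domain)
    then have "{H\<in>Fl. H \<subseteq> ?a} = {cl {}}" by (auto simp: bij_betw_def)
    moreover have "?a \<in> {H\<in>Fl. H \<subseteq> ?a}" using a by auto
    ultimately show False using ne cl_empty by auto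
  qed
  then obtain K where K: "K \<in> \<G>" "K \<subseteq> ?a" using facsD by blast
  have "rk ?a \<le> rk K" using rk_pos[OF G_E[OF K(1)] G_ne[OF K(1)]] rk_cl[of "{e}"] rk_single[OF assms] by simp
  then have "cl K = ?a" by (rule cl_eq_of_rk[OF K(2) a(1)])
  then show ?thesis using K Fl_cl[OF G_Fl[OF K(1)]] by simp
qed

lemma factors_Un: assumes "F \<in> Fl" shows "\<Union>(factors F) = F"
proof
  show "\<Union>(factors F) \<subseteq> F" using facsD(2) by blast
  show "F \<subseteq> \<Union>(factors F)"
  proof
    fix e assume e: "e \<in> F"
    then have eE: "e \<in> E" using Fl_E assms by auto
    have "cl {e} \<subseteq> F" using e assms by (intro cl_least) auto
    then obtain K where "K \<in> factors F" "cl {e} \<subseteq> K" using factors_above[OF atom_G[OF eE]] by metis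
    then show "e \<in> \<Union>(factors F)" using cl_ext[of "{e}"] eE by auto
  qed
qed

lemma factors_empty: "factors {} = {}" using facsD G_ne by blast

text \<open>The join of flats chosen one in each factor is their plain union: a point e of the
  closure lies in a single factor K, and comparing the tuple of \<open>cl {e}\<close> with y at K
  puts e into \<open>y K\<close>. This is what allows joins of nested sets to be written as
  unions.\<close>

lemma union_flat:
  assumes F: "F \<in> Fl" and y: "\<And>K. K \<in> factors F \<Longrightarrow> y K \<in> Fl \<and> y K \<subseteq> K"
  shows "\<Union>(y ` factors F) \<in> Fl"
proof (cases "F = {}")
  case True then show ?thesis using factors_empty empty_Fl by simp
next
  case ne: False
  have U: "\<Union>(y ` factors F) \<subseteq> F" using y facsD(2) by blast
  have "cl (\<Union>(y ` factors F)) \<subseteq> \<Union>(y ` factors F)"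
  proof
    fix e assume e: "e \<in> cl (\<Union>(y ` factors F))"
    then have eF: "e \<in> F" using cl_least[OF U F] by auto
    then have eE: "e \<in> E" using Fl_E F by auto
    obtain K where K: "K \<in> factors F" "e \<in> K" using factors_Un[OF F] eF by auto
    let ?a = "cl {e}"
    have a: "?a \<in> Fl" "?a \<subseteq> K" "e \<in> ?a"
      using eE K cl_Fl[of "{e}"] cl_least[of "{e}" K] G_Fl facsD(1) cl_ext[of "{e}"] by auto
    have 1: "restrict y (factors F) \<in> (\<Pi>\<^sub>E G\<in>factors F. {H\<in>Fl. H \<subseteq> G})" using y by auto
    have 2: "\<Union>(restrict y (factors F) ` factors F) = \<Union>(y ` factors F)" by auto
    have UE: "\<Union>(y ` factors F) \<subseteq> E" using U Fl_E F by blast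
    have "cl (\<Union>(one_at F K ?a ` factors F)) \<subseteq> cl (\<Union>(restrict y (factors F) ` factors F))"
      unfolding 2 one_at_Un[OF K(1)] using e cl_Fl[OF UE] by (intro cl_least[of ?a] cl_least[of "{e}"]) auto
    then have "one_at F K ?a K \<subseteq> restrict y (factors F) K"
      using join_props(2)[OF F ne one_at_in[OF K(1) a(1,2)] 1] K by blast
    then show "e \<in> \<Union>(y ` factors F)" using K a one_at_self[OF K(1)] by auto
  qed
  moreover have "\<Union>(y ` factors F) \<subseteq> E" using U Fl_E F by blast
  ultimately show ?thesis using cl_ext[of "\<Union>(y ` factors F)"] by (simp add: flats_def subset_antisym)
qed

text \<open>The factors of the join that contain G and H meet, hence coincide; this one factor
  contains both sets and so is the whole join.\<close>

lemma join_in: assumes "G \<in> \<G>" "H \<in> \<G>" "G \<inter> H \<noteq> {}" shows "cl (G \<union> H) \<in> \<G>"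
proof -
  let ?F = "cl (G \<union> H)"
  have GH: "G \<union> H \<subseteq> E" using assms G_E by auto
  have F: "?F \<in> Fl" "G \<subseteq> ?F" "H \<subseteq> ?F" using cl_Fl[OF GH] cl_ext[OF GH] by auto
  obtain K where K: "K \<in> factors ?F" "G \<subseteq> K" using factors_above[OF assms(1) F(2)] by metis
  obtain M where M: "M \<in> factors ?F" "H \<subseteq> M" using factors_above[OF assms(2) F(3)] by metis
  have "K = M" using factors_disjoint[OF F(1) K(1) M(1)] K M assms by auto
  then have "?F \<subseteq> K" using K M G_Fl facsD(1) by (intro cl_least) auto
  then show ?thesis using facsD[OF K(1)] by auto
qed

lemma in_one_fac: assumes "F \<in> Fl" "H \<in> \<G>" "H \<subseteq> F" "K \<in> factors F" "H \<inter> K \<noteq> {}" shows "H \<subseteq> K"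
proof -
  obtain M where M: "M \<in> factors F" "H \<subseteq> M" using factors_above assms by metis
  then have "M = K" using factors_disjoint[OF assms(1) M(1) assms(4)] assms by auto
  then show ?thesis using M by auto
qed

text \<open>Induction on the sum of the ranks. One nonempty \<open>y K\<close> is replaced by a
  hyperplane of it; the removed point lies outside the new union because factors are disjoint, so
  both sides drop by exactly 1.\<close>

lemma rk_disjoint_Un:
  assumes F: "F \<in> Fl" and S: "S \<subseteq> factors F" and y: "\<And>K. K \<in> S \<Longrightarrow> y K \<in> Fl \<and> y K \<subseteq> K"
  shows "\<Union>(y ` S) \<in> Fl \<and> rk (\<Union>(y ` S)) = (\<Sum>K\<in>S. rk (y K))"
proof -
  have fS: "finite S" using S factors_fin finite_subset by blast
  have fl: "\<Union>(z ` S) \<in> Fl" if z: "\<And>K. K \<in> S \<Longrightarrow> z K \<in> Fl \<and> z K \<subseteq> K" for z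
  proof -
    have "\<Union>((\<lambda>K. if K \<in> S then z K else {}) ` factors F) \<in> Fl"
      by (rule union_flat[OF F]) (use z empty_Fl in auto)
    moreover have "\<Union>((\<lambda>K. if K \<in> S then z K else {}) ` factors F) = \<Union>(z ` S)" using S by (auto split: if_splits)
    ultimately show ?thesis by simp
  qed
  have "rk (\<Union>(y ` S)) = (\<Sum>K\<in>S. rk (y K))"
    using y
  proof (induction "\<Sum>K\<in>S. rk (y K)" arbitrary: y rule: less_induct)
    case less
    show ?case
    proof (cases "\<forall>K\<in>S. y K = {}")
      case True
      then have "\<Union>(y ` S) = {}" by auto
      then show ?thesis using True by simp
    next
      case False
      then obtain K where K: "K \<in> S" "y K \<noteq> {}" by auto
      obtain B where B: "B \<subseteq> y K" "indep B" "card B = rk (y K)" by (rule rk_basis)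
      have KE: "y K \<subseteq> E" using less.prems K Fl_E by auto
      have "0 < card B" using B rk_pos[OF KE] K by simp
      then obtain e where e: "e \<in> B" by fastforce
      have eE: "e \<in> E" using e B KE by auto
      \<comment> \<open>A hyperplane of \<open>y K\<close>: the span of a basis without one of its
        points.\<close>
      let ?z = "cl (B - {e})"
      have BE: "B - {e} \<subseteq> E" "B \<subseteq> E" using B KE by auto
      have z: "?z \<in> Fl" "?z \<subseteq> y K" using cl_Fl[OF BE(1)] cl_least[of "B - {e}" "y K"] B K less.prems by auto
      have rz: "rk ?z = rk (y K) - 1"
      proof -
        have "rk (B - {e}) \<ge> card (B - {e})" by (rule rk_ge) (use B ind_mono in auto)
        moreover obtain I where "I \<subseteq> B - {e}" "indep I" "card I = rk (B - {e})" by (rule rk_basis)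
        then have "rk (B - {e}) \<le> card (B - {e})" using card_mono[of "B - {e}" I] ind_fin[OF B(2)] by auto
        ultimately show ?thesis using rk_cl[of "B - {e}"] B e ind_fin[OF B(2)] by simp
      qed
      have pos: "0 < rk (y K)" using \<open>0 < card B\<close> B by simp
      have yK: "cl (insert e ?z) = y K"
      proof -
        have "rk (insert e (B - {e})) \<ge> card B" by (rule rk_ge) (use e B in \<open>auto simp: insert_absorb\<close>)
        moreover have "insert e (B - {e}) \<subseteq> insert e ?z" using cl_ext[OF BE(1)] by auto
        ultimately have "rk (y K) \<le> rk (insert e ?z)" using rk_mono[of "insert e (B - {e})" "insert e ?z"] B by linarith
        then show ?thesis using cl_eq_of_rk[of "insert e ?z" "y K"] z e B K less.prems by auto
      qed
      have enz: "e \<notin> ?z"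
      proof
        assume "e \<in> ?z"
        then have "cl (insert e ?z) = ?z" using Fl_cl[OF z(1)] by (simp add: insert_absorb)
        then show False using yK rz pos by simp
      qed
      let ?y = "y(K := ?z)"
      have y': "?y M \<in> Fl \<and> ?y M \<subseteq> M" if "M \<in> S" for M using less.prems[OF that] z that less.prems[OF K(1)] by auto
      have sum: "(\<Sum>M\<in>S. rk (?y M)) = (\<Sum>M\<in>S - {K}. rk (y M)) + rk ?z"
        "(\<Sum>M\<in>S. rk (y M)) = (\<Sum>M\<in>S - {K}. rk (y M)) + rk (y K)"
        using sum.remove[OF fS K(1), of "\<lambda>M. rk (?y M)"] sum.remove[OF fS K(1), of "\<lambda>M. rk (y M)"] by simp_all
      have IH: "rk (\<Union>(?y ` S)) = (\<Sum>M\<in>S. rk (?y M))"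
        by (rule less.hyps) (use sum rz pos y' in auto)
      have "e \<notin> \<Union>(?y ` S)"
      proof
        assume "e \<in> \<Union>(?y ` S)"
        then obtain M where M: "M \<in> S" "e \<in> ?y M" unfolding UN_iff by blast
        then have "M \<noteq> K" using enz by auto
        then have "e \<in> y M" using M by auto
        then have "e \<in> M" "e \<in> K" using M less.prems[OF M(1)] less.prems[OF K(1)] e B by auto
        then show False using factors_disjoint[OF F, of K M] K M S \<open>M \<noteq> K\<close> by auto
      qed
      then have r: "rk (insert e (\<Union>(?y ` S))) = Suc (rk (\<Union>(?y ` S)))" using rk_flat_insert[OF fl[OF y'] eE] by auto
      have flU: "\<Union>(y ` S) \<in> Fl" using fl less.prems by blast
      have sub: "insert e (\<Union>(?y ` S)) \<subseteq> \<Union>(y ` S)" using z K e B by (auto split: if_splits)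
      have "\<Union>(y ` S) \<subseteq> cl (insert e (\<Union>(?y ` S)))"
      proof
        fix x assume "x \<in> \<Union>(y ` S)"
        then obtain M where M: "M \<in> S" "x \<in> y M" by auto
        have E: "insert e (\<Union>(?y ` S)) \<subseteq> E" using sub flU Fl_E by blast
        show "x \<in> cl (insert e (\<Union>(?y ` S)))"
        proof (cases "M = K")
          case True
          have "cl (insert e ?z) \<subseteq> cl (insert e (\<Union>(?y ` S)))" by (rule cl_mono) (use K in auto)
          then show ?thesis using yK True M by auto
        next
          case False
          then have "x \<in> insert e (\<Union>(?y ` S))" using M by auto
          then show ?thesis using cl_ext[OF E] by auto
        qed
      qed
      then have "rk (\<Union>(y ` S)) = rk (insert e (\<Union>(?y ` S)))"
        using rk_mono[OF sub] rk_mono[of "\<Union>(y ` S)" "cl (insert e (\<Union>(?y ` S)))"] rk_cl by simp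
      then show ?thesis using r IH sum rz pos by simp
    qed
  qed
  then show ?thesis using fl y by blast
qed

section \<open>Nested sets\<close>

abbreviation nst where "nst \<equiv> nested E indep \<G>"

text \<open>For nested S the union is already a flat, so \<open>J S G\<close> is the join that the paper calls \<open>J\<^sup>G\<close>.\<close>

definition J :: "'a set set \<Rightarrow> 'a set \<Rightarrow> 'a set" where "J S G = \<Union>{H\<in>S. H \<subset> G}"
text \<open>The local rank of G over S, for G in S or not. It bounds the exponents in the monomial
  basis, and a nested set containing E is maximal exactly when it is 1 at every member.\<close>

definition dl :: "'a set set \<Rightarrow> 'a set \<Rightarrow> nat" where "dl S G = rk G - rk (J S G)"

lemma nst_iff: "nst S \<longleftrightarrow> S \<subseteq> \<G> \<and> (\<forall>T\<subseteq>S. antichain_sets T \<and> 2 \<le> card T \<longrightarrow> cl (\<Union>T) \<notin> \<G>)"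
proof
  assume n: "nst S"
  then have "S \<subseteq> \<G>" by (simp add: nested_def)
  moreover have "cl (\<Union>T) \<notin> \<G>" if "T \<subseteq> S" "antichain_sets T" "2 \<le> card T" for T
  proof -
    have "finite T" using that(3) card.infinite by fastforce
    then show ?thesis using n that unfolding nested_def fjoin_def by blast
  qed
  ultimately show "S \<subseteq> \<G> \<and> (\<forall>T\<subseteq>S. antichain_sets T \<and> 2 \<le> card T \<longrightarrow> cl (\<Union>T) \<notin> \<G>)" by blast
next
  assume a: "S \<subseteq> \<G> \<and> (\<forall>T\<subseteq>S. antichain_sets T \<and> 2 \<le> card T \<longrightarrow> cl (\<Union>T) \<notin> \<G>)"
  have "fjoin E indep T \<notin> \<G>" if "A \<subseteq> S" "antichain_sets A" "T \<subseteq> A" "2 \<le> card T" for A T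
  proof -
    have "antichain_sets T" using that unfolding antichain_sets_def by blast
    then show ?thesis using a that unfolding fjoin_def by blast
  qed
  then show "nst S" using a unfolding nested_def by blast
qed

lemma nstG: "nst S \<Longrightarrow> S \<subseteq> \<G>" by (simp add: nested_def)
lemma nst_fin: "nst S \<Longrightarrow> finite S" using nstG finG finite_subset by blast
lemma nst_antichain: "nst S \<Longrightarrow> T \<subseteq> S \<Longrightarrow> antichain_sets T \<Longrightarrow> 2 \<le> card T \<Longrightarrow> cl (\<Union>T) \<notin> \<G>"
  by (simp add: nst_iff)
lemma nst_sub: "nst S \<Longrightarrow> T \<subseteq> S \<Longrightarrow> nst T" unfolding nst_iff by (meson subset_trans)

lemma nst_cmp: assumes "nst S" "G \<in> S" "H \<in> S" "G \<inter> H \<noteq> {}" shows "G \<subseteq> H \<or> H \<subseteq> G"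
proof (rule ccontr)
  assume a: "\<not> (G \<subseteq> H \<or> H \<subseteq> G)"
  then have "card {G,H} = 2" by (metis card_2_iff order_refl)
  moreover have "antichain_sets {G,H}" using a by (auto simp: antichain_sets_def)
  ultimately have "cl (\<Union>{G,H}) \<notin> \<G>" using assms by (intro nst_antichain) auto
  moreover have "G \<in> \<G>" "H \<in> \<G>" using assms nstG by auto
  ultimately show False using join_in[of G H] assms by auto
qed

text \<open>Each factor M of the join is the join of the members of T below it, since unions taken
  over the factors are flats. As M lies in \<G>, nestedness leaves exactly one such member, and it
  is M.\<close>

lemma nst_antichain_factors:
  assumes n: "nst S" and T: "T \<subseteq> S" "antichain_sets T"
  shows "factors (cl (\<Union>T)) = T" "\<Union>T \<in> Fl"
proof -
  let ?F = "cl (\<Union>T)"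
  have TG: "T \<subseteq> \<G>" using T nstG[OF n] by auto
  have UE: "\<Union>T \<subseteq> E" using UG_E[OF TG] .
  have F: "?F \<in> Fl" using cl_Fl[OF UE] .
  have TF: "K \<subseteq> ?F" if "K \<in> T" for K using cl_ext[OF UE] that by auto
  let ?y = "\<lambda>M. cl (\<Union>{K\<in>T. K \<subseteq> M})"
  have yM: "?y M \<in> Fl \<and> ?y M \<subseteq> M" if "M \<in> factors ?F" for M
  proof -
    have "\<Union>{K\<in>T. K \<subseteq> M} \<subseteq> E" using UE by auto
    then show ?thesis using cl_Fl cl_least[of "\<Union>{K\<in>T. K \<subseteq> M}" M] G_Fl[OF facsD(1)[OF that]] by blast
  qed
  have fl: "\<Union>(?y ` factors ?F) \<in> Fl" by (rule union_flat[OF F yM])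
  have "\<Union>T \<subseteq> \<Union>(?y ` factors ?F)"
  proof
    fix x assume "x \<in> \<Union>T"
    then obtain K where K: "K \<in> T" "x \<in> K" by auto
    then obtain M where M: "M \<in> factors ?F" "K \<subseteq> M" using factors_above[OF _ TF[OF K(1)]] TG by (metis subsetD)
    have "\<Union>{K\<in>T. K \<subseteq> M} \<subseteq> E" using UE by auto
    then have "K \<subseteq> ?y M" using cl_ext[of "\<Union>{K\<in>T. K \<subseteq> M}"] K M by auto
    then show "x \<in> \<Union>(?y ` factors ?F)" using M K by blast
  qed
  then have Fsub: "?F \<subseteq> \<Union>(?y ` factors ?F)" using fl by (intro cl_least)
  have inT: "M \<in> T" if M: "M \<in> factors ?F" for M
  proof -
    have "M \<subseteq> ?y M"
    proof
      fix x assume x: "x \<in> M"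
      then obtain M' where M': "M' \<in> factors ?F" "x \<in> ?y M'" using Fsub facsD(2)[OF M] by blast
      then have "x \<in> M'" using yM[OF M'(1)] by auto
      then have "M' = M" using factors_disjoint[OF F M'(1) M] x by auto
      then show "x \<in> ?y M" using M' by simp
    qed
    then have eq: "?y M = M" using yM[OF M] by auto
    have MG: "M \<in> \<G>" using facsD(1)[OF M] .
    have ac: "antichain_sets {K\<in>T. K \<subseteq> M}" using T(2) unfolding antichain_sets_def by auto
    have "\<not> 2 \<le> card {K\<in>T. K \<subseteq> M}" using nst_antichain[OF n _ ac] eq MG T by auto
    moreover have "{K\<in>T. K \<subseteq> M} \<noteq> {}"
    proof
      assume "{K\<in>T. K \<subseteq> M} = {}"
      then have "?y M = {}" by (simp only: Union_empty cl_empty)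
      then show False using eq G_ne[OF MG] by simp
    qed
    moreover have "finite {K\<in>T. K \<subseteq> M}" using TG finG finite_subset by fastforce
    ultimately have "card {K\<in>T. K \<subseteq> M} = 1" by (metis One_nat_def card_gt_0_iff less_2_cases_iff not_le not_less0)
    then obtain K where K: "{K\<in>T. K \<subseteq> M} = {K}" by (auto simp: card_1_singleton_iff)
    then have KT: "K \<in> T" by auto
    have "?y M = K" using K Fl_cl[of K] KT TG G_Fl by auto
    then show ?thesis using eq KT by simp
  qed
  have "K \<in> factors ?F" if K: "K \<in> T" for K
  proof -
    obtain M where M: "M \<in> factors ?F" "K \<subseteq> M" using factors_above[OF _ TF[OF K]] TG K by (metis subsetD)
    then have "M = K" using inT[OF M(1)] K T(2) unfolding antichain_sets_def by auto
    then show ?thesis using M by simp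
  qed
  then show fac: "factors ?F = T" using inT by blast
  show "\<Union>T \<in> Fl" using factors_Un[OF F] F unfolding fac by simp
qed

lemma nst_antichain_union:
  assumes n: "nst S" and T: "T \<subseteq> S" "antichain_sets T" and y: "\<And>K. K \<in> T \<Longrightarrow> y K \<in> Fl \<and> y K \<subseteq> K"
  shows "\<Union>(y ` T) \<in> Fl" "rk (\<Union>(y ` T)) = (\<Sum>K\<in>T. rk (y K))"
proof -
  have "\<Union>T \<subseteq> E" using T nstG[OF n] UG_E by blast
  then have F: "cl (\<Union>T) \<in> Fl" using cl_Fl by auto
  have "T \<subseteq> factors (cl (\<Union>T))" using nst_antichain_factors[OF n T] by simp
  from rk_disjoint_Un[OF F this y] show "\<Union>(y ` T) \<in> Fl" "rk (\<Union>(y ` T)) = (\<Sum>K\<in>T. rk (y K))" by auto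
qed

definition mx :: "'a set set \<Rightarrow> 'a set set" where "mx T = {K\<in>T. \<forall>H\<in>T. K \<subseteq> H \<longrightarrow> H = K}"

lemma mx_sub: "mx T \<subseteq> T" by (auto simp: mx_def)
lemma mx_antichain: "antichain_sets (mx T)" by (auto simp: mx_def antichain_sets_def)
lemma mx_above: assumes "finite T" "H \<in> T" obtains K where "K \<in> mx T" "H \<subseteq> K"
proof -
  have "finite {G\<in>T. H \<subseteq> G}" "{G\<in>T. H \<subseteq> G} \<noteq> {}" using assms by auto
  then obtain K where K: "K \<in> {G\<in>T. H \<subseteq> G}" "\<And>G. G \<in> {G\<in>T. H \<subseteq> G} \<Longrightarrow> K \<subseteq> G \<Longrightarrow> G = K"
    using finite_has_maximal[of "{G\<in>T. H \<subseteq> G}"] by (metis (no_types, lifting))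
  have "K \<in> mx T" using K by (auto simp: mx_def)
  then show ?thesis using that K by auto
qed
lemma mx_Un: assumes "finite T" shows "\<Union>(mx T) = \<Union>T"
proof
  show "\<Union>(mx T) \<subseteq> \<Union>T" using mx_sub by blast
  show "\<Union>T \<subseteq> \<Union>(mx T)"
  proof
    fix x assume "x \<in> \<Union>T"
    then obtain H where H: "H \<in> T" "x \<in> H" by auto
    obtain K where "K \<in> mx T" "H \<subseteq> K" by (rule mx_above[OF assms H(1)])
    then show "x \<in> \<Union>(mx T)" using H by auto
  qed
qed

lemma nst_union:
  assumes n: "nst S" and T: "T \<subseteq> S"
  shows "\<Union>T \<in> Fl" "factors (\<Union>T) = mx T"
proof -
  have fT: "finite T" using nst_fin[OF n] T finite_subset by blast
  have m: "mx T \<subseteq> S" using mx_sub T by blast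
  show fl: "\<Union>T \<in> Fl" using nst_antichain_factors(2)[OF n m mx_antichain] mx_Un[OF fT] by simp
  show "factors (\<Union>T) = mx T" using nst_antichain_factors(1)[OF n m mx_antichain] mx_Un[OF fT] Fl_cl[OF fl] by simp
qed

lemma nst_union_G: assumes n: "nst S" and T: "T \<subseteq> S" and G: "\<Union>T \<in> \<G>" shows "\<Union>T \<in> T"
proof -
  have "\<Union>T \<in> factors (\<Union>T)" using G by (auto simp: maxs_below_def)
  then show ?thesis using nst_union[OF n T] mx_sub by blast
qed

lemma J_mono: "S \<subseteq> T \<Longrightarrow> J S G \<subseteq> J T G" by (auto simp: J_def)
lemma J_sub: "J S G \<subseteq> G" by (auto simp: J_def)
lemma J_upper: "H \<in> S \<Longrightarrow> H \<subset> G \<Longrightarrow> H \<subseteq> J S G" by (auto simp: J_def)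
lemma J_Fl: "nst S \<Longrightarrow> J S G \<in> Fl" unfolding J_def by (rule nst_union(1)) auto
lemma J_ne: assumes "nst S" "G \<in> \<G>" shows "J S G \<noteq> G"
proof
  assume a: "J S G = G"
  have "\<Union>{H\<in>S. H \<subset> G} \<in> {H\<in>S. H \<subset> G}"
    by (rule nst_union_G[OF assms(1)]) (use a assms(2) in \<open>auto simp: J_def\<close>)
  then show False using a by (auto simp: J_def)
qed
lemma rk_J: assumes "nst S" "G \<in> \<G>" shows "rk (J S G) < rk G"
  by (rule rk_strict[OF J_Fl[OF assms(1)]]) (use J_ne[OF assms] J_sub[of S G] G_E[OF assms(2)] in auto)
lemma dl_pos: "nst S \<Longrightarrow> G \<in> \<G> \<Longrightarrow> 0 < dl S G" using rk_J by (simp add: dl_def)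
lemma dl_anti: "S \<subseteq> T \<Longrightarrow> dl T G \<le> dl S G" using rk_mono[OF J_mono, of S T G] by (simp add: dl_def)

lemma Jbelow_eq: "nst S \<Longrightarrow> Jbelow E indep S G = J S G"
  using Fl_cl[OF J_Fl] by (simp add: Jbelow_def fjoin_def J_def)

lemma nst_insert_E: assumes "nst S" "E \<in> \<G>" shows "nst (insert E S)"
  unfolding nst_iff
proof (intro conjI allI impI)
  show "insert E S \<subseteq> \<G>" using assms nstG by auto
  fix T assume T: "T \<subseteq> insert E S" "antichain_sets T \<and> 2 \<le> card T"
  show "cl (\<Union>T) \<notin> \<G>"
  proof (cases "E \<in> T")
    case False then show ?thesis using nst_antichain[OF assms(1)] T by blast
  next
    case True
    have "K = E" if "K \<in> T" for K
    proof -
      have "K \<subseteq> E" using that T nstG[OF assms(1)] G_E by blast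
      then show ?thesis using T that True by (auto simp: antichain_sets_def)
    qed
    then have "T \<subseteq> {E}" by auto
    then have "card T \<le> card {E}" by (intro card_mono) auto
    then show ?thesis using T by auto
  qed
qed

text \<open>Let T contain K and have its join W in \<G>. If all of T lies strictly below G, then W
  is below X, so W = K by maximality of the factor and T is a single set. Otherwise the members of T
  not strictly below G are disjoint from G; together with G they form an antichain in D with join
  \<open>cl (W \<union> G)\<close>, which is in \<G> because W meets G.\<close>

lemma nst_insert:
  assumes n: "nst D" and G: "G \<in> D" and X: "X \<in> Fl" "J D G \<subseteq> X" "X \<subset> G" and K: "K \<in> factors X"
  shows "nst (insert K D)"
  unfolding nst_iff
proof (intro conjI allI impI)
  have KG: "K \<in> \<G>" "K \<subseteq> X" "K \<noteq> {}" using facsD[OF K] G_ne by auto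
  show "insert K D \<subseteq> \<G>" using KG nstG[OF n] by auto
  fix T assume T: "T \<subseteq> insert K D" "antichain_sets T \<and> 2 \<le> card T"
  show "cl (\<Union>T) \<notin> \<G>"
  proof (cases "K \<in> T")
    case False then show ?thesis using nst_antichain[OF n] T by blast
  next
    case True
    show ?thesis
    proof
      assume W: "cl (\<Union>T) \<in> \<G>"
      have TG: "T \<subseteq> \<G>" using T KG nstG[OF n] by auto
      have UE: "\<Union>T \<subseteq> E" by (rule UG_E[OF TG])
      have finT: "finite T" using TG finG finite_subset by blast
      have inc: "\<not> H \<subseteq> K \<and> \<not> K \<subseteq> H" if "H \<in> T" "H \<noteq> K" for H
        using T True that by (auto simp: antichain_sets_def)
      have GG: "G \<in> \<G>" using G nstG[OF n] by auto
      show False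
      proof (cases "\<exists>H\<in>T. \<not> H \<subset> G")
        case False
        have "H \<subseteq> X" if "H \<in> T" for H
        proof (cases "H = K")
          case False
          then have "H \<in> D" "H \<subset> G" using T that \<open>\<not> (\<exists>H\<in>T. \<not> H \<subset> G)\<close> by auto
          then show ?thesis using J_upper[of H D G] X by auto
        qed (use KG in auto)
        then have "cl (\<Union>T) \<subseteq> X" using X by (intro cl_least) auto
        moreover have "K \<subseteq> cl (\<Union>T)" using cl_ext[OF UE] True by auto
        ultimately have WK: "cl (\<Union>T) = K" using facsD(3)[OF K W] by auto
        have "H = K" if "H \<in> T" for H using inc[OF that] cl_ext[OF UE] that WK by auto
        then have "card T \<le> card {K}" by (intro card_mono) auto
        then show False using T by auto
      next
        case True': True
        let ?T0 = "{H\<in>T. \<not> H \<subset> G}"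
        have T0: "H \<in> D \<and> H \<inter> G = {}" if "H \<in> ?T0" for H
        proof -
          have HK: "H \<noteq> K" using that KG X by auto
          then have HD: "H \<in> D" using that T by auto
          have "\<not> G \<subseteq> H" using inc[of H] HK that KG X by auto
          then show ?thesis using nst_cmp[OF n HD G] that HD by auto
        qed
        obtain H0 where H0: "H0 \<in> ?T0" using True' by auto
        have GnT: "G \<notin> ?T0" using T0[of G] G_ne[OF GG] by auto
        let ?T1 = "insert G ?T0"
        have "antichain_sets ?T1"
          unfolding antichain_sets_def
        proof (intro ballI impI)
          fix A B assume AB: "A \<in> ?T1" "B \<in> ?T1" "A \<subseteq> B"
          have Ane: "A \<noteq> {}" using AB(1) GG TG G_ne by auto
          show "A = B"
          proof (cases "A = G \<or> B = G")
            case True then show ?thesis using AB T0[of A] T0[of B] Ane by auto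
          next
            case False then show ?thesis using AB T by (auto simp: antichain_sets_def)
          qed
        qed
        moreover have "card ?T1 \<ge> 2"
        proof -
          have "card {G, H0} \<le> card ?T1" by (rule card_mono) (use finT H0 in auto)
          moreover have "card {G, H0} = 2" using H0 GnT by (metis card_2_iff)
          ultimately show ?thesis by simp
        qed
        ultimately have nin: "cl (\<Union>?T1) \<notin> \<G>" by (intro nst_antichain[OF n]) (use T0 G in auto)
        have KW: "K \<subseteq> cl (\<Union>T)" using cl_ext[OF UE] True by auto
        have "K \<subseteq> G" using KG(2) X(3) by simp
        then have "cl (\<Union>T) \<inter> G \<noteq> {}" using KW KG(3) by auto
        then have "cl (cl (\<Union>T) \<union> G) \<in> \<G>" by (rule join_in[OF W GG])
        moreover have "cl (cl (\<Union>T) \<union> G) = cl (\<Union>?T1)"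
        proof -
          have "cl (cl (\<Union>T) \<union> G) = cl (G \<union> \<Union>T)" using cl_Un_cl[of G "\<Union>T"] UE G_E[OF GG] by (simp add: Un_commute)
          moreover have "G \<union> \<Union>T = \<Union>?T1" by auto
          ultimately show ?thesis by simp
        qed
        ultimately show False using nin by simp
      qed
    qed
  qed
qed

end

section \<open>Monomials and ideals\<close>

text \<open>A is meant to be a subring, such as the polynomials in some of the variables. Ideals of
  polynomial rings in different sets of variables then live in one ambient ring and can be compared
  by inclusion.\<close>

inductive_set idl :: "'b::comm_ring_1 set \<Rightarrow> 'b set \<Rightarrow> 'b set" for A S where
  idl_0: "0 \<in> idl A S"
| idl_step: "p \<in> idl A S \<Longrightarrow> c \<in> A \<Longrightarrow> g \<in> S \<Longrightarrow> c * g + p \<in> idl A S"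

definition subring_set :: "'b::comm_ring_1 set \<Rightarrow> bool" where
  "subring_set A \<longleftrightarrow> 0 \<in> A \<and> 1 \<in> A \<and> (\<forall>a\<in>A. \<forall>b\<in>A. a + b \<in> A \<and> a * b \<in> A) \<and> (\<forall>a\<in>A. - a \<in> A)"

lemma idl_add: "p \<in> idl A S \<Longrightarrow> q \<in> idl A S \<Longrightarrow> p + q \<in> idl A S"
proof (induction rule: idl.induct)
  case (idl_step p c g)
  then have "c * g + (p + q) \<in> idl A S" by (intro idl.idl_step) auto
  then show ?case by (simp add: add.assoc)
qed simp

lemma idl_mult: "subring_set A \<Longrightarrow> a \<in> A \<Longrightarrow> p \<in> idl A S \<Longrightarrow> a * p \<in> idl A S"
proof (rotate_tac 2, induction rule: idl.induct)
  case idl_0 then show ?case by (simp add: idl.idl_0)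
next
  case (idl_step p c g)
  then have "(a * c) * g + a * p \<in> idl A S" by (intro idl.idl_step) (auto simp: subring_set_def)
  then show ?case by (simp add: algebra_simps)
qed

lemma idl_gen: "subring_set A \<Longrightarrow> g \<in> S \<Longrightarrow> g \<in> idl A S"
  using idl_step[OF idl_0, of 1 A g S] by (simp add: subring_set_def)

lemma idl_uminus: "subring_set A \<Longrightarrow> p \<in> idl A S \<Longrightarrow> - p \<in> idl A S"
  using idl_mult[of A "-1" p S] by (simp add: subring_set_def)

lemma idl_diff: "subring_set A \<Longrightarrow> p \<in> idl A S \<Longrightarrow> q \<in> idl A S \<Longrightarrow> p - q \<in> idl A S"
  using idl_add[OF _ idl_uminus, of p A S q] by simp

lemma idl_sum: "(\<And>i. i \<in> I \<Longrightarrow> f i \<in> idl A S) \<Longrightarrow> sum f I \<in> idl A S"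
  by (induction I rule: infinite_finite_induct) (auto intro: idl_0 idl_add)

lemma idl_least:
  assumes "0 \<in> I" "\<And>p q. p \<in> I \<Longrightarrow> q \<in> I \<Longrightarrow> p + q \<in> I" "\<And>c g. c \<in> A \<Longrightarrow> g \<in> S \<Longrightarrow> c * g \<in> I"
  shows "idl A S \<subseteq> I"
proof
  fix p assume "p \<in> idl A S" then show "p \<in> I" by induction (use assms in auto)
qed

lemma idl_mono: assumes "subring_set B" "A \<subseteq> B" "S \<subseteq> idl B T" shows "idl A S \<subseteq> idl B T"
  by (rule idl_least) (use assms in \<open>auto intro: idl_0 idl_add idl_mult\<close>)

text \<open>Modulo the ideal, multiplication by a identifies s with w, and hence their
  powers.\<close>

lemma idl_power_cong:
  assumes A: "subring_set A" and m: "s \<in> A" "w \<in> A" and d: "a * (s - w) \<in> idl A S"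
  shows "a * s ^ k - a * w ^ k \<in> idl A S"
proof (induction k)
  case 0 then show ?case by (simp add: idl_0)
next
  case (Suc k)
  have wk: "w ^ k \<in> A" by (induction k) (use A m in \<open>auto simp: subring_set_def\<close>)
  have "s * (a * s ^ k - a * w ^ k) + w ^ k * (a * (s - w)) \<in> idl A S"
    by (rule idl_add[OF idl_mult[OF A m(1) Suc] idl_mult[OF A wk d]])
  moreover have "s * (a * s ^ k - a * w ^ k) + w ^ k * (a * (s - w)) = a * s ^ Suc k - a * w ^ Suc k"
    by (simp add: algebra_simps)
  ultimately show ?case by simp
qed

section \<open>Polynomials as finitely supported functions on multisets\<close>

abbreviation (input) lookup where "lookup \<equiv> Poly_Mapping.lookup"
abbreviation (input) keys where "keys \<equiv> Poly_Mapping.keys"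

type_synonym 'v mp = "'v multiset \<Rightarrow>\<^sub>0 rat"

definition mo :: "'v multiset \<Rightarrow> 'v mp" where "mo m = Poly_Mapping.single m 1"
definition pol :: "'v set \<Rightarrow> 'v mp set" where "pol U = {p. \<forall>m\<in>keys p. set_mset m \<subseteq> U}"

lemma mo_add: "mo (m + n) = mo m * mo n" by (simp add: mo_def mult_single)
lemma mo_0: "mo {#} = 1" by (simp add: mo_def)
lemma mo_rep: "mo {#F#} ^ k = mo (replicate_mset k F)"
  by (induction k) (simp_all add: mo_0 mo_add[symmetric])
lemma lookup_mo: "lookup (mo m) n = (if n = m then 1 else 0)" by (auto simp: mo_def lookup_single when_def)
lemma keys_mo: "keys (mo m) = {m}" by (simp add: mo_def)

lemma mp_sum: fixes p :: "'v mp" shows "p = (\<Sum>m\<in>keys p. Poly_Mapping.single m (lookup p m))"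
proof (rule poly_mapping_eqI)
  fix n
  have "lookup (\<Sum>m\<in>keys p. Poly_Mapping.single m (lookup p m)) n = (\<Sum>m\<in>keys p. if m = n then lookup p m else 0)"
    by (simp add: lookup_sum lookup_single when_def)
  also have "\<dots> = lookup p n" by (simp add: in_keys_iff)
  finally show "lookup p n = lookup (\<Sum>m\<in>keys p. Poly_Mapping.single m (lookup p m)) n" by simp
qed

lemma single_mo: "Poly_Mapping.single m c = Poly_Mapping.single {#} c * mo m"
  by (simp add: mo_def mult_single)

lemma lookup_const_mult: "lookup (Poly_Mapping.single {#} c * (p :: 'v mp)) m = c * lookup p m"
proof -
  have "Poly_Mapping.single {#} c * p = (\<Sum>n\<in>keys p. Poly_Mapping.single n (c * lookup p n))"
    by (subst mp_sum[of p]) (simp add: sum_distrib_left mult_single)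
  then have "lookup (Poly_Mapping.single {#} c * p) m = (\<Sum>n\<in>keys p. if n = m then c * lookup p n else 0)"
    by (simp add: lookup_sum lookup_single when_def)
  then show ?thesis by (simp add: in_keys_iff)
qed

lemma lookup_mult_mo: "lookup (p * mo r) m = (if r \<subseteq># m then lookup p (m - r) else 0)" for p :: "'v mp"
proof -
  have "p * mo r = (\<Sum>n\<in>keys p. Poly_Mapping.single (n + r) (lookup p n))"
    by (subst mp_sum[of p]) (simp add: sum_distrib_right mult_single mo_def)
  then have *: "lookup (p * mo r) m = (\<Sum>n\<in>keys p. if n + r = m then lookup p n else 0)"
    by (simp add: lookup_sum lookup_single when_def)
  show ?thesis
  proof (cases "r \<subseteq># m")
    case True
    then have "n + r = m \<longleftrightarrow> n = m - r" for n by (metis add_diff_cancel_right' subset_mset.diff_add)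
    then show ?thesis using * True by (simp add: in_keys_iff)
  next
    case False
    then have "n + r \<noteq> m" for n by auto
    then show ?thesis using * False by simp
  qed
qed

lemma pol_subring: "subring_set (pol U)"
  unfolding subring_set_def
proof (intro conjI ballI)
  fix a b assume a: "a \<in> pol U" and b: "b \<in> pol U"
  show "a + b \<in> pol U" using a b Poly_Mapping.keys_add[of a b] unfolding pol_def by blast
  show "a * b \<in> pol U"
    unfolding pol_def
  proof (intro CollectI ballI)
    fix m assume "m \<in> keys (a * b)"
    then obtain m1 m2 where "m = m1 + m2" "m1 \<in> keys a" "m2 \<in> keys b" using keys_mult[of a b] by auto
    then show "set_mset m \<subseteq> U" using a b by (auto simp: pol_def)
  qed
next
  fix a assume "a \<in> pol U" then show "- a \<in> pol U" by (simp add: pol_def keys_def)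
qed (auto simp: pol_def)

lemma pol_add: "a \<in> pol U \<Longrightarrow> b \<in> pol U \<Longrightarrow> a + b \<in> pol U"
  and pol_mult: "a \<in> pol U \<Longrightarrow> b \<in> pol U \<Longrightarrow> a * b \<in> pol U"
  and pol_0: "0 \<in> pol U" and pol_1: "1 \<in> pol U"
  using pol_subring[of U] by (auto simp: subring_set_def)
lemma pol_sum: "(\<And>i. i \<in> I \<Longrightarrow> f i \<in> pol U) \<Longrightarrow> sum f I \<in> pol U"
  by (induction I rule: infinite_finite_induct) (auto intro: pol_0 pol_add)
lemma pol_power: "a \<in> pol U \<Longrightarrow> a ^ k \<in> pol U"
  by (induction k) (auto intro: pol_1 pol_mult)
lemma pol_mo: "set_mset m \<subseteq> U \<Longrightarrow> mo m \<in> pol U" by (simp add: pol_def keys_mo)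
lemma pol_const: "Poly_Mapping.single {#} c \<in> pol U" by (simp add: pol_def)
lemma pol_mono: "U \<subseteq> W \<Longrightarrow> pol U \<subseteq> pol W" unfolding pol_def by blast
lemma pol_of_nat: "of_nat n \<in> pol U" by (induction n) (auto intro: pol_0 pol_1 pol_add)

lemma split_mset: "m = filter_mset (\<lambda>G. G \<noteq> F) m + replicate_mset (count m F) F"
  by (rule multiset_eqI) auto

text \<open>Polynomials over \<open>U \<union> {F}\<close> as univariate polynomials in the variable of F.\<close>

lemma lookup_poly_eval:
  fixes q :: "'v mp poly"
  assumes q: "\<And>i. coeff q i \<in> pol U" and F: "F \<notin> U" and m: "F \<notin># m"
  shows "lookup (poly q (mo {#F#})) (m + replicate_mset j F) = lookup (coeff q j) m"
proof -
  let ?f = "\<lambda>i. lookup (coeff q i * mo {#F#} ^ i) (m + replicate_mset j F)"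
  have f: "?f i = (if i = j then lookup (coeff q j) m else 0)" for i
  proof (cases "i = j")
    case True then show ?thesis by (simp add: mo_rep lookup_mult_mo)
  next
    case False
    show ?thesis
    proof (cases "replicate_mset i F \<subseteq># m + replicate_mset j F")
      case True
      then have "count (replicate_mset i F) F \<le> count (m + replicate_mset j F) F" by (rule mset_subset_eq_count)
      then have "i < j" using False m by (simp add: not_in_iff)
      then have "F \<in># m + replicate_mset j F - replicate_mset i F"
        using m by (simp add: not_in_iff flip: count_greater_zero_iff)
      then have "m + replicate_mset j F - replicate_mset i F \<notin> keys (coeff q i)" using q[of i] F by (auto simp: pol_def)
      then have "lookup (coeff q i) (m + replicate_mset j F - replicate_mset i F) = 0" by (simp add: in_keys_iff)
      then show ?thesis using False by (simp add: mo_rep lookup_mult_mo)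
    next
      case nsub: False
      then show ?thesis using False by (simp add: mo_rep lookup_mult_mo)
    qed
  qed
  have "lookup (poly q (mo {#F#})) (m + replicate_mset j F) = (\<Sum>i\<le>Polynomial.degree q. ?f i)"
    by (simp add: poly_altdef lookup_sum)
  also have "\<dots> = (if j \<le> Polynomial.degree q then lookup (coeff q j) m else 0)" unfolding f by simp
  also have "\<dots> = lookup (coeff q j) m" by (simp add: coeff_eq_0)
  finally show ?thesis .
qed

lemma lin_power_coeff:
  fixes s :: "'v mp"
  shows "coeff ([:s, 1:] ^ k) k = 1" "\<And>i. i > k \<Longrightarrow> coeff ([:s, 1:] ^ k) i = 0"
    "coeff ([:s, 1:] ^ k) 0 = s ^ k" "\<And>i. s \<in> pol U \<Longrightarrow> coeff ([:s, 1:] ^ k) i \<in> pol U"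
proof -
  have "coeff ([:s, 1:] ^ k) k = 1 \<and> (\<forall>i>k. coeff ([:s, 1:] ^ k) i = 0) \<and> coeff ([:s, 1:] ^ k) 0 = s ^ k
     \<and> (s \<in> pol U \<longrightarrow> (\<forall>i. coeff ([:s, 1:] ^ k) i \<in> pol U))"
  proof (induction k)
    case 0 then show ?case by (auto simp: coeff_1 intro: pol_1 pol_0)
  next
    case (Suc k)
    have c: "coeff ([:s, 1:] ^ Suc k) i = s * coeff ([:s, 1:] ^ k) i + (case i of 0 \<Rightarrow> 0 | Suc i' \<Rightarrow> coeff ([:s, 1:] ^ k) i')" for i
      by (simp add: coeff_pCons split: nat.split)
    show ?case
    proof (intro conjI allI impI)
      fix i assume "i > Suc k" then show "coeff ([:s, 1:] ^ Suc k) i = 0" using Suc by (auto simp: c coeff_pCons split: nat.split)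
    next
      fix i assume "s \<in> pol U" then show "coeff ([:s, 1:] ^ Suc k) i \<in> pol U" using Suc unfolding c
        by (auto intro!: pol_add pol_mult pol_0 pol_power split: nat.split)
    qed (use Suc in \<open>auto simp: c\<close>)
  qed
  then show "coeff ([:s, 1:] ^ k) k = 1" "\<And>i. i > k \<Longrightarrow> coeff ([:s, 1:] ^ k) i = 0"
    "coeff ([:s, 1:] ^ k) 0 = s ^ k" "\<And>i. s \<in> pol U \<Longrightarrow> coeff ([:s, 1:] ^ k) i \<in> pol U" by auto
qed

text \<open>The leading coefficient of a nonzero q would reappear in degree k plus the degree of q,
  because M is monic of degree k.\<close>

lemma monic_mult_zero:
  fixes M q l :: "'v mp poly"
  assumes M: "coeff M k = 1" "\<And>i. i > k \<Longrightarrow> coeff M i = 0" and q: "\<And>j. j \<ge> k \<Longrightarrow> coeff (M * q) j = 0"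
  shows "q = 0"
proof (rule ccontr)
  assume "q \<noteq> 0"
  let ?d = "Polynomial.degree q"
  have "coeff (M * q) (k + ?d) = (\<Sum>i\<le>k + ?d. coeff M i * coeff q (k + ?d - i))" by (simp add: coeff_mult)
  also have "\<dots> = (\<Sum>i\<le>k + ?d. if i = k then coeff q ?d else 0)"
  proof (rule sum.cong)
    fix i show "coeff M i * coeff q (k + ?d - i) = (if i = k then coeff q ?d else 0)"
      using M coeff_eq_0[of q "k + ?d - i"] by (cases i k rule: linorder_cases) auto
  qed simp
  also have "\<dots> = coeff q ?d" by simp
  finally show False using q[of "k + ?d"] \<open>q \<noteq> 0\<close> by simp
qed

section \<open>The Feichtner-Yuzvinsky basis\<close>

context building
begin

lemma J_mono2: "S \<subseteq> T \<Longrightarrow> F \<subseteq> G \<Longrightarrow> J S F \<subseteq> J T G"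
proof
  fix x assume ST: "S \<subseteq> T" "F \<subseteq> G" and "x \<in> J S F"
  then obtain H where "x \<in> H" "H \<in> S" "H \<subset> F" unfolding J_def by auto
  then have "H \<in> T" "H \<subset> G" using ST by auto
  then show "x \<in> J T G" using J_upper[of H T G] \<open>x \<in> H\<close> by auto
qed

text \<open>With all of \<G> for U and an atom for B this is the linear relation of the Chow
  ring.\<close>

definition sig :: "'a set set \<Rightarrow> 'a set \<Rightarrow> 'a set mp" where "sig U B = (\<Sum>G\<in>{G\<in>U. B \<subseteq> G}. mo {#G#})"

text \<open>The relations of the Chow ring relative to an up-closed U of variables still in play and a set N of
  variables already known to divide the monomial. For \<open>U = \<G>\<close> and N empty they generate the Chow ideal.\<close>

definition gens :: "'a set set \<Rightarrow> 'a set set \<Rightarrow> 'a set mp set" where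
  "gens U N = {mo m | m. set_mset m \<subseteq> U \<and> \<not> nst (set_mset m \<union> N)} \<union>
     {mo m * sig U B ^ dl (set_mset m \<union> N) B | m B. set_mset m \<subseteq> U \<and> B \<in> U}"

definition rel_ideal :: "'a set set \<Rightarrow> 'a set set \<Rightarrow> 'a set mp set" where "rel_ideal U N = idl (pol U) (gens U N)"

definition FY :: "'a set set \<Rightarrow> 'a set set \<Rightarrow> 'a set multiset set" where
  "FY U N = {m. set_mset m \<subseteq> U \<and> nst (set_mset m \<union> N) \<and> (\<forall>G\<in>#m. count m G < dl (set_mset m \<union> N) G)}"

definition FY_span :: "'a set set \<Rightarrow> 'a set set \<Rightarrow> 'a set mp set" where "FY_span U N = {p. keys p \<subseteq> FY U N}"

lemma sig_pol: "sig U B \<in> pol U" unfolding sig_def by (intro pol_sum pol_mo) auto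

lemma rel_ideal_mono: "m \<in> rel_ideal U N \<Longrightarrow> c \<in> pol U \<Longrightarrow> c * m \<in> rel_ideal U N"
  unfolding rel_ideal_def by (rule idl_mult[OF pol_subring])
lemma rel_ideal_add: "p \<in> rel_ideal U N \<Longrightarrow> q \<in> rel_ideal U N \<Longrightarrow> p + q \<in> rel_ideal U N" unfolding rel_ideal_def by (rule idl_add)
lemma rel_ideal_0: "0 \<in> rel_ideal U N" unfolding rel_ideal_def by (rule idl_0)

lemma rel_ideal_a: "set_mset m \<subseteq> U \<Longrightarrow> \<not> nst (set_mset m \<union> N) \<Longrightarrow> mo m \<in> rel_ideal U N"
  unfolding rel_ideal_def by (rule idl_gen[OF pol_subring]) (auto simp: gens_def)

lemma rel_ideal_b:
  assumes "set_mset m \<subseteq> U" "B \<in> U" "dl (set_mset m \<union> N) B \<le> e" shows "mo m * sig U B ^ e \<in> rel_ideal U N"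
proof -
  let ?d = "dl (set_mset m \<union> N) B"
  have "mo m * sig U B ^ ?d \<in> rel_ideal U N"
    unfolding rel_ideal_def by (rule idl_gen[OF pol_subring]) (use assms in \<open>auto simp: gens_def\<close>)
  then have "sig U B ^ (e - ?d) * (mo m * sig U B ^ ?d) \<in> rel_ideal U N"
    by (rule rel_ideal_mono) (intro pol_power sig_pol)
  moreover have "sig U B ^ e = sig U B ^ (e - ?d) * sig U B ^ ?d" using assms(3) by (simp flip: power_add)
  ultimately show ?thesis by (simp add: ac_simps)
qed

lemma sig_diff:
  assumes "finite U" "B \<subseteq> W"
  shows "sig U B - sig U W = (\<Sum>G\<in>{G\<in>U. B \<subseteq> G \<and> \<not> W \<subseteq> G}. mo {#G#})"
proof -
  have "sig U B = (\<Sum>G\<in>{G\<in>U. B \<subseteq> G \<and> \<not> W \<subseteq> G} \<union> {G\<in>U. W \<subseteq> G}. mo {#G#})"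
    unfolding sig_def by (rule sum.cong) (use assms in auto)
  also have "\<dots> = (\<Sum>G\<in>{G\<in>U. B \<subseteq> G \<and> \<not> W \<subseteq> G}. mo {#G#}) + sig U W"
    unfolding sig_def by (rule sum.union_disjoint) (use assms in auto)
  finally show ?thesis by simp
qed

text \<open>The terms by which the two sums differ are killed by a, so a identifies the sums and
  therefore their powers. All later changes of base flat go through this.\<close>

lemma sig_replace:
  assumes U: "finite U" "B \<subseteq> W" and a: "a * sig U W ^ e \<in> idl (pol U) S"
    and nn: "\<And>G. G \<in> U \<Longrightarrow> B \<subseteq> G \<Longrightarrow> \<not> W \<subseteq> G \<Longrightarrow> a * mo {#G#} \<in> idl (pol U) S"
  shows "a * sig U B ^ e \<in> idl (pol U) S"
proof -
  have "a * (sig U B - sig U W) \<in> idl (pol U) S"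
    unfolding sig_diff[OF U] sum_distrib_left by (rule idl_sum) (use nn in auto)
  from idl_power_cong[OF pol_subring sig_pol sig_pol this, of e]
  have "(a * sig U B ^ e - a * sig U W ^ e) + a * sig U W ^ e \<in> idl (pol U) S" using a by (rule idl_add)
  then show ?thesis by simp
qed

lemma nst_not_two:
  assumes "G \<in> \<G>" "H \<in> \<G>" "G \<inter> H \<noteq> {}" "\<not> G \<subseteq> H" "\<not> H \<subseteq> G" "G \<in> S" "H \<in> S" shows "\<not> nst S"
  using nst_cmp[of S G H] assms by auto

text \<open>In the presence of the variable of G, a variable above B but not above the join of G and
  B belongs to a set that overlaps G and is incomparable to it; such a product is non-nested. So the
  sum above B may be replaced by the sum above the join.\<close>

lemma mo_sig_replace:
  assumes U: "finite U" "U \<subseteq> \<G>" and GB: "G \<in> U" "B \<in> U" "G \<inter> B \<noteq> {}" "\<not> B \<subseteq> G"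
    and m: "set_mset m \<subseteq> U" and nn: "\<And>m. set_mset m \<subseteq> U \<Longrightarrow> \<not> nst (set_mset m \<union> N) \<Longrightarrow> mo m \<in> idl (pol U) S"
    and a: "mo (add_mset G m) * sig U (cl (G \<union> B)) ^ e \<in> idl (pol U) S"
  shows "mo (add_mset G m) * sig U B ^ e \<in> idl (pol U) S"
proof (rule sig_replace[OF U(1) _ a])
  have GBE: "G \<union> B \<subseteq> E" using GB U G_E by blast
  show "B \<subseteq> cl (G \<union> B)" using cl_ext[OF GBE] by auto
  fix H assume H: "H \<in> U" "B \<subseteq> H" "\<not> cl (G \<union> B) \<subseteq> H"
  have HF: "H \<in> Fl" using H U G_Fl by auto
  have 1: "\<not> G \<subseteq> H" using cl_least[OF _ HF, of "G \<union> B"] H by auto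
  have 2: "\<not> H \<subseteq> G" using GB H by auto
  have "\<not> nst (set_mset (add_mset H (add_mset G m)) \<union> N)"
    by (rule nst_not_two[of G H]) (use GB H U 1 2 in auto)
  then have "mo (add_mset H (add_mset G m)) \<in> idl (pol U) S" using GB H m by (intro nn) auto
  then show "mo (add_mset G m) * mo {#H#} \<in> idl (pol U) S" by (simp flip: mo_add)
qed

text \<open>With s the sum of the variables above a minimal element F, the power \<open>s\<^sup>k\<close> carries the ideal of
  \<open>N \<union> {F}\<close> into the ideal of N.\<close>

context
  fixes U N F k
  assumes U: "U \<subseteq> \<G>" and F: "F \<in> \<G>" and up: "\<And>G H. G \<in> insert F U \<Longrightarrow> H \<in> \<G> \<Longrightarrow> G \<subseteq> H \<Longrightarrow> H \<in> insert F U"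
    and FU: "F \<notin> U" and mn: "\<And>G. G \<in> U \<Longrightarrow> \<not> G \<subseteq> F" and N: "nst N" and k: "k = dl N F"
begin

lemma finU: "finite U" using U finG by (rule finite_subset)

lemma upU: "G \<in> U \<Longrightarrow> H \<in> \<G> \<Longrightarrow> G \<subseteq> H \<Longrightarrow> H \<in> U"
  using up[of G H] mn by auto

lemma upF: "H \<in> \<G> \<Longrightarrow> F \<subset> H \<Longrightarrow> H \<in> U" using up[of F H] by auto

text \<open>An antichain T witnessing non-nestedness must contain F, and its join lies strictly
  above F. Modulo the ideal of N the sum above F can be replaced by the sum above this join, whose
  local rank is at most k.\<close>

lemma sig_power_nonnested:
  assumes m: "set_mset m \<subseteq> U" and nn: "\<not> nst (set_mset m \<union> insert F N)"
  shows "mo m * sig U F ^ k \<in> rel_ideal U N"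
proof (cases "nst (set_mset m \<union> N)")
  case False
  then have "mo m \<in> rel_ideal U N" by (intro rel_ideal_a m)
  then have "sig U F ^ k * mo m \<in> rel_ideal U N" by (rule rel_ideal_mono) (intro pol_power sig_pol)
  then show ?thesis by (simp add: mult.commute)
next
  case True
  let ?D = "set_mset m \<union> N"
  have "insert F ?D \<subseteq> \<G>" using nstG[OF True] F by auto
  then obtain T where T: "T \<subseteq> insert F ?D" "antichain_sets T" "2 \<le> card T" and W: "cl (\<Union>T) \<in> \<G>"
    using nn unfolding nst_iff by auto
  have FT: "F \<in> T" using nst_antichain[OF True _ T(2,3)] T(1) W by blast
  define W' where "W' = cl (\<Union>T)"
  have TG: "T \<subseteq> \<G>" using T(1) nstG[OF True] F by auto
  have TE: "\<Union>T \<subseteq> E" by (rule UG_E[OF TG])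
  have TW: "H \<subseteq> W'" if "H \<in> T" for H using cl_ext[OF TE] that unfolding W'_def by auto
  have finT: "finite T" using TG finG by (rule finite_subset)
  have inc: "\<not> H \<subseteq> F \<and> \<not> F \<subseteq> H" if "H \<in> T" "H \<noteq> F" for H using T(2) FT that by (auto simp: antichain_sets_def)
  obtain H0 where H0: "H0 \<in> T" "H0 \<noteq> F"
  proof (rule ccontr)
    assume "\<not> thesis"
    then have "T \<subseteq> {F}" using that by auto
    then have "card T \<le> card {F}" by (intro card_mono) auto
    then show False using T(3) by simp
  qed
  have FW: "F \<subset> W'" using TW[OF FT] TW[OF H0(1)] inc[OF H0] by auto
  have WU: "W' \<in> U" by (rule upF) (use W FW in \<open>auto simp: W'_def\<close>)
  show ?thesis
    unfolding rel_ideal_def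
  proof (rule sig_replace[OF finU, of F W'])
    show "F \<subseteq> W'" using FW by auto
    \<comment> \<open>All of T except F is already below \<open>J ?D W'\<close>, so F alone closes
      the gap up to \<open>W'\<close>, and by submodularity it adds at most
      \<open>rk F - rk (J N F)\<close>.\<close>
    have "dl ?D W' \<le> k"
    proof -
      have "H \<subseteq> J ?D W'" if H: "H \<in> T" "H \<noteq> F" for H
      proof (rule J_upper)
        show "H \<in> ?D" using H T(1) by auto
        show "H \<subset> W'" using TW[OF H(1)] TW[OF FT] inc[OF H] by auto
      qed
      then have "\<Union>T \<subseteq> F \<union> J ?D W'" by blast
      then have "rk W' \<le> rk (F \<union> J ?D W')" using rk_mono rk_cl[of "\<Union>T"] unfolding W'_def by metis
      moreover have "J N F \<subseteq> J ?D W'" by (rule J_mono2) (use FW in auto)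
      then have "J N F \<subseteq> F \<inter> J ?D W'" using J_sub[of N F] by simp
      then have "rk (F \<union> J ?D W') + rk (J N F) \<le> rk F + rk (J ?D W')" by (rule rk_submod_le)
      ultimately show ?thesis unfolding k dl_def by linarith
    qed
    then show "mo m * sig U W' ^ k \<in> idl (pol U) (gens U N)" using rel_ideal_b[OF m WU] unfolding rel_ideal_def by auto
    fix G assume G: "G \<in> U" "F \<subseteq> G" "\<not> W' \<subseteq> G"
    have GG: "G \<in> \<G>" using G U by auto
    \<comment> \<open>Otherwise G and the members of T not below it would form an antichain with
      join \<open>cl (G \<union> W')\<close>, a member of \<G> since G and \<open>W'\<close> share
      F.\<close>
    have "\<not> nst (set_mset (add_mset G m) \<union> N)"
    proof
      assume n: "nst (set_mset (add_mset G m) \<union> N)"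
      let ?T = "{H\<in>T. \<not> H \<subseteq> G}"
      have TD: "H \<in> ?D \<and> \<not> G \<subseteq> H" if "H \<in> ?T" for H
      proof -
        have "H \<noteq> F" using that G by auto
        then show ?thesis using inc[of H] that T(1) G by auto
      qed
      have ac: "antichain_sets (insert G ?T)" using T(2) TD unfolding antichain_sets_def by auto
      have "?T \<noteq> {}"
      proof
        assume "?T = {}"
        then have "\<Union>T \<subseteq> G" by auto
        then have "W' \<subseteq> G" unfolding W'_def by (rule cl_least[OF _ G_Fl[OF GG]])
        then show False using G by simp
      qed
      then have "0 < card ?T" using finT by (simp add: card_gt_0_iff)
      then have "2 \<le> card (insert G ?T)" using finT by simp
      then have "cl (\<Union>(insert G ?T)) \<notin> \<G>" by (intro nst_antichain[OF n _ ac]) (use TD in auto)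
      moreover have "\<Union>(insert G ?T) = G \<union> \<Union>T" by auto
      moreover have "cl (G \<union> \<Union>T) = cl (G \<union> W')" unfolding W'_def by (rule cl_Un_cl[symmetric, OF G_E[OF GG] TE])
      moreover have "G \<inter> W' \<noteq> {}" using G FW G_ne[OF F] by auto
      then have "cl (G \<union> W') \<in> \<G>" using W by (intro join_in GG) (auto simp: W'_def)
      ultimately show False by simp
    qed
    then have "mo (add_mset G m) \<in> rel_ideal U N" using G m by (intro rel_ideal_a) auto
    then show "mo m * mo {#G#} \<in> idl (pol U) (gens U N)" by (simp add: rel_ideal_def flip: mo_add)
  qed
qed

text \<open>Putting F below B lowers the local rank of B by at most k, so the power d + k of the sum
  above B is a relation for N. To turn k of these factors into the sum above F, each variable G
  above F but not above B must be killed: if G is below B, it brings F into the join below B; if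
  not, B is replaced by the join of G and B, whose local rank is again at most d.\<close>

lemma sig_power_gen:
  assumes m: "set_mset m \<subseteq> U" and B: "B \<in> U"
  defines "d \<equiv> dl (set_mset m \<union> insert F N) B"
  shows "mo m * sig U B ^ d * sig U F ^ k \<in> rel_ideal U N"
proof (cases "F \<subset> B")
  case False
  have "F \<noteq> B" using FU B by auto
  then have "J (set_mset m \<union> insert F N) B = J (set_mset m \<union> N) B" using False by (auto simp: J_def)
  then have "d = dl (set_mset m \<union> N) B" by (simp add: d_def dl_def)
  then have "mo m * sig U B ^ d \<in> rel_ideal U N" using rel_ideal_b[OF m B, of N d] by simp
  then have "sig U F ^ k * (mo m * sig U B ^ d) \<in> rel_ideal U N" by (rule rel_ideal_mono) (intro pol_power sig_pol)
  then show ?thesis by (simp add: mult.commute)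
next
  case FB: True
  let ?D = "set_mset m \<union> N" and ?D' = "set_mset m \<union> insert F N"
  have JD: "J ?D' B = J ?D B \<union> F" using FB by (auto simp: J_def)
  have JF: "J N F \<subseteq> J ?D B" by (rule J_mono2) (use FB in auto)
  show ?thesis
    unfolding rel_ideal_def
  proof (rule sig_replace[OF finU, of F B])
    show "F \<subseteq> B" using FB by auto
    have "rk (F \<union> J ?D B) + rk (J N F) \<le> rk F + rk (J ?D B)" by (rule rk_submod_le) (use JF J_sub in auto)
    then have "dl ?D B \<le> d + k" unfolding d_def k dl_def JD by (simp add: Un_commute)
    then have "mo m * sig U B ^ (d + k) \<in> rel_ideal U N" by (rule rel_ideal_b[OF m B])
    then show "mo m * sig U B ^ d * sig U B ^ k \<in> idl (pol U) (gens U N)" by (simp add: rel_ideal_def power_add mult.assoc)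
    fix G assume G: "G \<in> U" "F \<subseteq> G" "\<not> B \<subseteq> G"
    have m': "set_mset (add_mset G m) \<subseteq> U" using m G by auto
    let ?D2 = "set_mset (add_mset G m) \<union> N"
    have GG: "G \<in> \<G>" "B \<in> \<G>" using G B U by auto
    have "mo (add_mset G m) * sig U B ^ d \<in> rel_ideal U N"
    proof (cases "G \<subseteq> B")
      case True
      then have "G \<subset> B" using G by auto
      then have "J ?D' B \<subseteq> J ?D2 B" unfolding JD using G(2) by (auto simp: J_def)
      then have "dl ?D2 B \<le> d" unfolding d_def dl_def using rk_mono by (meson diff_le_mono2)
      then show ?thesis by (rule rel_ideal_b[OF m' B])
    next
      case False
      let ?W = "cl (G \<union> B)"
      have GB: "G \<inter> B \<noteq> {}" using G FB G_ne[OF F] by auto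
      have W: "?W \<in> \<G>" by (rule join_in[OF GG GB])
      have GBE: "G \<union> B \<subseteq> E" using GG G_E by auto
      have sub: "G \<subseteq> ?W" "B \<subseteq> ?W" using cl_ext[OF GBE] by auto
      have WU: "?W \<in> U" by (rule upU[OF B W sub(2)])
      have "G \<subset> ?W" using sub G by auto
      then have GJ: "G \<subseteq> J ?D2 ?W" by (intro J_upper) auto
      have JJ: "J ?D' B \<subseteq> J ?D2 ?W"
        unfolding JD using J_mono2[of ?D ?D2 B ?W] GJ G(2) sub(2) by auto
      have "dl ?D2 ?W \<le> d"
      proof -
        have "rk ?W = rk (G \<union> B)" by (rule rk_cl)
        also have "\<dots> \<le> rk (J ?D2 ?W \<union> B)" by (rule rk_mono) (use GJ in auto)
        finally have 1: "rk ?W \<le> rk (J ?D2 ?W \<union> B)" .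
        have "rk (J ?D2 ?W \<union> B) + rk (J ?D' B) \<le> rk (J ?D2 ?W) + rk B" by (rule rk_submod_le) (use JJ J_sub in auto)
        then show ?thesis using 1 unfolding d_def dl_def by linarith
      qed
      then have "mo (add_mset G m) * sig U ?W ^ d \<in> rel_ideal U N" by (rule rel_ideal_b[OF m' WU])
      then show ?thesis unfolding rel_ideal_def
        by (intro mo_sig_replace[OF finU U G(1) B GB G(3) m]) (auto simp flip: rel_ideal_def intro: rel_ideal_a)
    qed
    then show "mo m * sig U B ^ d * mo {#G#} \<in> idl (pol U) (gens U N)"
      using mo_add[of m "{#G#}"] by (simp add: rel_ideal_def ac_simps)
  qed
qed

lemma sig_power_ideal: assumes "c \<in> rel_ideal U (insert F N)" shows "sig U F ^ k * c \<in> rel_ideal U N"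
proof -
  have "rel_ideal U (insert F N) \<subseteq> {c. sig U F ^ k * c \<in> rel_ideal U N}"
    unfolding rel_ideal_def
  proof (rule idl_least, unfold rel_ideal_def[symmetric])
    fix c g assume c: "c \<in> pol U" and "g \<in> gens U (insert F N)"
    then have "g * sig U F ^ k \<in> rel_ideal U N" unfolding gens_def using sig_power_nonnested sig_power_gen by auto
    then have "c * (g * sig U F ^ k) \<in> rel_ideal U N" using c by (rule rel_ideal_mono)
    then show "c * g \<in> {c. sig U F ^ k * c \<in> rel_ideal U N}" by (simp add: ac_simps)
  qed (auto simp: rel_ideal_0 algebra_simps intro: rel_ideal_add)
  then show ?thesis using assms by auto
qed

lemma rel_ideal_insert: "rel_ideal U N \<subseteq> rel_ideal U (insert F N)"
  unfolding rel_ideal_def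
proof (rule idl_mono[OF pol_subring order_refl], unfold rel_ideal_def[symmetric], rule subsetI)
  fix g assume "g \<in> gens U N"
  then consider m where "g = mo m" "set_mset m \<subseteq> U" "\<not> nst (set_mset m \<union> N)"
    | m B where "g = mo m * sig U B ^ dl (set_mset m \<union> N) B" "set_mset m \<subseteq> U" "B \<in> U" unfolding gens_def by auto
  then show "g \<in> rel_ideal U (insert F N)"
  proof cases
    case 1
    then have "\<not> nst (set_mset m \<union> insert F N)" using nst_sub[of "set_mset m \<union> insert F N" "set_mset m \<union> N"] by auto
    then show ?thesis using 1 rel_ideal_a by auto
  next
    case 2
    then show ?thesis using rel_ideal_b[OF 2(2,3), of "insert F N"] dl_anti[of "set_mset m \<union> N" "set_mset m \<union> insert F N" B] by auto
  qed
qed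

end

lemma gens_pol: "gens U N \<subseteq> pol U"
  unfolding gens_def by (auto intro!: pol_mult pol_power sig_pol pol_mo)

lemma rel_ideal_pol: "rel_ideal U N \<subseteq> pol U"
  unfolding rel_ideal_def by (rule idl_least) (use gens_pol in \<open>auto intro: pol_0 pol_add pol_mult\<close>)

lemma rel_ideal_uminus: "p \<in> rel_ideal U N \<Longrightarrow> - p \<in> rel_ideal U N" unfolding rel_ideal_def by (rule idl_uminus[OF pol_subring])
lemma rel_ideal_diff: "p \<in> rel_ideal U N \<Longrightarrow> q \<in> rel_ideal U N \<Longrightarrow> p - q \<in> rel_ideal U N" unfolding rel_ideal_def by (rule idl_diff[OF pol_subring])

lemma FY_span_add: "p \<in> FY_span U N \<Longrightarrow> q \<in> FY_span U N \<Longrightarrow> p + q \<in> FY_span U N"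
  unfolding FY_span_def using Poly_Mapping.keys_add[of p q] by blast
lemma FY_span_0: "0 \<in> FY_span U N" by (simp add: FY_span_def)
lemma FY_span_uminus: "p \<in> FY_span U N \<Longrightarrow> - p \<in> FY_span U N" by (simp add: FY_span_def keys_def)

definition direct :: "'a set set \<Rightarrow> 'a set set \<Rightarrow> bool" where
  "direct U N \<longleftrightarrow> (\<forall>p\<in>pol U. \<exists>f\<in>FY_span U N. p - f \<in> rel_ideal U N) \<and> FY_span U N \<inter> rel_ideal U N \<subseteq> {0}"

section \<open>Adding one variable: division by a monic polynomial\<close>

context
  fixes U N F k
  assumes U: "U \<subseteq> \<G>" and F: "F \<in> \<G>" and up: "\<And>G H. G \<in> insert F U \<Longrightarrow> H \<in> \<G> \<Longrightarrow> G \<subseteq> H \<Longrightarrow> H \<in> insert F U"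
    and FU: "F \<notin> U" and mn: "\<And>G. G \<in> U \<Longrightarrow> \<not> G \<subseteq> F" and N: "nst N" and k: "k = dl N F"
begin

abbreviation (input) UF where "UF \<equiv> insert F U"
abbreviation (input) xF where "xF \<equiv> mo {#F#}"
abbreviation (input) sF where "sF \<equiv> sig U F"

lemma k_pos: "0 < k" unfolding k by (rule dl_pos[OF N F])

lemma sig_UF: "B \<in> U \<Longrightarrow> sig UF B = sig U B"
  unfolding sig_def by (rule sum.cong) (use mn in auto)

lemma sig_UF_F: "sig UF F = xF + sF"
proof -
  have "{G\<in>UF. F \<subseteq> G} = insert F {G\<in>U. F \<subseteq> G}" by auto
  then show ?thesis unfolding sig_def using FU finite_subset[OF U finG] by simp
qed

lemma rel_ideal_UF: "rel_ideal U N \<subseteq> rel_ideal UF N"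
  unfolding rel_ideal_def
proof (rule idl_mono[OF pol_subring], unfold rel_ideal_def[symmetric])
  show "pol U \<subseteq> pol UF" by (rule pol_mono) auto
  show "gens U N \<subseteq> rel_ideal UF N"
  proof
    fix g assume "g \<in> gens U N"
    then consider m where "g = mo m" "set_mset m \<subseteq> U" "\<not> nst (set_mset m \<union> N)"
      | m B where "g = mo m * sig UF B ^ dl (set_mset m \<union> N) B" "set_mset m \<subseteq> U" "B \<in> U" unfolding gens_def using sig_UF by auto
    then show "g \<in> rel_ideal UF N"
    proof cases
      case 1 show ?thesis unfolding 1(1) by (rule rel_ideal_a) (use 1 in auto)
    next
      case 2 show ?thesis unfolding 2(1) by (rule rel_ideal_b) (use 2 in auto)
    qed
  qed
qed

text \<open>The factor \<open>xF\<close> puts F into the support of each monomial, where it plays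
  the role that it had in \<open>insert F N\<close>.\<close>

lemma xKK: "c \<in> rel_ideal U (insert F N) \<Longrightarrow> xF * c \<in> rel_ideal UF N"
proof -
  have "rel_ideal U (insert F N) \<subseteq> {c. xF * c \<in> rel_ideal UF N}"
    unfolding rel_ideal_def
  proof (rule idl_least, unfold rel_ideal_def[symmetric])
    fix c g assume c: "c \<in> pol U" and "g \<in> gens U (insert F N)"
    then consider m where "g = mo m" "set_mset m \<subseteq> U" "\<not> nst (set_mset m \<union> insert F N)"
      | m B where "g = mo m * sig UF B ^ dl (set_mset m \<union> insert F N) B" "set_mset m \<subseteq> U" "B \<in> U" unfolding gens_def using sig_UF by auto
    then have "xF * g \<in> rel_ideal UF N"
    proof cases
      case 1
      have "mo (add_mset F m) \<in> rel_ideal UF N" by (rule rel_ideal_a) (use 1 in auto)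
      then show ?thesis using mo_add[of "{#F#}" m] 1 by simp
    next
      case 2
      have "mo (add_mset F m) * sig UF B ^ dl (set_mset m \<union> insert F N) B \<in> rel_ideal UF N" by (rule rel_ideal_b) (use 2 in auto)
      then show ?thesis using mo_add[of "{#F#}" m] 2 by (simp add: mult.assoc)
    qed
    moreover have "c \<in> pol UF" using c pol_mono[of U UF] by auto
    ultimately have "c * (xF * g) \<in> rel_ideal UF N" by (rule rel_ideal_mono)
    then show "c * g \<in> {c. xF * c \<in> rel_ideal UF N}" by (simp add: ac_simps)
  qed (auto simp: rel_ideal_0 algebra_simps intro: rel_ideal_add)
  then show "c \<in> rel_ideal U (insert F N) \<Longrightarrow> xF * c \<in> rel_ideal UF N" by auto
qed

lemma xsk: "(xF + sF) ^ k \<in> rel_ideal UF N"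
  using rel_ideal_b[of "{#}" UF F N k] k sig_UF_F by (simp add: mo_0)

lemma dlF: "set_mset m \<subseteq> UF \<Longrightarrow> dl (set_mset m \<union> N) F = k"
proof -
  assume "set_mset m \<subseteq> UF"
  then have "{H\<in>set_mset m \<union> N. H \<subset> F} = {H\<in>N. H \<subset> F}" using mn by auto
  then show ?thesis unfolding k dl_def J_def by simp
qed

lemma FY_UF: "FY U N \<subseteq> FY UF N" by (auto simp: FY_def)

text \<open>The basis side of the splitting: exponent 0 of F leaves the set N as it is, the
  exponents 1 to k - 1 move F into it. The local rank of F is k for every support, as nothing in
  play lies strictly below F.\<close>

lemma FY_rep: assumes m: "F \<notin># m"
  shows "m + replicate_mset j F \<in> FY UF N \<longleftrightarrow> j < k \<and> m \<in> FY U (if j = 0 then N else insert F N)"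
proof (cases "j = 0")
  case True
  then show ?thesis using m k_pos by (auto simp: FY_def)
next
  case False
  have D: "set_mset (m + replicate_mset j F) \<union> N = set_mset m \<union> insert F N" using False by auto
  have c: "count (m + replicate_mset j F) F = j" using m by (simp add: not_in_iff)
  have c': "count (m + replicate_mset j F) G = count m G" if "G \<in># m" for G using m that by auto
  have dF: "dl (set_mset m \<union> insert F N) F = k" if "set_mset m \<subseteq> UF"
    using dlF[of "m + replicate_mset j F"] that D by auto
  have G: "(\<forall>G\<in>#m + replicate_mset j F. count (m + replicate_mset j F) G < dl (set_mset m \<union> insert F N) G) \<longleftrightarrow>
     (\<forall>G\<in>#m. count m G < dl (set_mset m \<union> insert F N) G) \<and> j < dl (set_mset m \<union> insert F N) F"
    using False c c' by (auto simp: ball_Un simp del: count_union)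
  have sF: "set_mset (m + replicate_mset j F) \<subseteq> UF \<longleftrightarrow> set_mset m \<subseteq> U" using False m by auto
  show ?thesis unfolding FY_def mem_Collect_eq D G sF using False dF by auto
qed

text \<open>The ideal for \<open>U \<union> {F}\<close>, described through division by the monic polynomial \<open>(x + s)\<^sup>k\<close> in the
  variable x of F: only the remainder \<open>l\<close> is constrained.\<close>

definition rem_form where
  "rem_form = {poly (l + [:sF, 1:] ^ k * q) xF | l q. (\<forall>i. coeff l i \<in> rel_ideal U (insert F N)) \<and> coeff l 0 \<in> rel_ideal U N \<and>
     (\<forall>i\<ge>k. coeff l i = 0) \<and> (\<forall>i. coeff q i \<in> pol U)}"

lemma rem_form_I: "(\<And>i. coeff l i \<in> rel_ideal U (insert F N)) \<Longrightarrow> coeff l 0 \<in> rel_ideal U N \<Longrightarrow> (\<And>i. i \<ge> k \<Longrightarrow> coeff l i = 0) \<Longrightarrow>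
    (\<And>i. coeff q i \<in> pol U) \<Longrightarrow> y = poly (l + [:sF, 1:] ^ k * q) xF \<Longrightarrow> y \<in> rem_form"
  unfolding rem_form_def by blast

lemma rem_form_E: assumes "y \<in> rem_form"
  obtains l q where "\<forall>i. coeff l i \<in> rel_ideal U (insert F N)" "coeff l 0 \<in> rel_ideal U N" "\<forall>i\<ge>k. coeff l i = 0"
    "\<forall>i. coeff q i \<in> pol U" "y = poly (l + [:sF, 1:] ^ k * q) xF"
  using assms unfolding rem_form_def by blast

lemma rem_form_0: "0 \<in> rem_form"
  by (rule rem_form_I[of 0 0]) (auto intro: rel_ideal_0 pol_0)

lemma rem_form_add: assumes "y \<in> rem_form" "z \<in> rem_form" shows "y + z \<in> rem_form"
proof -
  obtain l q where 1: "\<forall>i. coeff l i \<in> rel_ideal U (insert F N)" "coeff l 0 \<in> rel_ideal U N" "\<forall>i\<ge>k. coeff l i = 0"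
    "\<forall>i. coeff q i \<in> pol U" "y = poly (l + [:sF, 1:] ^ k * q) xF" using rem_form_E[OF assms(1)] .
  obtain l' q' where 2: "\<forall>i. coeff l' i \<in> rel_ideal U (insert F N)" "coeff l' 0 \<in> rel_ideal U N" "\<forall>i\<ge>k. coeff l' i = 0"
    "\<forall>i. coeff q' i \<in> pol U" "z = poly (l' + [:sF, 1:] ^ k * q') xF" using rem_form_E[OF assms(2)] .
  show ?thesis
    by (rule rem_form_I[of "l + l'" "q + q'"]) (use 1 2 in \<open>auto intro: rel_ideal_add pol_add simp: algebra_simps\<close>)
qed

lemma rem_form_const: assumes "y \<in> rem_form" "c \<in> pol U" shows "c * y \<in> rem_form"
proof -
  obtain l q where 1: "\<forall>i. coeff l i \<in> rel_ideal U (insert F N)" "coeff l 0 \<in> rel_ideal U N" "\<forall>i\<ge>k. coeff l i = 0"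
    "\<forall>i. coeff q i \<in> pol U" "y = poly (l + [:sF, 1:] ^ k * q) xF" using rem_form_E[OF assms(1)] .
  show ?thesis
    by (rule rem_form_I[of "smult c l" "smult c q"]) (use 1 assms in \<open>auto intro: rel_ideal_mono pol_mult simp: algebra_simps\<close>)
qed

text \<open>Multiplication by the variable pushes the top coefficient c of l into degree k;
  subtracting c times the monic polynomial removes it again. The constant coefficient becomes - s^k
  c, which lies in the ideal of N by \<open>sig_power_ideal\<close>.\<close>

lemma rem_form_x_aux:
  assumes l: "\<And>i. coeff l i \<in> rel_ideal U (insert F N)" "\<And>i. i \<ge> k \<Longrightarrow> coeff l i = 0" and q: "\<And>i. coeff q i \<in> pol U"
  shows "xF * poly (l + [:sF, 1:] ^ k * q) xF \<in> rem_form"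
proof -
  define c where "c = coeff l (k - 1)"
  have cC: "c \<in> rel_ideal U (insert F N)" using l by (simp add: c_def)
  let ?M = "[:sF, 1:] ^ k"
  have Mp: "coeff ?M i \<in> pol U" for i using lin_power_coeff(4)[OF sig_pol] .
  have cf: "coeff (pCons 0 l - smult c ?M) i = (case i of 0 \<Rightarrow> 0 | Suc j \<Rightarrow> coeff l j) - coeff ?M i * c" for i
    by (simp add: coeff_pCons mult.commute)
  show ?thesis
  proof (rule rem_form_I[of "pCons 0 l - smult c ?M" "pCons 0 q + [:c:]"])
    fix i
    have "coeff ?M i * c \<in> rel_ideal U (insert F N)" by (rule rel_ideal_mono[OF cC Mp])
    then show "coeff (pCons 0 l - smult c ?M) i \<in> rel_ideal U (insert F N)"
      unfolding cf by (intro rel_ideal_diff) (auto simp: l rel_ideal_0 split: nat.split)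
    show "coeff (pCons 0 q + [:c:]) i \<in> pol U"
      using q cC rel_ideal_pol by (auto simp: coeff_pCons intro: pol_add pol_0 split: nat.split)
  next
    have "sF ^ k * c \<in> rel_ideal U N" by (rule sig_power_ideal[OF U F up FU mn N k cC])
    then show "coeff (pCons 0 l - smult c ?M) 0 \<in> rel_ideal U N"
      unfolding cf lin_power_coeff(3) using rel_ideal_uminus by auto
  next
    fix i assume i: "k \<le> i"
    show "coeff (pCons 0 l - smult c ?M) i = 0"
    proof (cases "i = k")
      case True
      then show ?thesis unfolding cf using k_pos lin_power_coeff(1)[of sF k] by (auto simp: c_def split: nat.split)
    next
      case False
      then show ?thesis unfolding cf using i l(2) lin_power_coeff(2)[of k i sF] by (auto split: nat.split)
    qed
  next
    have "pCons 0 l - smult c ?M + ?M * (pCons 0 q + [:c:]) = pCons 0 (l + ?M * q)"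
      by (simp add: algebra_simps)
    then show "xF * poly (l + ?M * q) xF = poly (pCons 0 l - smult c ?M + ?M * (pCons 0 q + [:c:])) xF"
      by (simp only: poly_pCons) simp
  qed
qed

lemma rem_form_x: assumes "y \<in> rem_form" shows "xF * y \<in> rem_form"
proof -
  obtain l q where 1: "\<forall>i. coeff l i \<in> rel_ideal U (insert F N)" "coeff l 0 \<in> rel_ideal U N" "\<forall>i\<ge>k. coeff l i = 0"
    "\<forall>i. coeff q i \<in> pol U" "y = poly (l + [:sF, 1:] ^ k * q) xF" using rem_form_E[OF assms(1)] .
  show ?thesis unfolding 1(5) by (rule rem_form_x_aux) (use 1 in auto)
qed

lemma rem_form_xj: "y \<in> rem_form \<Longrightarrow> xF ^ j * y \<in> rem_form"
  by (induction j) (auto simp: mult.assoc intro: rem_form_x)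

lemma mo_split: "mo m = mo (filter_mset (\<lambda>G. G \<noteq> F) m) * xF ^ count m F"
  by (subst split_mset[of m F]) (simp add: mo_add mo_rep)

lemma rem_form_mo: assumes "y \<in> rem_form" "set_mset m \<subseteq> UF" shows "mo m * y \<in> rem_form"
proof -
  have "mo (filter_mset (\<lambda>G. G \<noteq> F) m) * (xF ^ count m F * y) \<in> rem_form"
    by (intro rem_form_const rem_form_xj assms pol_mo) (use assms in auto)
  then show ?thesis by (subst mo_split) (simp add: mult.assoc)
qed

lemma rem_form_mult: assumes "y \<in> rem_form" "p \<in> pol UF" shows "p * y \<in> rem_form"
proof -
  have sm: "(\<Sum>i\<in>S. f i) \<in> rem_form" if "\<And>i. i \<in> S \<Longrightarrow> f i \<in> rem_form" for f :: "'a set multiset \<Rightarrow> _" and S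
    using that by (induction S rule: infinite_finite_induct) (auto intro: rem_form_0 rem_form_add)
  have "p * y = (\<Sum>m\<in>keys p. Poly_Mapping.single m (lookup p m) * y)"
    by (subst mp_sum[of p]) (simp add: sum_distrib_right)
  also have "\<dots> \<in> rem_form"
  proof (rule sm)
    fix m assume m: "m \<in> keys p"
    have "Poly_Mapping.single {#} (lookup p m) * (mo m * y) \<in> rem_form"
      by (intro rem_form_const rem_form_mo assms pol_const) (use m assms in \<open>auto simp: pol_def\<close>)
    then show "Poly_Mapping.single m (lookup p m) * y \<in> rem_form" by (subst single_mo) (simp add: mult.assoc)
  qed
  finally show ?thesis .
qed

lemma rem_form_A: assumes "a \<in> rel_ideal U N" shows "a \<in> rem_form"
proof (rule rem_form_I[of "[:a:]" 0])
  have "rel_ideal U N \<subseteq> rel_ideal U (insert F N)" by (rule rel_ideal_insert[OF U F up FU mn N k])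
  then have aC: "a \<in> rel_ideal U (insert F N)" using assms by auto
  then show "coeff [:a:] i \<in> rel_ideal U (insert F N)" for i by (auto simp: coeff_pCons rel_ideal_0 split: nat.split)
  show "coeff [:a:] i = 0" if "i \<ge> k" for i using k_pos that by (auto simp: coeff_pCons split: nat.split)
qed (use assms in \<open>auto intro: pol_0\<close>)

text \<open>As a constant, c satisfies the weaker condition only; one multiplication by
  \<open>xF\<close> already brings it into \<open>rem_form\<close>.\<close>

lemma rem_form_C: assumes "c \<in> rel_ideal U (insert F N)" "0 < j" shows "xF ^ j * c \<in> rem_form"
proof -
  have "xF * poly ([:c:] + [:sF, 1:] ^ k * 0) xF \<in> rem_form"
    by (rule rem_form_x_aux) (use assms k_pos in \<open>auto simp: coeff_pCons intro: rel_ideal_0 pol_0 split: nat.split\<close>)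
  then have "xF ^ (j - 1) * (xF * c) \<in> rem_form" by (intro rem_form_xj) simp
  moreover have "xF ^ j = xF ^ (j - 1) * xF" using assms(2) by (metis power_minus_mult)
  ultimately show ?thesis by (simp add: mult.assoc)
qed

lemma rel_ideal_rem_form: "rel_ideal UF N \<subseteq> rem_form"
  unfolding rel_ideal_def
proof (rule idl_least)
  fix c g assume c: "c \<in> pol UF" and "g \<in> gens UF N"
  then consider m where "g = mo m" "set_mset m \<subseteq> UF" "\<not> nst (set_mset m \<union> N)"
    | m B where "g = mo m * sig UF B ^ dl (set_mset m \<union> N) B" "set_mset m \<subseteq> UF" "B \<in> UF" unfolding gens_def by auto
  then have "g \<in> rem_form"
  proof cases
    case 1
    let ?m = "filter_mset (\<lambda>G. G \<noteq> F) m"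
    have mU: "set_mset ?m \<subseteq> U" using 1 by auto
    show ?thesis
    proof (cases "count m F = 0")
      case True
      then have "?m = m" by (metis add.right_neutral replicate_mset_0 split_mset)
      then show ?thesis using 1 rel_ideal_a[OF mU, of N] rem_form_A by simp
    next
      case False
      then have "set_mset m \<union> N = set_mset ?m \<union> insert F N" by auto
      then have "mo ?m \<in> rel_ideal U (insert F N)" using 1 by (intro rel_ideal_a mU) auto
      then have "xF ^ count m F * mo ?m \<in> rem_form" using False by (intro rem_form_C) auto
      then show ?thesis unfolding 1(1) by (subst mo_split) (simp add: mult.commute)
    qed
  next
    case 2
    let ?m = "filter_mset (\<lambda>G. G \<noteq> F) m"
    have mU: "set_mset ?m \<subseteq> U" using 2 by auto
    show ?thesis
    proof (cases "B = F")
      case True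
      have "(xF + sF) ^ k \<in> rem_form"
        by (rule rem_form_I[of 0 1]) (auto simp: coeff_1 rel_ideal_0 pol_0 pol_1 add.commute)
      then have "mo m * (xF + sF) ^ k \<in> rem_form" by (rule rem_form_mo[OF _ 2(2)])
      then show ?thesis using 2 True dlF[OF 2(2)] sig_UF_F by simp
    next
      case False
      then have B: "B \<in> U" using 2 by auto
      show ?thesis
      proof (cases "count m F = 0")
        case True
        then have "?m = m" by (metis add.right_neutral replicate_mset_0 split_mset)
        then show ?thesis using 2 rel_ideal_b[OF mU B, of N] rem_form_A sig_UF[OF B] by simp
      next
        case F0: False
        then have D: "set_mset m \<union> N = set_mset ?m \<union> insert F N" by auto
        have "mo ?m * sig U B ^ dl (set_mset m \<union> N) B \<in> rel_ideal U (insert F N)" unfolding D by (intro rel_ideal_b mU B) simp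
        then have "xF ^ count m F * (mo ?m * sig U B ^ dl (set_mset m \<union> N) B) \<in> rem_form" using F0 by (intro rem_form_C) auto
        then show ?thesis unfolding 2(1) sig_UF[OF B] by (subst mo_split) (simp add: ac_simps)
      qed
    qed
  qed
  then show "c * g \<in> rem_form" using c by (rule rem_form_mult)
qed (auto intro: rem_form_0 rem_form_add)

text \<open>For independence the remainder form of an element is compared with its expansion in the
  basis: the quotient q vanishes and each coefficient of l falls under one of the two hypotheses.
  Spanning is by induction on the exponent of F: exponents below k are settled by the hypotheses,
  larger ones are lowered by the relation \<open>xsk\<close>.\<close>

lemma direct_step:
  assumes d0: "direct U N" and d1: "direct U (insert F N)" shows "direct UF N"
  unfolding direct_def
proof (intro conjI ballI subsetI)
  fix v assume "v \<in> FY_span UF N \<inter> rel_ideal UF N"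
  then have v: "v \<in> FY_span UF N" "v \<in> rem_form" using rel_ideal_rem_form by auto
  obtain l q where 1: "\<forall>i. coeff l i \<in> rel_ideal U (insert F N)" "coeff l 0 \<in> rel_ideal U N" "\<forall>i\<ge>k. coeff l i = 0"
    "\<forall>i. coeff q i \<in> pol U" "v = poly (l + [:sF, 1:] ^ k * q) xF" using rem_form_E[OF v(2)] .
  let ?M = "[:sF, 1:] ^ k"
  let ?p = "l + ?M * q"
  have Mq: "coeff (?M * q) i \<in> pol U" for i
    unfolding coeff_mult using lin_power_coeff(4)[OF sig_pol] 1(4) by (auto intro!: pol_sum pol_mult)
  have pp: "coeff ?p i \<in> pol U" for i using Mq 1(1) rel_ideal_pol[of U "insert F N"] by (auto intro!: pol_add)
  have lk: "lookup (coeff ?p j) m = lookup v (m + replicate_mset j F)" if "F \<notin># m" for j m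
    using lookup_poly_eval[OF pp FU that] 1(5) by simp
  have kp: "F \<notin># m \<and> j < k \<and> m \<in> FY U (if j = 0 then N else insert F N)" if "m \<in> keys (coeff ?p j)" for j m
  proof -
    have F0: "F \<notin># m" using that pp[of j] FU by (auto simp: pol_def)
    then have "m + replicate_mset j F \<in> keys v" using that lk[OF F0] by (simp add: in_keys_iff)
    then have "m + replicate_mset j F \<in> FY UF N" using v by (auto simp: FY_span_def)
    then show ?thesis using FY_rep[OF F0] F0 by simp
  qed
  \<comment> \<open>Basis monomials have exponent of F below k, and so does l; hence the multiple of
    the monic polynomial has no terms from degree k on.\<close>
  have "coeff (?M * q) j = 0" if "j \<ge> k" for j
  proof -
    have "keys (coeff ?p j) = {}" using kp[of _ j] that by fastforce
    then have "coeff ?p j = 0" by simp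
    then show ?thesis using 1(3) that by simp
  qed
  then have q0: "q = 0"
    using monic_mult_zero[of "[:sF, 1:] ^ k" k q] lin_power_coeff(1,2) by blast
  have "coeff l j = 0" for j
  proof -
    have "keys (coeff l j) \<subseteq> FY U (if j = 0 then N else insert F N)" using kp[of _ j] q0 by auto
    then have "coeff l j \<in> FY_span U (if j = 0 then N else insert F N) \<inter> rel_ideal U (if j = 0 then N else insert F N)"
      using 1 by (auto simp: FY_span_def)
    then show ?thesis using d0 d1 unfolding direct_def by (auto split: if_splits)
  qed
  then have "l = 0" by (intro poly_eqI) simp
  then show "v \<in> {0}" using 1(5) q0 by simp
next
  define Good where "Good = {p. \<exists>f\<in>FY_span UF N. p - f \<in> rel_ideal UF N}"
  have G0: "0 \<in> Good" unfolding Good_def using FY_span_0 rel_ideal_0 by force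
  have Gadd: "p + q \<in> Good" if "p \<in> Good" "q \<in> Good" for p q
  proof -
    obtain f g where f: "f \<in> FY_span UF N" "p - f \<in> rel_ideal UF N" and g: "g \<in> FY_span UF N" "q - g \<in> rel_ideal UF N" using \<open>p \<in> Good\<close> \<open>q \<in> Good\<close> unfolding Good_def by auto
    have e: "p + q - (f + g) = (p - f) + (q - g)" by simp
    have "p + q - (f + g) \<in> rel_ideal UF N" unfolding e by (rule rel_ideal_add[OF f(2) g(2)])
    then show ?thesis unfolding Good_def using FY_span_add[OF f(1) g(1)] by blast
  qed
  have Gmin: "- p \<in> Good" if "p \<in> Good" for p
  proof -
    obtain f where f: "f \<in> FY_span UF N" "p - f \<in> rel_ideal UF N" using \<open>p \<in> Good\<close> unfolding Good_def by auto
    have e: "- p - (- f) = - (p - f)" by simp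
    have "- p - (- f) \<in> rel_ideal UF N" unfolding e by (rule rel_ideal_uminus[OF f(2)])
    then show ?thesis unfolding Good_def using FY_span_uminus[OF f(1)] by blast
  qed
  have Gsum: "(\<Sum>i\<in>S. f i) \<in> Good" if "\<And>i. i \<in> S \<Longrightarrow> f i \<in> Good" for f :: "'c \<Rightarrow> _" and S :: "'c set"
    using that by (induction S rule: infinite_finite_induct) (auto intro: G0 Gadd)
  have GK: "p \<in> Good" if "p \<in> rel_ideal UF N" for p unfolding Good_def using FY_span_0 that by force
  have Gx: "xF ^ j * r \<in> Good" if "r \<in> pol U" for j r
    using that
  proof (induction j arbitrary: r rule: less_induct)
    case (less j)
    consider "j = 0" | "0 < j" "j < k" | "k \<le> j" by linarith
    then show ?case
    proof cases
      case 1
      obtain f where f: "f \<in> FY_span U N" "r - f \<in> rel_ideal U N" using d0 less.prems unfolding direct_def by auto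
      have "f \<in> FY_span UF N" using f FY_UF by (auto simp: FY_span_def)
      then show ?thesis using 1 f rel_ideal_UF unfolding Good_def by auto
    next
      case 2
      obtain f where f: "f \<in> FY_span U (insert F N)" "r - f \<in> rel_ideal U (insert F N)" using d1 less.prems unfolding direct_def by auto
      have "xF ^ j * f \<in> FY_span UF N"
        unfolding FY_span_def
      proof (intro CollectI subsetI)
        fix m assume m: "m \<in> keys (xF ^ j * f)"
        then have "replicate_mset j F \<subseteq># m" "m - replicate_mset j F \<in> keys f"
          by (auto simp: in_keys_iff mo_rep lookup_mult_mo mult.commute[of _ f] split: if_splits)
        then obtain n where n: "m = n + replicate_mset j F" "n \<in> FY U (insert F N)" using f(1) unfolding FY_span_def
          by (metis subset_mset.diff_add mem_Collect_eq subsetD)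
        moreover have "F \<notin># n" using n FU by (auto simp: FY_def)
        ultimately show "m \<in> FY UF N" using FY_rep[of n j] 2 by simp
      qed
      moreover have "xF ^ j * r - xF ^ j * f \<in> rel_ideal UF N"
      proof -
        have "xF ^ (j - 1) * (xF * (r - f)) \<in> rel_ideal UF N" by (intro rel_ideal_mono xKK f pol_power pol_mo) auto
        moreover have "xF ^ j = xF ^ (j - 1) * xF" using 2 by (metis power_minus_mult)
        ultimately show ?thesis by (simp add: algebra_simps)
      qed
      ultimately show ?thesis unfolding Good_def by auto
    next
      case 3
      have rU': "r \<in> pol UF" using less.prems pol_mono[of U UF] by auto
      have "xF ^ (j - k) * r * (xF + sF) ^ k \<in> rel_ideal UF N" by (intro rel_ideal_mono xsk pol_mult pol_power pol_mo rU') auto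
      then have g1: "xF ^ (j - k) * r * (xF + sF) ^ k \<in> Good" by (rule GK)
      \<comment> \<open>Isolating the top term expresses the power k of \<open>xF\<close> by lower
        powers modulo the ideal.\<close>
      have "(xF + sF) ^ k = (\<Sum>i\<le>k. of_nat (k choose i) * xF ^ i * sF ^ (k - i))" by (rule binomial_ring)
      also have "\<dots> = (\<Sum>i<k. of_nat (k choose i) * xF ^ i * sF ^ (k - i)) + xF ^ k"
        by (simp add: lessThan_Suc_atMost[symmetric])
      finally have e: "(xF + sF) ^ k = (\<Sum>i<k. of_nat (k choose i) * xF ^ i * sF ^ (k - i)) + xF ^ k" .
      have xj: "xF ^ j = xF ^ (j - k) * xF ^ k" using 3 by (simp flip: power_add)
      have "xF ^ j * r = xF ^ (j - k) * r * (xF + sF) ^ k - xF ^ (j - k) * r * (\<Sum>i<k. of_nat (k choose i) * xF ^ i * sF ^ (k - i))"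
        unfolding e xj by (simp add: algebra_simps)
      also have "xF ^ (j - k) * r * (\<Sum>i<k. of_nat (k choose i) * xF ^ i * sF ^ (k - i)) =
          (\<Sum>i<k. xF ^ (j - k + i) * (r * of_nat (k choose i) * sF ^ (k - i)))"
        unfolding sum_distrib_left by (rule sum.cong) (simp_all add: power_add ac_simps)
      finally have eq: "xF ^ j * r = xF ^ (j - k) * r * (xF + sF) ^ k + - (\<Sum>i<k. xF ^ (j - k + i) * (r * of_nat (k choose i) * sF ^ (k - i)))" by simp
      have "(\<Sum>i<k. xF ^ (j - k + i) * (r * of_nat (k choose i) * sF ^ (k - i))) \<in> Good"
      proof (rule Gsum)
        fix i assume "i \<in> {..<k}"
        then show "xF ^ (j - k + i) * (r * of_nat (k choose i) * sF ^ (k - i)) \<in> Good"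
          using 3 less.prems by (intro less.IH pol_mult pol_power sig_pol pol_of_nat) auto
      qed
      then show ?thesis unfolding eq by (intro Gadd g1 Gmin)
    qed
  qed
  fix p assume p: "p \<in> pol UF"
  have "(\<Sum>m\<in>keys p. Poly_Mapping.single m (lookup p m)) \<in> Good"
  proof (rule Gsum)
    fix m assume m: "m \<in> keys p"
    have "set_mset (filter_mset (\<lambda>G. G \<noteq> F) m) \<subseteq> U" using m p by (auto simp: pol_def)
    then have "xF ^ count m F * (Poly_Mapping.single {#} (lookup p m) * mo (filter_mset (\<lambda>G. G \<noteq> F) m)) \<in> Good"
      by (intro Gx pol_mult pol_const pol_mo)
    moreover have "xF ^ count m F * (Poly_Mapping.single {#} (lookup p m) * mo (filter_mset (\<lambda>G. G \<noteq> F) m)) = Poly_Mapping.single m (lookup p m)"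
      unfolding single_mo[of m] mo_split[of m] by (simp only: ac_simps)
    ultimately show "Poly_Mapping.single m (lookup p m) \<in> Good" by simp
  qed
  then have "p \<in> Good" using mp_sum[of p] by simp
  then show "\<exists>f\<in>FY_span UF N. p - f \<in> rel_ideal UF N" unfolding Good_def by auto
qed

end

text \<open>Needed because \<open>insert F N\<close> may fail to be nested in the induction. Then 1
  is a relation and there are no basis monomials.\<close>

lemma direct_nn: assumes "\<not> nst N" shows "direct U N"
proof -
  have "\<not> nst (set_mset m \<union> N)" for m using nst_sub[of "set_mset m \<union> N" N] assms by auto
  then have "FY U N = {}" by (auto simp: FY_def)
  then have V: "FY_span U N = {0}" by (auto simp: FY_span_def)
  have "mo {#} \<in> rel_ideal U N" by (rule rel_ideal_a) (use assms in auto)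
  then have one: "1 \<in> rel_ideal U N" by (simp add: mo_0)
  have "p \<in> rel_ideal U N" if "p \<in> pol U" for p using rel_ideal_mono[OF one that] by simp
  then show ?thesis unfolding direct_def V by auto
qed

text \<open>A minimal F is removed from U, which leaves U up-closed; N stays arbitrary because the
  step calls for both N and \<open>insert F N\<close>.\<close>

theorem direct_upset:
  assumes "U \<subseteq> \<G>" "\<And>G H. G \<in> U \<Longrightarrow> H \<in> \<G> \<Longrightarrow> G \<subseteq> H \<Longrightarrow> H \<in> U"
  shows "direct U N"
proof -
  have "finite U" using assms(1) finG by (rule finite_subset)
  then show ?thesis using assms
  proof (induction "card U" arbitrary: U N)
    case (0 U N)
    then have U: "U = {}" by simp
    show ?case
    proof (cases "nst N")
      case False then show ?thesis by (rule direct_nn)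
    next
      case True
      have "gens {} N = {}" using True by (auto simp: gens_def)
      then have "rel_ideal {} N \<subseteq> {0}" unfolding rel_ideal_def by (intro idl_least) auto
      moreover have "FY {} N = {{#}}" using True by (auto simp: FY_def)
      then have "pol {} = FY_span {} N" by (auto simp: pol_def FY_span_def)
      ultimately show ?thesis unfolding direct_def U using rel_ideal_0 by force
    qed
  next
    case (Suc n U N)
    show ?case
    proof (cases "nst N")
      case False then show ?thesis by (rule direct_nn)
    next
      case N: True
      have "U \<noteq> {}" using Suc by auto
      then obtain F where F: "F \<in> U" "\<And>G. G \<in> U \<Longrightarrow> G \<subseteq> F \<Longrightarrow> G = F"
        using finite_has_minimal[OF Suc.prems(1)] by metis
      define W where "W = U - {F}"
      have UW: "U = insert F W" "F \<notin> W" using F by (auto simp: W_def)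
      have c: "n = card W" using Suc UW by simp
      have upW: "H \<in> W" if "G \<in> W" "H \<in> \<G>" "G \<subseteq> H" for G H
        using Suc.prems(3)[of G H] F(2)[of G] that unfolding W_def by auto
      have IH: "direct W N'" for N' by (rule Suc.hyps(1)[OF c]) (use Suc.prems UW upW in auto)
      have "direct (insert F W) N"
      proof (rule direct_step[of W F N "dl N F"])
        show "\<not> G \<subseteq> F" if "G \<in> W" for G using F(2)[of G] that unfolding W_def by auto
        show "H \<in> insert F W" if "G \<in> insert F W" "H \<in> \<G>" "G \<subseteq> H" for G H using Suc.prems(3)[of G H] that UW by auto
      qed (use IH N Suc.prems UW in auto)
      then show ?thesis using UW by simp
    qed
  qed
qed

end

section \<open>Dimensions of the graded pieces\<close>

interpretation vs: vector_space "qscale :: rat \<Rightarrow> ('a set multiset \<Rightarrow> rat) \<Rightarrow> _"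
  by unfold_locales (auto simp: qscale_def plus_fun_def fun_eq_iff algebra_simps)

lemma lookup_add_fun: "lookup (p + q) = lookup p + lookup q" for p q :: "'a mp"
  by (simp add: fun_eq_iff lookup_add)

lemma lookup_mo_fn: "lookup (mo m) = mono_fn m" by (auto simp: fun_eq_iff lookup_mo mono_fn_def)

lemma lookup_zero_fun: "lookup 0 = 0" for p :: "'a mp" by (simp add: fun_eq_iff)

lemma lookup_const_fun: "lookup (Poly_Mapping.single {#} c * p) = qscale c (lookup p)" for p :: "'a set mp"
  by (simp add: fun_eq_iff lookup_const_mult qscale_def)

lemma finite_multisets_size: "finite A \<Longrightarrow> finite {m. set_mset m \<subseteq> A \<and> size m = n}"
proof -
  assume A: "finite A"
  have "{m. set_mset m \<subseteq> A \<and> size m = n} \<subseteq> mset ` {xs. set xs \<subseteq> A \<and> length xs = n}"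
  proof
    fix m assume m: "m \<in> {m. set_mset m \<subseteq> A \<and> size m = n}"
    obtain xs where "m = mset xs" by (metis ex_mset)
    then show "m \<in> mset ` {xs. set xs \<subseteq> A \<and> length xs = n}" using m by auto
  qed
  then show ?thesis using finite_lists_length_eq[OF A, of n] finite_surj by blast
qed

context building
begin

section \<open>The ideal of the presentation\<close>

definition pres_ideal :: "'a set mp set" where
  "pres_ideal = idl (pol \<G>) ({mo m | m. set_mset m \<subseteq> \<G> \<and> \<not> nst (set_mset m)} \<union> {sig \<G> a | a. a \<in> atoms E indep})"

lemma pres_ideal_a: "set_mset m \<subseteq> \<G> \<Longrightarrow> \<not> nst (set_mset m) \<Longrightarrow> mo m \<in> pres_ideal"
  unfolding pres_ideal_def by (rule idl_gen[OF pol_subring]) auto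

lemma pres_ideal_sig: "a \<in> atoms E indep \<Longrightarrow> sig \<G> a \<in> pres_ideal"
  unfolding pres_ideal_def by (rule idl_gen[OF pol_subring]) auto

lemma pres_ideal_mult: "c \<in> pol \<G> \<Longrightarrow> p \<in> pres_ideal \<Longrightarrow> c * p \<in> pres_ideal"
  unfolding pres_ideal_def by (rule idl_mult[OF pol_subring])

text \<open>Induction on d. Choose e in B outside the join below B. The sum above the atom of e is a
  relation, so one factor of the sum above B can be traded for variables G containing e but not
  containing B. If G is below B, it brings e into the join below B; if not, B is replaced by the
  join of G and B, with e and the old join below it. Either way the local rank is at most d.\<close>

lemma mo_sig_pres_ideal:
  assumes "set_mset m \<subseteq> \<G>" "B \<in> \<G>" "dl (set_mset m) B \<le> d" shows "mo m * sig \<G> B ^ d \<in> pres_ideal"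
  using assms
proof (induction d arbitrary: m B)
  case 0
  \<comment> \<open>A nested support has positive local rank at every member of \<G>.\<close>
  then have "\<not> nst (set_mset m)" using dl_pos[of "set_mset m" B] by auto
  then show ?case using pres_ideal_a 0 by simp
next
  case (Suc d)
  show ?case
  proof (cases "nst (set_mset m)")
    case False
    then have "sig \<G> B ^ Suc d * mo m \<in> pres_ideal" by (intro pres_ideal_mult pres_ideal_a Suc.prems pol_power sig_pol)
    then show ?thesis by (simp add: mult.commute)
  next
    case True
    let ?J = "J (set_mset m) B"
    have "?J \<noteq> B" by (rule J_ne[OF True Suc.prems(2)])
    then obtain e where e: "e \<in> B" "e \<notin> ?J" using J_sub by blast
    have BF: "B \<in> Fl" "B \<subseteq> E" using Suc.prems G_Fl G_E by auto
    have eE: "e \<in> E" using e BF by auto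
    let ?a = "cl {e}"
    have aB: "?a \<subseteq> B" using e BF by (intro cl_least) auto
    have ea: "e \<in> ?a" using cl_ext[of "{e}"] eE by auto
    have rJ: "rk (insert e ?J) = Suc (rk ?J)" by (rule rk_flat_insert[OF J_Fl[OF True] eE e(2)])
    have dle: "rk B \<le> Suc d + rk ?J" using Suc.prems(3) by (simp add: dl_def)
    have sm: "mo m * sig \<G> B ^ d * mo {#G#} \<in> pres_ideal" if G: "G \<in> \<G>" "?a \<subseteq> G" "\<not> B \<subseteq> G" for G
    proof -
      have eG: "e \<in> G" using G ea by auto
      have m': "set_mset (add_mset G m) \<subseteq> \<G>" using Suc.prems G by auto
      have "mo (add_mset G m) * sig \<G> B ^ d \<in> pres_ideal"
      proof (cases "G \<subseteq> B")
        case True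
        then have GB: "G \<subset> B" using G by auto
        have "insert e ?J \<subseteq> J (set_mset (add_mset G m)) B"
          using J_upper[of G "set_mset (add_mset G m)" B] GB eG J_mono[of "set_mset m" "set_mset (add_mset G m)" B] by auto
        then have "Suc (rk ?J) \<le> rk (J (set_mset (add_mset G m)) B)" unfolding rJ[symmetric] by (rule rk_mono)
        then have "dl (set_mset (add_mset G m)) B \<le> d" using dle by (simp add: dl_def)
        then show ?thesis by (rule Suc.IH[OF m' Suc.prems(2)])
      next
        case False
        let ?W = "cl (G \<union> B)" and ?D2 = "set_mset (add_mset G m)"
        have GB: "G \<inter> B \<noteq> {}" using e eG by auto
        have W: "?W \<in> \<G>" by (rule join_in[OF G(1) Suc.prems(2) GB])
        have GBE: "G \<union> B \<subseteq> E" using G G_E BF by auto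
        have sub: "G \<subseteq> ?W" "B \<subseteq> ?W" using cl_ext[OF GBE] by auto
        have "G \<subset> ?W" using sub G by auto
        then have GJ: "G \<subseteq> J ?D2 ?W" by (intro J_upper) auto
        have "J (set_mset m) B \<subseteq> J ?D2 ?W" by (rule J_mono2) (use sub in auto)
        then have JJ: "insert e ?J \<subseteq> J ?D2 ?W" using GJ eG by auto
        have "rk ?W = rk (G \<union> B)" by (rule rk_cl)
        also have "\<dots> \<le> rk (J ?D2 ?W \<union> B)" by (rule rk_mono) (use GJ in auto)
        finally have 1: "rk ?W \<le> rk (J ?D2 ?W \<union> B)" .
        have "rk (J ?D2 ?W \<union> B) + rk (insert e ?J) \<le> rk (J ?D2 ?W) + rk B"
          by (rule rk_submod_le) (use JJ J_sub e in auto)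
        then have "dl ?D2 ?W \<le> d" using 1 dle unfolding dl_def rJ by linarith
        then have "mo (add_mset G m) * sig \<G> ?W ^ d \<in> pres_ideal" by (rule Suc.IH[OF m' W])
        then show ?thesis unfolding pres_ideal_def
          by (intro mo_sig_replace[OF finG order_refl G(1) Suc.prems(2) GB G(3) Suc.prems(1), where N = "{}"])
            (auto simp flip: pres_ideal_def intro: pres_ideal_a)
      qed
      then show ?thesis using mo_add[of m "{#G#}"] by (simp add: ac_simps)
    qed
    have "mo m * sig \<G> B ^ d * (sig \<G> ?a - sig \<G> B) \<in> pres_ideal"
      unfolding sig_diff[OF finG aB] sum_distrib_left pres_ideal_def
      by (rule idl_sum) (use sm in \<open>auto simp: pres_ideal_def\<close>)
    moreover have "mo m * sig \<G> B ^ d * sig \<G> ?a \<in> pres_ideal"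
      by (intro pres_ideal_mult pres_ideal_sig pol_mult pol_mo pol_power sig_pol Suc.prems) (use atom_iff eE in auto)
    ultimately have "mo m * sig \<G> B ^ d * sig \<G> ?a - mo m * sig \<G> B ^ d * (sig \<G> ?a - sig \<G> B) \<in> pres_ideal"
      unfolding pres_ideal_def by (intro idl_diff[OF pol_subring])
    then show ?thesis by (simp add: algebra_simps)
  qed
qed

lemma rel_ideal_pres_ideal: "rel_ideal \<G> {} = pres_ideal"
proof
  show "rel_ideal \<G> {} \<subseteq> pres_ideal"
    unfolding rel_ideal_def pres_ideal_def
  proof (rule idl_mono[OF pol_subring order_refl], unfold pres_ideal_def[symmetric])
    show "gens \<G> {} \<subseteq> pres_ideal" unfolding gens_def by (auto intro: pres_ideal_a mo_sig_pres_ideal)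
  qed
  show "pres_ideal \<subseteq> rel_ideal \<G> {}"
    unfolding rel_ideal_def pres_ideal_def
  proof (rule idl_mono[OF pol_subring order_refl], unfold rel_ideal_def[symmetric], intro Un_least subsetI)
    fix p assume "p \<in> {mo m | m. set_mset m \<subseteq> \<G> \<and> \<not> nst (set_mset m)}"
    then show "p \<in> rel_ideal \<G> {}" using rel_ideal_a[of _ \<G> "{}"] by auto
  next
    fix p assume "p \<in> {sig \<G> a | a. a \<in> atoms E indep}"
    then obtain a where a: "p = sig \<G> a" "a \<in> atoms E indep" by auto
    then have aG: "a \<in> \<G>" using atom_iff atom_G by auto
    have "dl {} a \<le> 1" using a(2) by (simp add: dl_def J_def atoms_def)
    then show "p \<in> rel_ideal \<G> {}" using rel_ideal_b[of "{#}" \<G> a "{}" 1] aG a(1) by (simp add: mo_0)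
  qed
qed

section \<open>The Chow ideal as a linear span of monomial multiples\<close>

abbreviation CH where "CH \<equiv> chow_ideal E indep \<G>"

text \<open>The generators allow a non-nested set times any monomial; here the set is the support of
  m, and the rest of m is the multiplier.\<close>

lemma CH_gen_mo: "set_mset m \<subseteq> \<G> \<Longrightarrow> \<not> nst (set_mset m) \<Longrightarrow> lookup (mo m) \<in> chow_ideal_gens E indep \<G>"
proof -
  assume m: "set_mset m \<subseteq> \<G>" "\<not> nst (set_mset m)"
  have "mset_set (set_mset m) \<subseteq># m" by (simp add: subseteq_mset_def count_mset_set' Suc_le_eq)
  then have "lookup (mo m) = mono_fn ((m - mset_set (set_mset m)) + mset_set (set_mset m))" by (simp add: lookup_mo_fn)
  moreover have "set_mset (m - mset_set (set_mset m)) \<subseteq> \<G>" using m in_diffD by fastforce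
  ultimately show ?thesis unfolding chow_ideal_gens_def using m by blast
qed

lemma mo_sig_lookup: "lookup (mo m * sig \<G> a) = (\<lambda>\<mu>. \<Sum>G\<in>{G\<in>\<G>. a \<subseteq> G}. mono_fn (m + {#G#}) \<mu>)"
proof -
  have "mo m * sig \<G> a = (\<Sum>G\<in>{G\<in>\<G>. a \<subseteq> G}. mo (m + {#G#}))"
    unfolding sig_def sum_distrib_left mo_add ..
  then show ?thesis by (simp add: fun_eq_iff lookup_sum lookup_mo_fn)
qed

lemma CH_sub_1: "p \<in> pres_ideal \<Longrightarrow> lookup p \<in> CH"
proof -
  have gen: "lookup (mo m * g) \<in> CH" if g: "g \<in> {mo m | m. set_mset m \<subseteq> \<G> \<and> \<not> nst (set_mset m)} \<union> {sig \<G> a | a. a \<in> atoms E indep}"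
    and m: "set_mset m \<subseteq> \<G>" for g m
  proof -
    have "lookup (mo m * g) \<in> chow_ideal_gens E indep \<G>"
    proof (cases "\<exists>a. a \<in> atoms E indep \<and> g = sig \<G> a")
      case True
      then show ?thesis using m unfolding chow_ideal_gens_def by (auto simp: mo_sig_lookup)
    next
      case False
      then obtain n where n: "g = mo n" "set_mset n \<subseteq> \<G>" "\<not> nst (set_mset n)" using g by auto
      have "\<not> nst (set_mset (m + n))" using nst_sub[of "set_mset (m + n)" "set_mset n"] n by auto
      then show ?thesis unfolding n(1) mo_add[symmetric] using m n by (intro CH_gen_mo) auto
    qed
    then show ?thesis unfolding chow_ideal_def by (rule vs.span_base)
  qed
  have "pres_ideal \<subseteq> {p. lookup p \<in> CH}"
    unfolding pres_ideal_def
  proof (rule idl_least)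
    fix p q :: "'a set mp" assume "p \<in> {p. lookup p \<in> CH}" "q \<in> {p. lookup p \<in> CH}"
    then show "p + q \<in> {p. lookup p \<in> CH}" unfolding chow_ideal_def by (simp add: lookup_add_fun vs.span_add)
  next
    fix c g :: "'a set mp" assume c: "c \<in> pol \<G>"
      and g: "g \<in> {mo m | m. set_mset m \<subseteq> \<G> \<and> \<not> nst (set_mset m)} \<union> {sig \<G> a | a. a \<in> atoms E indep}"
    have lsum: "lookup (\<Sum>i\<in>S. f i) \<in> CH" if "\<And>i. i \<in> S \<Longrightarrow> lookup (f i) \<in> CH" for f :: "'a set multiset \<Rightarrow> 'a set mp" and S
      using that unfolding chow_ideal_def
      by (induction S rule: infinite_finite_induct) (auto simp: lookup_add_fun lookup_zero_fun vs.span_zero vs.span_add)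
    have "c * g = (\<Sum>m\<in>keys c. Poly_Mapping.single m (lookup c m) * g)"
      by (subst mp_sum[of c]) (simp add: sum_distrib_right)
    also have "\<dots> = (\<Sum>m\<in>keys c. Poly_Mapping.single {#} (lookup c m) * (mo m * g))"
      by (rule sum.cong[OF refl], subst single_mo) (simp add: mult.assoc)
    finally have "c * g = (\<Sum>m\<in>keys c. Poly_Mapping.single {#} (lookup c m) * (mo m * g))" .
    moreover have "lookup (\<Sum>m\<in>keys c. Poly_Mapping.single {#} (lookup c m) * (mo m * g)) \<in> CH"
    proof (rule lsum)
      fix m assume "m \<in> keys c"
      then have "lookup (mo m * g) \<in> CH" using c by (intro gen[OF g]) (auto simp: pol_def)
      then show "lookup (Poly_Mapping.single {#} (lookup c m) * (mo m * g)) \<in> CH"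
        unfolding lookup_const_fun chow_ideal_def by (rule vs.span_scale)
    qed
    ultimately show "c * g \<in> {p. lookup p \<in> CH}" by simp
  qed (simp add: lookup_zero_fun chow_ideal_def vs.span_zero)
  then show "p \<in> pres_ideal \<Longrightarrow> lookup p \<in> CH" by auto
qed

lemma CH_sub_2: "CH \<subseteq> lookup ` pres_ideal"
  unfolding chow_ideal_def
proof (rule vs.span_minimal)
  show "vs.subspace (lookup ` pres_ideal)"
    unfolding vs.subspace_def
  proof (intro conjI ballI allI)
    have "0 \<in> pres_ideal" unfolding pres_ideal_def by (rule idl_0)
    then show "0 \<in> lookup ` pres_ideal" unfolding lookup_zero_fun[symmetric] by (rule imageI)
    fix f g assume "f \<in> lookup ` pres_ideal" "g \<in> lookup ` pres_ideal"
    then obtain p q where p: "f = lookup p" "g = lookup q" "p \<in> pres_ideal" "q \<in> pres_ideal" by auto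
    have "p + q \<in> pres_ideal" using p(3,4) unfolding pres_ideal_def by (rule idl_add)
    then show "f + g \<in> lookup ` pres_ideal" unfolding p(1,2) lookup_add_fun[symmetric] by (rule imageI)
  next
    fix c f assume "f \<in> lookup ` pres_ideal"
    then obtain p where p: "f = lookup p" "p \<in> pres_ideal" by auto
    have "Poly_Mapping.single {#} c * p \<in> pres_ideal" by (rule pres_ideal_mult[OF pol_const p(2)])
    then show "qscale c f \<in> lookup ` pres_ideal" unfolding p(1) lookup_const_fun[symmetric] by (rule imageI)
  qed
  show "chow_ideal_gens E indep \<G> \<subseteq> lookup ` pres_ideal"
  proof
    fix g assume "g \<in> chow_ideal_gens E indep \<G>"
    then consider m T where "g = mono_fn (m + mset_set T)" "set_mset m \<subseteq> \<G>" "T \<subseteq> \<G>" "\<not> nst T"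
      | m a where "g = lookup (mo m * sig \<G> a)" "set_mset m \<subseteq> \<G>" "a \<in> atoms E indep"
      unfolding chow_ideal_gens_def mo_sig_lookup by auto
    then show "g \<in> lookup ` pres_ideal"
    proof cases
      case 1
      have fT: "finite T" using finite_subset[OF 1(3) finG] .
      then have s: "set_mset (m + mset_set T) = set_mset m \<union> T" by simp
      have "\<not> nst (set_mset m \<union> T)" using nst_sub[of "set_mset m \<union> T" T] 1 by auto
      then have "mo (m + mset_set T) \<in> pres_ideal" using 1(2,3) by (intro pres_ideal_a) (use fT in auto)
      then show ?thesis unfolding 1(1) lookup_mo_fn[symmetric] by (rule imageI)
    next
      case 2
      show ?thesis unfolding 2(1) by (intro imageI pres_ideal_mult pres_ideal_sig pol_mo 2)
    qed
  qed
qed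

section \<open>Homogeneous parts and dimension count\<close>

definition homp :: "nat \<Rightarrow> ('a set multiset \<Rightarrow> rat) \<Rightarrow> ('a set multiset \<Rightarrow> rat)" where
  "homp i f = (\<lambda>\<mu>. if size \<mu> = i then f \<mu> else 0)"

lemma homp_add: "homp i (f + g) = homp i f + homp i g" by (auto simp: homp_def fun_eq_iff)
lemma homp_zero: "homp i 0 = 0" by (auto simp: homp_def fun_eq_iff)
lemma homp_scale: "homp i (qscale c f) = qscale c (homp i f)" by (auto simp: homp_def qscale_def fun_eq_iff)

text \<open>Every generator is homogeneous, so its part of degree i is the generator itself or
  0.\<close>

lemma homp_CH: assumes "f \<in> CH" shows "homp i f \<in> CH"
proof -
  have "vs.span (chow_ideal_gens E indep \<G>) \<subseteq> {f. homp i f \<in> CH}"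
  proof (rule vs.span_minimal)
    show "vs.subspace {f. homp i f \<in> CH}"
      unfolding vs.subspace_def chow_ideal_def
      by (auto simp: homp_add homp_scale homp_zero intro: vs.span_add vs.span_scale vs.span_zero)
    show "chow_ideal_gens E indep \<G> \<subseteq> {f. homp i f \<in> CH}"
    proof
      fix g assume g: "g \<in> chow_ideal_gens E indep \<G>"
      then have gC: "g \<in> CH" unfolding chow_ideal_def by (rule vs.span_base)
      have "\<exists>n. \<forall>\<mu>. g \<mu> \<noteq> 0 \<longrightarrow> size \<mu> = n"
      proof -
        consider m T where "g = mono_fn (m + mset_set T)"
          | m a where "g = (\<lambda>\<mu>. \<Sum>G\<in>{G\<in>\<G>. a \<subseteq> G}. mono_fn (m + {#G#}) \<mu>)"
          using g unfolding chow_ideal_gens_def by auto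
        then show ?thesis
        proof cases
          case 1 then show ?thesis by (auto simp: mono_fn_def)
        next
          case 2
          have "size \<mu> = Suc (size m)" if "g \<mu> \<noteq> 0" for \<mu>
          proof (rule ccontr)
            assume "size \<mu> \<noteq> Suc (size m)"
            then have "mono_fn (m + {#G#}) \<mu> = 0" for G by (auto simp: mono_fn_def)
            then show False using that unfolding 2 by simp
          qed
          then show ?thesis by auto
        qed
      qed
      then obtain n where n: "\<And>\<mu>. g \<mu> \<noteq> 0 \<Longrightarrow> size \<mu> = n" by auto
      have "homp i g = g \<or> homp i g = 0" using n by (cases "i = n") (auto simp: homp_def fun_eq_iff)
      then show "g \<in> {f. homp i f \<in> CH}" using gC vs.span_zero unfolding chow_ideal_def by auto
    qed
  qed
  then show ?thesis using assms unfolding chow_ideal_def[symmetric] by auto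
qed

abbreviation "FYm \<equiv> FY \<G> {}"
abbreviation "HP \<equiv> hom_polys \<G>"

lemma span_mono_fn: assumes "g \<in> vs.span (mono_fn ` C)" "g \<mu> \<noteq> 0" shows "\<mu> \<in> C"
proof -
  have "vs.span (mono_fn ` C) \<subseteq> {g. \<forall>\<mu>. \<mu> \<notin> C \<longrightarrow> g \<mu> = 0}"
    by (rule vs.span_minimal) (auto simp: vs.subspace_def qscale_def mono_fn_def)
  then show ?thesis using assms by auto
qed

lemma in_span_mono_fn:
  assumes "finite {\<mu>. f \<mu> \<noteq> 0}" "\<And>\<mu>. f \<mu> \<noteq> 0 \<Longrightarrow> \<mu> \<in> C" shows "f \<in> vs.span (mono_fn ` C)"
proof -
  have "f = (\<Sum>\<mu>\<in>{\<mu>. f \<mu> \<noteq> 0}. qscale (f \<mu>) (mono_fn \<mu>))"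
  proof
    fix \<nu>
    have "(\<Sum>\<mu>\<in>{\<mu>. f \<mu> \<noteq> 0}. qscale (f \<mu>) (mono_fn \<mu>)) \<nu> = (\<Sum>\<mu>\<in>{\<mu>. f \<mu> \<noteq> 0}. if \<mu> = \<nu> then f \<mu> else 0)"
      using assms(1) by (induction rule: finite_induct) (auto simp: qscale_def mono_fn_def)
    then show "f \<nu> = (\<Sum>\<mu>\<in>{\<mu>. f \<mu> \<noteq> 0}. qscale (f \<mu>) (mono_fn \<mu>)) \<nu>" using assms(1) by simp
  qed
  also have "\<dots> \<in> vs.span (mono_fn ` C)"
    by (intro vs.span_sum vs.span_scale vs.span_base) (use assms in auto)
  finally show ?thesis .
qed

lemma FY_CH: assumes f: "\<And>\<mu>. f \<mu> \<noteq> 0 \<Longrightarrow> \<mu> \<in> FYm" "f \<in> CH" shows "f = 0"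
proof -
  obtain p where p: "f = lookup p" "p \<in> pres_ideal" using f CH_sub_2 by auto
  have "keys p \<subseteq> FYm" using f p by (auto simp: in_keys_iff)
  moreover have "direct \<G> {}" by (rule direct_upset) auto
  ultimately have "p = 0" using p unfolding direct_def rel_ideal_pres_ideal FY_span_def by auto
  then show ?thesis using p by (simp add: lookup_zero_fun)
qed

text \<open>A basis of the degree i part of the ideal, joined with the basis monomials of degree i,
  is a basis of all homogeneous polynomials of degree i. The monomials thus account for the
  difference of the two finite dimensions.\<close>

theorem chow_dim_FY: "chow_dim E indep \<G> i = card {m\<in>FYm. size m = i}"
proof -
  let ?C = "{m\<in>FYm. size m = i}"
  have fin: "finite {m. set_mset m \<subseteq> \<G> \<and> size m = i}" by (rule finite_multisets_size[OF finG])
  have Csub: "?C \<subseteq> {m. set_mset m \<subseteq> \<G> \<and> size m = i}" by (auto simp: FY_def)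
  have finC: "finite ?C" by (rule finite_subset[OF Csub fin])
  obtain B where B: "B \<subseteq> CH \<inter> HP i" "vs.independent B" "CH \<inter> HP i \<subseteq> vs.span B" "card B = vs.dim (CH \<inter> HP i)"
    by (rule vs.basis_exists)
  have HPspan: "f \<in> vs.span (mono_fn ` {m. set_mset m \<subseteq> \<G> \<and> size m = i})" if "f \<in> HP i" for f
  proof (rule in_span_mono_fn)
    have "{\<mu>. f \<mu> \<noteq> 0} \<subseteq> {m. set_mset m \<subseteq> \<G> \<and> size m = i}" using that by (auto simp: hom_polys_def)
    then show "finite {\<mu>. f \<mu> \<noteq> 0}" by (rule finite_subset[OF _ fin])
  qed (use that in \<open>auto simp: hom_polys_def\<close>)
  have finB: "finite B"
    using vs.independent_span_bound[of "mono_fn ` {m. set_mset m \<subseteq> \<G> \<and> size m = i}" B] fin B HPspan by blast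
  have CHs: "vs.subspace CH" unfolding chow_ideal_def by (rule vs.subspace_span)
  have spB: "vs.span B \<subseteq> CH" by (rule vs.span_minimal) (use B CHs in auto)
  \<comment> \<open>Monomials are added one at a time; a dependence would put a combination of basis
    monomials into the ideal, and by \<open>FY_CH\<close> that combination is 0.\<close>
  have ind: "vs.independent (B \<union> mono_fn ` C') \<and> card (B \<union> mono_fn ` C') = card B + card C'" if "C' \<subseteq> ?C" for C'
    using finite_subset[OF that finC] that
  proof (induction C' rule: finite_induct)
    case empty then show ?case using B by simp
  next
    case (insert m C')
    have nin: "mono_fn m \<notin> vs.span (B \<union> mono_fn ` C')"
    proof
      assume "mono_fn m \<in> vs.span (B \<union> mono_fn ` C')"
      then obtain b c where bc: "mono_fn m = b + c" "b \<in> vs.span B" "c \<in> vs.span (mono_fn ` C')" unfolding vs.span_Un by auto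
      have c: "\<And>\<mu>. c \<mu> \<noteq> 0 \<Longrightarrow> \<mu> \<in> C'" by (rule span_mono_fn[OF bc(3)])
      have b: "b = mono_fn m - c" using bc(1) by simp
      have "b = 0"
      proof (rule FY_CH)
        fix \<mu> assume "b \<mu> \<noteq> 0"
        then have "\<mu> = m \<or> c \<mu> \<noteq> 0" unfolding b by (auto simp: mono_fn_def)
        then show "\<mu> \<in> FYm" using c insert.prems by auto
      qed (use bc spB in auto)
      then have "c m \<noteq> 0" using bc(1) by (auto simp: mono_fn_def fun_eq_iff split: if_splits)
      then show False using c insert.hyps by auto
    qed
    then have "vs.independent (insert (mono_fn m) (B \<union> mono_fn ` C'))" using insert by (intro vs.independent_insertI) auto
    moreover have "mono_fn m \<notin> B \<union> mono_fn ` C'" using nin vs.span_base[of "mono_fn m" "B \<union> mono_fn ` C'"] by blast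
    moreover have "B \<union> mono_fn ` insert m C' = insert (mono_fn m) (B \<union> mono_fn ` C')" by simp
    moreover have "vs.independent (B \<union> mono_fn ` C')" "card (B \<union> mono_fn ` C') = card B + card C'"
      using insert.IH insert.prems by auto
    moreover have "finite (B \<union> mono_fn ` C')" "card (insert m C') = Suc (card C')" using finB insert.hyps by simp_all
    ultimately show ?case by simp
  qed
  have sub: "B \<union> mono_fn ` ?C \<subseteq> HP i"
    using B by (auto simp: hom_polys_def mono_fn_def FY_def split: if_splits)
  have "HP i \<subseteq> vs.span (B \<union> mono_fn ` ?C)"
  proof
    fix f assume f: "f \<in> HP i"
    have "finite {\<mu>. f \<mu> \<noteq> 0}" using f by (intro finite_subset[OF _ fin]) (auto simp: hom_polys_def)
    then have lf: "lookup (Abs_poly_mapping f) = f" by simp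
    have "Abs_poly_mapping f \<in> pol \<G>" using f by (auto simp: pol_def in_keys_iff lf hom_polys_def)
    moreover have "direct \<G> {}" by (rule direct_upset) auto
    ultimately obtain v where v: "v \<in> FY_span \<G> {}" "Abs_poly_mapping f - v \<in> pres_ideal" unfolding direct_def rel_ideal_pres_ideal by auto
    define w where "w = Abs_poly_mapping f - v"
    have fw: "f = lookup v + lookup w" using lf unfolding w_def by (metis add.commute diff_add_cancel lookup_add_fun)
    have "homp i f = f" using f by (auto simp: homp_def hom_polys_def fun_eq_iff)
    then have fe: "f = homp i (lookup v) + homp i (lookup w)" unfolding fw homp_add[symmetric] by simp
    have "homp i (lookup v) \<in> vs.span (mono_fn ` ?C)"
    proof (rule in_span_mono_fn)
      have "{\<mu>. homp i (lookup v) \<mu> \<noteq> 0} \<subseteq> keys v" by (auto simp: homp_def in_keys_iff split: if_splits)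
      then show "finite {\<mu>. homp i (lookup v) \<mu> \<noteq> 0}" by (rule finite_subset) simp
      show "\<mu> \<in> ?C" if "homp i (lookup v) \<mu> \<noteq> 0" for \<mu>
        using that v(1) by (auto simp: homp_def in_keys_iff FY_span_def split: if_splits)
    qed
    moreover have "homp i (lookup w) \<in> CH \<inter> HP i"
    proof -
      have wC: "w \<in> pres_ideal" using v by (simp add: w_def)
      then have "w \<in> pol \<G>" using rel_ideal_pol[of \<G> "{}"] rel_ideal_pres_ideal by auto
      then have "homp i (lookup w) \<in> HP i" by (auto simp: homp_def hom_polys_def pol_def in_keys_iff split: if_splits)
      then show ?thesis using homp_CH CH_sub_1[OF wC] by auto
    qed
    then have "homp i (lookup w) \<in> vs.span B" using B by auto
    ultimately have "homp i (lookup w) + homp i (lookup v) \<in> vs.span (B \<union> mono_fn ` ?C)" unfolding vs.span_Un by blast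
    then show "f \<in> vs.span (B \<union> mono_fn ` ?C)" using fe by (simp add: add.commute)
  qed
  then have "vs.dim (HP i) = card B + card ?C"
    using vs.dim_unique[OF sub] ind[OF order_refl] by auto
  then show ?thesis unfolding chow_dim_def B(4)[symmetric] by simp
qed

lemma finite_FY: "finite FYm"
proof -
  have "FYm \<subseteq> (\<Union>n\<le>card \<G> * rk E. {m. set_mset m \<subseteq> \<G> \<and> size m = n})"
  proof
    fix m assume m: "m \<in> FYm"
    then have mG: "set_mset m \<subseteq> \<G>" by (auto simp: FY_def)
    have "size m = (\<Sum>G\<in>set_mset m. count m G)" by (rule size_multiset_overloaded_eq)
    also have "\<dots> \<le> (\<Sum>G\<in>set_mset m. rk E)"
    proof (rule sum_mono)
      fix G assume G: "G \<in># m"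
      then have "count m G < dl (set_mset m) G" using m by (auto simp: FY_def)
      also have "\<dots> \<le> rk E" unfolding dl_def using rk_mono[OF G_E, of G] G mG by auto
      finally show "count m G \<le> rk E" by simp
    qed
    also have "\<dots> \<le> card \<G> * rk E" using card_mono[OF finG mG] by simp
    finally show "m \<in> (\<Union>n\<le>card \<G> * rk E. {m. set_mset m \<subseteq> \<G> \<and> size m = n})" using mG by auto
  qed
  then show ?thesis by (rule finite_subset) (simp add: finite_multisets_size[OF finG])
qed

lemma chow_poly_FY: "chow_poly E indep \<G> = (\<Sum>m\<in>FYm. monom 1 (size m))"
proof -
  have c: "coeff (\<Sum>m\<in>FYm. monom (1::rat) (size m)) i = of_nat (chow_dim E indep \<G> i)" for i
  proof -
    have "coeff (\<Sum>m\<in>FYm. monom (1::rat) (size m)) i = (\<Sum>m\<in>FYm. if size m = i then 1 else 0)"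
      by (simp add: coeff_sum)
    also have "\<dots> = (\<Sum>m\<in>{m\<in>FYm. size m = i}. 1)" by (rule sum.inter_filter[symmetric, OF finite_FY])
    finally show ?thesis unfolding chow_dim_FY by simp
  qed
  show ?thesis
    unfolding chow_poly_def
  proof (rule the_equality)
    show "\<forall>i. coeff (\<Sum>m\<in>FYm. monom (1::rat) (size m)) i = of_nat (chow_dim E indep \<G> i)" using c by blast
    fix p :: "rat poly" assume "\<forall>i. coeff p i = of_nat (chow_dim E indep \<G> i)"
    then show "p = (\<Sum>m\<in>FYm. monom 1 (size m))" using c by (intro poly_eqI) simp
  qed
qed

section \<open>Maximal nested sets and their labels\<close>

text \<open>The children of G when G lies in S, as \<open>par_props\<close> and
  \<open>par_ch\<close> show; as maximal elements they are also the factors of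
  \<open>J S G\<close>.\<close>

definition ch :: "'a set set \<Rightarrow> 'a set \<Rightarrow> 'a set set" where "ch S G = mx {H\<in>S. H \<subset> G}"

lemma chD: "C \<in> ch S G \<Longrightarrow> C \<in> S" "C \<in> ch S G \<Longrightarrow> C \<subset> G" using mx_sub unfolding ch_def by blast+
lemma ch_max: "C \<in> ch S G \<Longrightarrow> H \<in> S \<Longrightarrow> H \<subset> G \<Longrightarrow> C \<subseteq> H \<Longrightarrow> H = C" by (auto simp: ch_def mx_def)
lemma ch_sub: "ch S G \<subseteq> S" using chD(1) by blast
lemma ch_ac: "antichain_sets (ch S G)" unfolding ch_def by (rule mx_antichain)
lemma ch_fin: "nst S \<Longrightarrow> finite (ch S G)" by (rule finite_subset[OF ch_sub nst_fin])
lemma ch_J: "nst S \<Longrightarrow> \<Union>(ch S G) = J S G"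
  unfolding ch_def J_def by (rule mx_Un) (simp add: nst_fin)
lemma factors_J: "nst S \<Longrightarrow> factors (J S G) = ch S G"
  unfolding ch_def J_def by (rule nst_union(2)) auto
lemma ch_above: assumes "nst S" "H \<in> S" "H \<subset> G" obtains C where "C \<in> ch S G" "H \<subseteq> C"
  using mx_above[of "{H\<in>S. H \<subset> G}" H] assms nst_fin[OF assms(1)] unfolding ch_def by auto
lemma ch_disj: "nst S \<Longrightarrow> C \<in> ch S G \<Longrightarrow> C' \<in> ch S G \<Longrightarrow> C \<noteq> C' \<Longrightarrow> C \<inter> C' = {}"
  using nst_cmp[of S C C'] chD ch_max[of C S G C'] ch_max[of C' S G C] by blast

lemma rk_J_ch: assumes "nst S" shows "rk (J S G) = (\<Sum>C\<in>ch S G. rk C)"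
proof -
  have "\<And>C. C \<in> ch S G \<Longrightarrow> id C \<in> Fl \<and> id C \<subseteq> C" using ch_sub nstG[OF assms] G_Fl by fastforce
  from nst_antichain_union(2)[OF assms ch_sub ch_ac this] show ?thesis by (simp add: ch_J[OF assms])
qed

text \<open>The ranks of the children add up to the rank of the join below G, so the local ranks
  telescope down the forest.\<close>

lemma rank_sum: assumes n: "nst D" shows "G \<in> D \<Longrightarrow> rk G = (\<Sum>H\<in>{H\<in>D. H \<subseteq> G}. dl D H)"
proof (induction "card G" arbitrary: G rule: less_induct)
  case less
  have GG: "G \<in> \<G>" using less.prems nstG[OF n] by auto
  have fG: "finite G" using Fl_fin[OF G_Fl[OF GG]] .
  have fD: "finite D" by (rule nst_fin[OF n])
  have part: "{H\<in>D. H \<subseteq> G} = insert G (\<Union>C\<in>ch D G. {H\<in>D. H \<subseteq> C})"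
  proof
    show "{H\<in>D. H \<subseteq> G} \<subseteq> insert G (\<Union>C\<in>ch D G. {H\<in>D. H \<subseteq> C})"
    proof
      fix H assume H: "H \<in> {H\<in>D. H \<subseteq> G}"
      show "H \<in> insert G (\<Union>C\<in>ch D G. {H\<in>D. H \<subseteq> C})"
      proof (cases "H = G")
        case False
        then obtain C where "C \<in> ch D G" "H \<subseteq> C" using ch_above[OF n, of H G] H by auto
        then show ?thesis using H by auto
      qed simp
    qed
    show "insert G (\<Union>C\<in>ch D G. {H\<in>D. H \<subseteq> C}) \<subseteq> {H\<in>D. H \<subseteq> G}"
      using less.prems chD(2)[of _ D G] by fastforce
  qed
  have nin: "G \<notin> (\<Union>C\<in>ch D G. {H\<in>D. H \<subseteq> C})" using chD(2)[of _ D G] by auto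
  have "(\<Sum>H\<in>{H\<in>D. H \<subseteq> G}. dl D H) = dl D G + (\<Sum>H\<in>(\<Union>C\<in>ch D G. {H\<in>D. H \<subseteq> C}). dl D H)"
    unfolding part by (rule sum.insert[OF _ nin]) (use ch_fin[OF n] fD in auto)
  also have "(\<Sum>H\<in>(\<Union>C\<in>ch D G. {H\<in>D. H \<subseteq> C}). dl D H) = (\<Sum>C\<in>ch D G. \<Sum>H\<in>{H\<in>D. H \<subseteq> C}. dl D H)"
  proof (rule sum.UNION_disjoint)
    show "\<forall>C\<in>ch D G. \<forall>C'\<in>ch D G. C \<noteq> C' \<longrightarrow> {H\<in>D. H \<subseteq> C} \<inter> {H\<in>D. H \<subseteq> C'} = {}"
    proof (intro ballI impI)
      fix C C' assume "C \<in> ch D G" "C' \<in> ch D G" "C \<noteq> C'"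
      then have "C \<inter> C' = {}" by (rule ch_disj[OF n])
      then have "H = {}" if "H \<subseteq> C" "H \<subseteq> C'" for H using that by auto
      moreover have "{} \<notin> D" using G_ne nstG[OF n] by auto
      ultimately show "{H\<in>D. H \<subseteq> C} \<inter> {H\<in>D. H \<subseteq> C'} = {}" by blast
    qed
  qed (use ch_fin[OF n] fD in auto)
  also have "\<dots> = (\<Sum>C\<in>ch D G. rk C)"
  proof (rule sum.cong[OF refl])
    fix C assume C: "C \<in> ch D G"
    have "card C < card G" by (rule psubset_card_mono[OF fG chD(2)[OF C]])
    then show "(\<Sum>H\<in>{H\<in>D. H \<subseteq> C}. dl D H) = rk C" using less.hyps[of C] chD(1)[OF C] by simp
  qed
  also have "dl D G + (\<Sum>C\<in>ch D G. rk C) = rk G" using rk_J_ch[OF n, of G] rk_J[OF n GG] by (simp add: dl_def)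
  finally show ?case by simp
qed

text \<open>Numerical form of maximality, shown equivalent in
  \<open>max_nested_full\<close>.\<close>

definition full :: "'a set set \<Rightarrow> bool" where "full S \<longleftrightarrow> nst S \<and> E \<in> S \<and> (\<forall>G\<in>S. dl S G = 1)"

lemma fullD: "full S \<Longrightarrow> nst S" "full S \<Longrightarrow> E \<in> S" "full S \<Longrightarrow> G \<in> S \<Longrightarrow> dl S G = 1" by (auto simp: full_def)

lemma rank_total: assumes "nst D" "E \<in> D" shows "rk E = (\<Sum>H\<in>D. dl D H)"
proof -
  have "{H\<in>D. H \<subseteq> E} = D" using nstG[OF assms(1)] G_E by auto
  then show ?thesis using rank_sum[OF assms] by simp
qed

text \<open>All local ranks are at least 1 and they add up to \<open>rk E\<close>. Besides proving
  full sets maximal, this bound makes the filling-in process terminate.\<close>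

lemma card_le_rk: assumes "nst D" "E \<in> D" shows "card D \<le> rk E"
proof -
  have "(\<Sum>H\<in>D. 1) \<le> (\<Sum>H\<in>D. dl D H)"
    by (rule sum_mono) (use dl_pos[OF assms(1)] nstG[OF assms(1)] in \<open>auto simp: Suc_le_eq\<close>)
  then show ?thesis using rank_total[OF assms] by simp
qed

lemma full_card: "full S \<Longrightarrow> card S = rk E" using rank_total[of S] fullD[of S] by simp

lemma full_maximal: assumes "full S" "nst S'" "S \<subseteq> S'" shows "S' = S"
  using card_seteq[OF nst_fin[OF assms(2)] assms(3)] card_le_rk[OF assms(2)] full_card[OF assms(1)] fullD(2)[OF assms(1)] assms(3)
  by auto

text \<open>At a member G of local rank at least 2, adding one point e to the join below G spans a
  flat strictly below G. Its factor through e can be added by \<open>nst_insert\<close>, but is not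
  in S because e is outside the join.\<close>

lemma max_nested_full: assumes "E \<in> \<G>" shows "max_nested E indep \<G> S \<longleftrightarrow> full S"
proof
  assume "full S" then show "max_nested E indep \<G> S"
    unfolding max_nested_def using full_maximal fullD(1) by auto
next
  assume m: "max_nested E indep \<G> S"
  have n: "nst S" using m by (simp add: max_nested_def)
  have mx: "K \<in> S" if "nst (insert K S)" for K using m that unfolding max_nested_def by blast
  have "dl S G = 1" if G: "G \<in> S" for G
  proof (rule ccontr)
    assume "dl S G \<noteq> 1"
    have GG: "G \<in> \<G>" using G nstG[OF n] by auto
    have d2: "rk (J S G) + 2 \<le> rk G" using dl_pos[OF n GG] \<open>dl S G \<noteq> 1\<close> by (simp add: dl_def)
    have GF: "G \<in> Fl" "G \<subseteq> E" using G_Fl[OF GG] G_E[OF GG] by auto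
    obtain e where e: "e \<in> G" "e \<notin> J S G" using J_ne[OF n GG] J_sub by blast
    let ?X = "cl (insert e (J S G))"
    have iE: "insert e (J S G) \<subseteq> E" using e J_sub[of S G] GF by auto
    have X: "?X \<in> Fl" "J S G \<subseteq> ?X" "e \<in> ?X" using cl_Fl[OF iE] cl_ext[OF iE] by auto
    have "?X \<subseteq> G" by (rule cl_least) (use e J_sub[of S G] GF in auto)
    moreover have "rk ?X < rk G"
      using rk_cl[of "insert e (J S G)"] rk_insert[of e "J S G"] iE d2 by simp
    then have "?X \<noteq> G" by auto
    ultimately have XG: "?X \<subset> G" by auto
    obtain K where K: "K \<in> factors ?X" "e \<in> K" using factors_Un[OF X(1)] X(3) by auto
    have "K \<in> S" by (rule mx[OF nst_insert[OF n G X(1,2) XG K(1)]])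
    then have "K \<subseteq> J S G" using facsD(2)[OF K(1)] XG by (intro J_upper) auto
    then show False using K e by auto
  qed
  then show "full S" unfolding full_def using n mx[OF nst_insert_E[OF n assms]] by auto
qed

lemma par_props:
  assumes n: "nst S" and E: "E \<in> S" and G: "G \<in> S" "G \<noteq> E"
  shows "par S G \<in> S" "G \<subset> par S G" "\<And>H. H \<in> S \<Longrightarrow> G \<subset> H \<Longrightarrow> par S G \<subseteq> H" "G \<in> ch S (par S G)"
proof -
  let ?A = "{H\<in>S. G \<subset> H}"
  have GE: "G \<subset> E" using G G_E nstG[OF n] by auto
  have "finite ?A" "?A \<noteq> {}" using nst_fin[OF n] GE E by auto
  then obtain P where P: "P \<in> ?A" "\<And>H. H \<in> ?A \<Longrightarrow> H \<subseteq> P \<Longrightarrow> H = P" using finite_has_minimal[of ?A] by metis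
  have Gne: "G \<noteq> {}" using G G_ne nstG[OF n] by auto
  have mn: "P \<subseteq> H" if "H \<in> S" "G \<subset> H" for H
  proof -
    have "P \<subseteq> H \<or> H \<subseteq> P" by (rule nst_cmp[OF n]) (use P(1) that Gne in auto)
    then show ?thesis using P(2)[of H] that by auto
  qed
  have "par S G = P"
    unfolding par_def
  proof (rule the_equality)
    show "P \<in> S \<and> G \<subset> P \<and> (\<forall>H'\<in>S. G \<subset> H' \<longrightarrow> P \<subseteq> H')" using P(1) mn by auto
    fix H assume "H \<in> S \<and> G \<subset> H \<and> (\<forall>H'\<in>S. G \<subset> H' \<longrightarrow> H \<subseteq> H')"
    then show "H = P" using P(1) mn by auto
  qed
  moreover have "G \<in> ch S P" unfolding ch_def mx_def
  proof (intro CollectI conjI ballI impI)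
    fix H assume "H \<in> {H\<in>S. H \<subset> P}" "G \<subseteq> H"
    then show "H = G" using mn[of H] by auto
  qed (use P(1) G in auto)
  ultimately show "par S G \<in> S" "G \<subset> par S G" "\<And>H. H \<in> S \<Longrightarrow> G \<subset> H \<Longrightarrow> par S G \<subseteq> H" "G \<in> ch S (par S G)"
    using P(1) mn by auto
qed

lemma par_ch: assumes n: "nst S" and E: "E \<in> S" and P: "P \<in> S" and C: "C \<in> ch S P" shows "par S C = P" "C \<noteq> E"
proof -
  show CE: "C \<noteq> E" using chD(2)[OF C] P nstG[OF n] G_E by auto
  have p: "par S C \<in> S" "C \<subset> par S C" "par S C \<subseteq> P" using par_props[OF n E chD(1)[OF C] CE] P chD(2)[OF C] by auto
  show "par S C = P"
  proof (rule ccontr)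
    assume "par S C \<noteq> P"
    then have "par S C = C" using ch_max[OF C p(1)] p by auto
    then show False using p by auto
  qed
qed

text \<open>Members of D that cover C below G must lie inside C, as distinct children are disjoint,
  and strictly so since C is not in D; then C would equal the join of the members of S strictly
  below it.\<close>

lemma child_not_below:
  assumes n: "nst S" and D: "D \<subseteq> S" and C: "C \<in> ch S G" "C \<notin> D" shows "\<not> C \<subseteq> J D G"
proof
  assume a: "C \<subseteq> J D G"
  have CG: "C \<in> \<G>" using chD(1)[OF C(1)] nstG[OF n] by auto
  have "C \<subseteq> J S C"
  proof
    fix z assume z: "z \<in> C"
    then obtain H where H: "H \<in> D" "H \<subset> G" "z \<in> H" using a by (auto simp: J_def)
    obtain C1 where C1: "C1 \<in> ch S G" "H \<subseteq> C1" using ch_above[OF n, of H G] H D by auto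
    have "C1 = C" using ch_disj[OF n C1(1) C(1)] z H C1 by auto
    moreover have "H \<noteq> C" using H C by auto
    ultimately have "H \<subset> C" using C1 by auto
    then show "z \<in> J S C" using J_upper[of H S C] H D by auto
  qed
  then show False using J_ne[OF n CG] J_sub[of S C] by auto
qed

text \<open>Let K be the factor of X that contains H. Cutting every other factor down to its part in
  \<open>J D G\<close> leaves a flat that still contains \<open>J D G\<close> and H, hence X. So the
  other factors lie inside \<open>J D G\<close> and are children of G in D; only K is new.\<close>

lemma newfac:
  assumes n: "nst D" and G: "G \<in> D" and H: "H \<in> \<G>" and X: "X = cl (J D G \<union> H)" "X \<subset> G" "X \<noteq> J D G"
  obtains K where "K \<in> factors X" "K \<notin> D" "nst (insert K D)" "factors X \<subseteq> insert K D" "J (insert K D) G = X" "K \<subset> G"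
proof -
  have GE: "G \<subseteq> E" using G nstG[OF n] G_E by auto
  have JH: "J D G \<union> H \<subseteq> E" using J_sub[of D G] GE G_E[OF H] by auto
  have XF: "X \<in> Fl" "J D G \<subseteq> X" "H \<subseteq> X" using cl_Fl[OF JH] cl_ext[OF JH] X(1) by auto
  obtain K where K: "K \<in> factors X" "H \<subseteq> K" using factors_above[OF H XF(3)] by metis
  have other: "M \<in> D" if M: "M \<in> factors X" "M \<noteq> K" for M
  proof -
    let ?y = "\<lambda>M. if M = K then K else M \<inter> J D G"
    have intfl: "A \<inter> B \<in> Fl" if "A \<in> Fl" "B \<in> Fl" for A B
      using that cl_least[of "A \<inter> B" A] cl_least[of "A \<inter> B" B] cl_ext[of "A \<inter> B"] Fl_E[of A] unfolding flats_def by blast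
    have "\<Union>(?y ` factors X) \<in> Fl"
      by (rule union_flat[OF XF(1)]) (use facsD(1) G_Fl intfl J_Fl[OF n] in auto)
    moreover have "J D G \<union> H \<subseteq> \<Union>(?y ` factors X)"
    proof
      fix z assume z: "z \<in> J D G \<union> H"
      show "z \<in> \<Union>(?y ` factors X)"
      proof (cases "z \<in> H")
        case True then show ?thesis using K by auto
      next
        case False
        then have zJ: "z \<in> J D G" using z by auto
        then obtain M where "M \<in> factors X" "z \<in> M" using factors_Un[OF XF(1)] XF(2) by auto
        then show ?thesis using zJ by (intro UN_I[of M]) auto
      qed
    qed
    ultimately have XU: "X \<subseteq> \<Union>(?y ` factors X)" unfolding X(1) by (intro cl_least)
    have MJ: "M \<subseteq> J D G"
    proof
      fix z assume z: "z \<in> M"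
      then have "z \<in> X" using facsD(2)[OF M(1)] by auto
      then obtain M' where M': "M' \<in> factors X" "z \<in> ?y M'" using XU by blast
      then have "z \<in> M'" by (auto split: if_splits)
      then have "M' = M" using factors_disjoint[OF XF(1) M'(1) M(1)] z by auto
      then show "z \<in> J D G" using M'(2) M(2) by auto
    qed
    obtain T where T: "T \<in> factors (J D G)" "M \<subseteq> T" using factors_above[OF facsD(1)[OF M(1)] MJ] by metis
    have TD: "T \<in> D" "T \<in> \<G>" "T \<subseteq> X" using T(1) factors_J[OF n] chD(1)[of T D G] facsD(1,2)[OF T(1)] XF(2) by auto
    have "T = M" by (rule facsD(3)[OF M(1) TD(2,3) T(2)])
    then show ?thesis using TD by simp
  qed
  have KG: "K \<subset> G" using facsD(2)[OF K(1)] X(2) by auto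
  have KD: "K \<notin> D"
  proof
    assume "K \<in> D"
    then have "K \<subseteq> J D G" using KG by (rule J_upper)
    then have "X \<subseteq> J D G" unfolding X(1) using K(2) by (intro cl_least[OF _ J_Fl[OF n]]) auto
    then show False using X(3) XF(2) by auto
  qed
  have fs: "factors X \<subseteq> insert K D" using other by auto
  have "J (insert K D) G = X"
  proof
    have "J (insert K D) G = K \<union> J D G" using KG by (auto simp: J_def)
    then show "J (insert K D) G \<subseteq> X" using XF(2) facsD(2)[OF K(1)] by auto
    show "X \<subseteq> J (insert K D) G"
    proof
      fix z assume "z \<in> X"
      then obtain M where M: "M \<in> factors X" "z \<in> M" using factors_Un[OF XF(1)] by auto
      have "M \<subset> G" using facsD(2)[OF M(1)] X(2) by auto
      then show "z \<in> J (insert K D) G" using J_upper[of M "insert K D" G] fs M by auto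
    qed
  qed
  then show ?thesis using that K(1) KD nst_insert[OF n G XF(1,2) X(2) K(1)] fs KG by blast
qed

end

text \<open>The order is encoded by positions, so that labels are numbers and initial segments have
  the form \<open>pos e < n\<close>. The assumption \<open>complete\<close> is the form in which
  completeness is applied: joining F with an initial segment of G changes nothing or is a join with
  one member of \<G>.\<close>

locale ordered_building = building +
  fixes pos :: "'a \<Rightarrow> nat"
  assumes EG: "E \<in> \<G>" and inj: "inj_on pos E"
    and complete: "\<And>F G n. F \<in> Fl \<Longrightarrow> G \<in> \<G> \<Longrightarrow> F \<subseteq> G \<Longrightarrow>
      cl (F \<union> {e\<in>G. pos e < n}) = F \<or> (\<exists>H\<in>\<G>. cl (F \<union> {e\<in>G. pos e < n}) = cl (F \<union> H))"
begin

definition bel :: "'a set \<Rightarrow> nat \<Rightarrow> 'a set" where "bel G n = {e\<in>G. pos e < n}"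
text \<open>For a full set this is the position of the label (\<open>lam_full\<close>). The
  definition by spanning also makes sense for a nested set with larger local rank at G, which the
  comparison with completions requires.\<close>

definition lab :: "'a set set \<Rightarrow> 'a set \<Rightarrow> nat" where "lab D G = (LEAST n. cl (J D G \<union> bel G (Suc n)) = G)"
text \<open>The last flat before G is reached when its elements are added in order.\<close>

definition pre :: "'a set set \<Rightarrow> 'a set \<Rightarrow> 'a set" where "pre D G = cl (J D G \<union> bel G (lab D G))"

lemma bel_sub: "bel G n \<subseteq> G" and bel_mono: "n \<le> m \<Longrightarrow> bel G n \<subseteq> bel G m" by (auto simp: bel_def)

text \<open>Positions are distinct, so the span grows by at most one rank at each of them; the flat
  just before G therefore has corank 1.\<close>

lemma lab_props:
  assumes n: "nst D" and G: "G \<in> \<G>"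
  shows "pre D G \<in> Fl" "J D G \<subseteq> pre D G" "bel G (lab D G) \<subseteq> pre D G" "pre D G \<subset> G" "Suc (rk (pre D G)) = rk G"
    "\<exists>b\<in>G - pre D G. pos b = lab D G"
proof -
  have GF: "G \<in> Fl" "G \<subseteq> E" using G_Fl[OF G] G_E[OF G] by auto
  have fG: "finite G" using GF(2) finE finite_subset by blast
  have sub: "J D G \<union> bel G m \<subseteq> G" for m using J_sub bel_sub by auto
  then have subE: "J D G \<union> bel G m \<subseteq> E" for m using GF(2) by blast
  have clG: "cl (J D G \<union> bel G m) \<subseteq> G" for m by (rule cl_least[OF sub GF(1)])
  have "bel G (Suc (Max (pos ` G))) = G" using fG by (auto simp: bel_def less_Suc_eq_le)
  then have "J D G \<union> bel G (Suc (Max (pos ` G))) = G" using J_sub by auto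
  then have "cl (J D G \<union> bel G (Suc (Max (pos ` G)))) = G" using Fl_cl[OF GF(1)] by simp
  then have L: "cl (J D G \<union> bel G (Suc (lab D G))) = G" unfolding lab_def by (rule LeastI)
  have nL: "cl (J D G \<union> bel G (Suc m)) \<noteq> G" if "m < lab D G" for m using not_less_Least[OF that[unfolded lab_def]] .
  have ne: "pre D G \<noteq> G"
  proof (cases "lab D G")
    case 0
    then have "pre D G = J D G" using Fl_cl[OF J_Fl[OF n]] by (simp add: pre_def bel_def)
    then show ?thesis using J_ne[OF n G] by simp
  next
    case (Suc m)
    then show ?thesis using nL[of m] by (simp add: pre_def)
  qed
  show 1: "pre D G \<in> Fl" unfolding pre_def by (rule cl_Fl[OF subE])
  show 2: "J D G \<subseteq> pre D G" "bel G (lab D G) \<subseteq> pre D G" using cl_ext[OF subE] unfolding pre_def by auto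
  show 3: "pre D G \<subset> G" using ne clG unfolding pre_def by auto
  have "\<exists>b\<in>bel G (Suc (lab D G)). b \<notin> pre D G"
  proof (rule ccontr)
    assume "\<not> ?thesis"
    then have "cl (J D G \<union> bel G (Suc (lab D G))) \<subseteq> pre D G" using 1 2 by (intro cl_least) auto
    then show False using L 3 by auto
  qed
  then obtain b where b: "b \<in> G" "pos b < Suc (lab D G)" "b \<notin> pre D G" by (auto simp: bel_def)
  then have pb: "pos b = lab D G" using 2(2) by (fastforce simp: bel_def)
  then show "\<exists>b\<in>G - pre D G. pos b = lab D G" using b by auto
  have bE: "b \<in> E" using b GF by auto
  \<comment> \<open>By injectivity of \<open>pos\<close> the element b is the only one at position
    \<open>lab D G\<close>.\<close>
  have "J D G \<union> bel G (Suc (lab D G)) \<subseteq> insert b (pre D G)"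
  proof
    fix z assume z: "z \<in> J D G \<union> bel G (Suc (lab D G))"
    show "z \<in> insert b (pre D G)"
    proof (cases "z \<in> J D G \<or> pos z < lab D G")
      case True then show ?thesis using z 2 by (auto simp: bel_def)
    next
      case False
      then have "z \<in> G" "pos z = pos b" using z pb by (auto simp: bel_def)
      then have "z = b" using inj_onD[OF inj, of z b] bE GF by auto
      then show ?thesis by simp
    qed
  qed
  then have "G \<subseteq> cl (insert b (pre D G))" using cl_mono L by blast
  then have "rk G \<le> rk (insert b (pre D G))" using rk_mono rk_cl by metis
  also have "\<dots> = Suc (rk (pre D G))" by (rule rk_flat_insert[OF 1 bE b(3)])
  finally show "Suc (rk (pre D G)) = rk G" using rk_strict[OF 1 3 GF(2)] by simp
qed

lemma pre_J: assumes "nst D" "G \<in> \<G>" "dl D G = 1" shows "pre D G = J D G"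
proof -
  have "rk (pre D G) = rk (J D G)" using lab_props(5)[OF assms(1,2)] assms(3) by (simp add: dl_def)
  then have "cl (J D G) = pre D G" using lab_props(1,2)[OF assms(1,2)] by (intro cl_eq_of_rk) auto
  then show ?thesis using Fl_cl[OF J_Fl[OF assms(1)]] by simp
qed

lemma lab_eqI:
  assumes "nst D" "G \<in> \<G>" "X \<in> Fl" "J D G \<subseteq> X" "Suc (rk X) = rk G" "X \<subset> G" "b \<in> G - X" "pos b = k"
    "bel G k \<subseteq> X" "X \<subseteq> cl (J D G \<union> bel G k)"
  shows "lab D G = k" "pre D G = X"
proof -
  have GF: "G \<in> Fl" "G \<subseteq> E" using G_Fl G_E assms by auto
  have subE: "J D G \<union> bel G m \<subseteq> E" for m using J_sub[of D G] bel_sub[of G m] GF by auto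
  have X: "cl (J D G \<union> bel G k) = X" using assms cl_least[of "J D G \<union> bel G k" X] by auto
  show l: "lab D G = k"
    unfolding lab_def
  proof (rule Least_equality)
    have 1: "X \<subseteq> cl (J D G \<union> bel G (Suc k))" using X cl_mono[of "J D G \<union> bel G k" "J D G \<union> bel G (Suc k)"] bel_mono[of k "Suc k" G] by auto
    moreover have "b \<in> cl (J D G \<union> bel G (Suc k))" using cl_ext[OF subE[of "Suc k"]] assms by (auto simp: bel_def)
    ultimately have "insert b X \<subseteq> cl (J D G \<union> bel G (Suc k))" by auto
    then have "rk (insert b X) \<le> rk (J D G \<union> bel G (Suc k))" using rk_mono rk_cl by metis
    moreover have "rk (insert b X) = Suc (rk X)" by (rule rk_flat_insert) (use assms GF in auto)
    ultimately show "cl (J D G \<union> bel G (Suc k)) = G"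
      using assms(5) J_sub[of D G] bel_sub[of G "Suc k"] by (intro cl_eq_of_rk[OF _ GF(1)]) auto
  next
    fix m assume m: "cl (J D G \<union> bel G (Suc m)) = G"
    show "k \<le> m"
    proof (rule ccontr)
      assume "\<not> k \<le> m"
      then have "cl (J D G \<union> bel G (Suc m)) \<subseteq> X" unfolding X[symmetric] using bel_mono[of "Suc m" k G] by (intro cl_mono) auto
      then show False using m assms by auto
    qed
  qed
  show "pre D G = X" unfolding pre_def l by (rule X)
qed

lemma lab_witness:
  assumes "nst S" "G \<in> \<G>" obtains b where "b \<in> G" "b \<notin> J S G" "pos b = lab S G" "b \<in> E"
proof -
  obtain b where b: "b \<in> G" "b \<notin> pre S G" "pos b = lab S G" using lab_props(6)[OF assms] by auto
  then show ?thesis using that[of b] lab_props(2)[OF assms] G_E[OF assms(2)] by auto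
qed

lemma full_lab_le: assumes "full S" "G \<in> S" "e \<in> G" "e \<notin> J S G" shows "lab S G \<le> pos e"
proof (rule ccontr)
  assume "\<not> lab S G \<le> pos e"
  then have "e \<in> bel G (lab S G)" using assms by (auto simp: bel_def)
  have GG: "G \<in> \<G>" using assms fullD(1) nstG by blast
  then have "e \<in> J S G" using lab_props(3)[OF fullD(1)[OF assms(1)] GG] pre_J[OF fullD(1)[OF assms(1)] GG fullD(3)[OF assms(1,2)]]
    \<open>e \<in> bel G (lab S G)\<close> by auto
  then show False using assms by simp
qed

lemma full_bel: assumes "full S" "G \<in> S" shows "bel G (lab S G) \<subseteq> J S G"
  using full_lab_le[OF assms] by (force simp: bel_def)

definition desc :: "'a set set \<Rightarrow> 'a set \<Rightarrow> bool" where
  "desc S H \<longleftrightarrow> H \<in> S \<and> H \<noteq> E \<and> lab S (par S H) < lab S H"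

text \<open>The element realizing the label of H lies in H, while the one realizing the label of the
  parent avoids all children of the parent.\<close>

lemma lab_par_ne: assumes "full S" "H \<in> S" "H \<noteq> E" shows "lab S (par S H) \<noteq> lab S H"
proof
  assume eq: "lab S (par S H) = lab S H"
  have n: "nst S" and E: "E \<in> S" using fullD assms by auto
  note p = par_props[OF n E assms(2,3)]
  have PG: "par S H \<in> \<G>" "H \<in> \<G>" using p(1) assms nstG[OF n] by auto
  obtain b where b: "b \<in> H" "pos b = lab S H" "b \<in> E" using lab_witness[OF n PG(2)] by metis
  obtain b' where b': "b' \<notin> J S (par S H)" "pos b' = lab S (par S H)" "b' \<in> E" using lab_witness[OF n PG(1)] by metis
  have "b = b'" using inj_onD[OF inj] b b' eq by auto
  then show False using J_upper[OF assms(2) p(2)] b b' by auto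
qed

text \<open>The labels inside a block of non-descents increase towards its top, which forces \<open>J S G\<close> to be
  the flat \<open>pre D G\<close> determined by D.\<close>

lemma key_pre:
  assumes S: "full S" and D: "D \<subseteq> S" and G: "G \<in> D" and nd: "\<And>H. H \<in> S - D \<Longrightarrow> \<not> desc S H"
  shows "J S G = pre D G" "lab S G = lab D G"
proof -
  have n: "nst S" and E: "E \<in> S" using fullD S by auto
  have nD: "nst D" by (rule nst_sub[OF n D])
  have GS: "G \<in> S" using G D by auto
  have GG: "G \<in> \<G>" using GS nstG[OF n] by auto
  have GF: "G \<in> Fl" "G \<subseteq> E" "finite G" using G_Fl[OF GG] G_E[OF GG] Fl_fin by auto
  let ?b = "lab S G"
  have low: "lab S H < ?b" if "H \<in> S" "H \<subset> G" "\<not> (\<exists>D'\<in>D. H \<subseteq> D' \<and> D' \<subset> G)" for H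
    using that
  proof (induction "card G - card H" arbitrary: H rule: less_induct)
    case less
    have HE: "H \<noteq> E" using less.prems GF by auto
    note p = par_props[OF n E less.prems(1) HE]
    have pG: "par S H \<subseteq> G" by (rule p(3)[OF GS less.prems(2)])
    have "H \<notin> D" using less.prems by auto
    then have "\<not> desc S H" using nd less.prems by auto
    then have "lab S H \<le> lab S (par S H)" using less.prems HE by (auto simp: desc_def)
    then have lt: "lab S H < lab S (par S H)" using lab_par_ne[OF S less.prems(1) HE] by simp
    show ?case
    proof (cases "par S H = G")
      case True then show ?thesis using lt by simp
    next
      case False
      then have pG': "par S H \<subset> G" using pG by auto
      have "card H < card (par S H)" "card (par S H) < card G"
        using psubset_card_mono[OF finite_subset[OF pG GF(3)] p(2)] psubset_card_mono[OF GF(3) pG'] by auto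
      then have "lab S (par S H) < ?b" using p(1,2) pG' less.prems(3) by (intro less.hyps) auto
      then show ?thesis using lt by simp
    qed
  qed
  let ?Y = "cl (J D G \<union> bel G ?b)"
  have JbE: "J D G \<union> bel G ?b \<subseteq> E" using J_sub[of D G] bel_sub[of G ?b] GF by auto
  have Y: "?Y \<in> Fl" "J D G \<subseteq> ?Y" "bel G ?b \<subseteq> ?Y" using cl_Fl[OF JbE] cl_ext[OF JbE] by auto
  \<comment> \<open>From the bottom up: a set H covered by no member of D below G is spanned by the
    join below it and the element of its label, whose position is below \<open>?b\<close> by
    \<open>low\<close>.\<close>
  have HY: "H \<subseteq> ?Y" if "H \<in> S" "H \<subset> G" for H
    using that
  proof (induction "card H" arbitrary: H rule: less_induct)
    case less
    have HG: "H \<in> \<G>" using less.prems nstG[OF n] by auto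
    have HF: "H \<in> Fl" "finite H" using G_Fl[OF HG] Fl_fin by auto
    show ?case
    proof (cases "\<exists>D'\<in>D. H \<subseteq> D' \<and> D' \<subset> G")
      case True
      then show ?thesis using Y(2) J_upper[of _ D G] by blast
    next
      case False
      have "H' \<subseteq> ?Y" if "H' \<in> S" "H' \<subset> H" for H'
        using less.hyps[OF psubset_card_mono[OF HF(2) that(2)] that(1)] that less.prems by auto
      then have 1: "J S H \<subseteq> ?Y" by (auto simp: J_def)
      obtain b where b: "b \<in> H" "b \<notin> J S H" "pos b = lab S H" "b \<in> E" by (rule lab_witness[OF n HG])
      have "b \<in> bel G ?b" using b low[OF less.prems False] less.prems by (auto simp: bel_def)
      then have 2: "insert b (J S H) \<subseteq> ?Y" using 1 Y by auto
      have "rk (insert b (J S H)) = Suc (rk (J S H))" by (rule rk_flat_insert[OF J_Fl[OF n] b(4,2)])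
      then have "rk H \<le> rk (insert b (J S H))" using fullD(3)[OF S less.prems(1)] by (simp add: dl_def)
      then have "cl (insert b (J S H)) = H" by (intro cl_eq_of_rk[OF _ HF(1)]) (use b J_sub in auto)
      then show ?thesis using cl_least[OF 2 Y(1)] by simp
    qed
  qed
  have JY: "J S G \<subseteq> ?Y" using HY by (auto simp: J_def)
  obtain b where b: "b \<in> G" "b \<notin> J S G" "pos b = lab S G" "b \<in> E" by (rule lab_witness[OF n GG])
  have "Suc (rk (J S G)) = rk G" using fullD(3)[OF S GS] by (simp add: dl_def)
  moreover have "J S G \<subset> G" using J_ne[OF n GG] J_sub by (simp add: psubset_eq)
  moreover have "b \<in> G - J S G" using b by auto
  ultimately have "lab D G = lab S G" "pre D G = J S G"
    using lab_eqI[OF nD GG J_Fl[OF n] J_mono[OF D] _ _ _ b(3) full_bel[OF S GS] JY] by blast+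
  then show "J S G = pre D G" "lab S G = lab D G" by auto
qed

text \<open>Completeness presents \<open>pre D G\<close> as the join of \<open>J D G\<close> with
  one member of \<G>, as \<open>newfac\<close> requires.\<close>

lemma newfac_pre:
  assumes n: "nst D" and G: "G \<in> D" and d: "dl D G \<noteq> 1"
  obtains K where "K \<in> factors (pre D G)" "K \<notin> D" "nst (insert K D)" "factors (pre D G) \<subseteq> insert K D"
    "J (insert K D) G = pre D G" "K \<subset> G"
proof -
  have GG: "G \<in> \<G>" using G nstG[OF n] by auto
  note l = lab_props[OF n GG]
  have ne: "pre D G \<noteq> J D G" using l(5) d rk_J[OF n GG] by (auto simp: dl_def)
  have "pre D G = J D G \<or> (\<exists>H\<in>\<G>. pre D G = cl (J D G \<union> H))"
    unfolding pre_def bel_def by (rule complete[OF J_Fl[OF n] GG J_sub])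
  then obtain H where "H \<in> \<G>" "pre D G = cl (J D G \<union> H)" using ne by auto
  then show ?thesis using newfac[OF n G _ _ l(4) ne] that by metis
qed

text \<open>At a member G of local rank above 1 the new factor K of \<open>pre D G\<close> is added,
  and induction completes the larger set to S. What remains is that K is no descent of S.\<close>

lemma completion_exists:
  assumes "nst D" "E \<in> D" shows "\<exists>S. full S \<and> D \<subseteq> S \<and> (\<forall>H\<in>S - D. \<not> desc S H)"
  using assms
proof (induction "rk E - card D" arbitrary: D rule: less_induct)
  case less
  have n: "nst D" using less.prems by simp
  show ?case
  proof (cases "\<forall>G\<in>D. dl D G = 1")
    case True
    then have "full D" using less.prems by (auto simp: full_def)
    then show ?thesis by auto
  next
    case False
    then obtain G where G: "G \<in> D" "dl D G \<noteq> 1" by auto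
    have GG: "G \<in> \<G>" using G nstG[OF n] by auto
    obtain K where K: "K \<in> factors (pre D G)" "K \<notin> D" "nst (insert K D)" "factors (pre D G) \<subseteq> insert K D"
      "J (insert K D) G = pre D G" "K \<subset> G" by (rule newfac_pre[OF n G])
    have "card (insert K D) = Suc (card D)" using K(2) nst_fin[OF n] by simp
    moreover have "card (insert K D) \<le> rk E" by (rule card_le_rk[OF K(3)]) (use less.prems in auto)
    ultimately have "\<exists>S. full S \<and> insert K D \<subseteq> S \<and> (\<forall>H\<in>S - insert K D. \<not> desc S H)"
      by (intro less.hyps) (use K less.prems in auto)
    then obtain S where S: "full S" "insert K D \<subseteq> S" "\<And>H. H \<in> S - insert K D \<Longrightarrow> \<not> desc S H" by auto
    note l = lab_props[OF n GG]
    have nS: "nst S" and ES: "E \<in> S" using fullD S by auto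
    have GS: "G \<in> S" using S G by auto
    have KG: "K \<in> \<G>" using facsD(1)[OF K(1)] .
    \<comment> \<open>Both flats are hyperplanes of G, the first by construction and the second
      because S is full; so they agree.\<close>
    have pS: "pre D G \<subseteq> J S G" using J_mono[OF S(2), of G] K(5) by simp
    have "rk (J S G) \<le> rk (pre D G)" using l(5) fullD(3)[OF S(1) GS] by (simp add: dl_def)
    then have "cl (pre D G) = J S G" by (intro cl_eq_of_rk[OF pS J_Fl[OF nS]])
    then have JS: "J S G = pre D G" using Fl_cl[OF l(1)] by simp
    have Kch: "K \<in> ch S G" using K(1) factors_J[OF nS, of G] JS by simp
    have parK: "par S K = G" "K \<noteq> E" using par_ch[OF nS ES GS Kch] by auto
    obtain b where b: "b \<in> G" "b \<notin> pre D G" "pos b = lab D G" using l(6) by auto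
    have labG: "lab S G = lab D G"
    proof (rule lab_eqI(1)[OF nS GG l(1) _ l(5) l(4) _ b(3) l(3)])
      show "J S G \<subseteq> pre D G" using JS by simp
      show "b \<in> G - pre D G" using b by auto
      show "pre D G \<subseteq> cl (J S G \<union> bel G (lab D G))"
        unfolding JS[symmetric] using J_sub[of S G] G_E[OF GG] bel_sub[of G] cl_ext[of "J S G \<union> bel G (lab D G)"] by blast
    qed
    \<comment> \<open>Some element of K before the label of G must be new in K. Otherwise
      \<open>pre D G\<close> would be spanned inside the flat in which the factor K is replaced by
      \<open>J S K\<close>, which is too small.\<close>
    have "\<exists>e\<in>K. e \<notin> J S K \<and> pos e < lab D G"
    proof (rule ccontr)
      assume neg: "\<not> ?thesis"
      let ?y = "\<lambda>M. if M = K then J S K else M"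
      let ?Z = "\<Union>(?y ` factors (pre D G))"
      have Z: "?Z \<in> Fl" by (rule union_flat[OF l(1)]) (use J_Fl[OF nS] J_sub facsD(1) G_Fl in auto)
      have "J D G \<union> bel G (lab D G) \<subseteq> ?Z"
      proof
        fix z assume z: "z \<in> J D G \<union> bel G (lab D G)"
        then have "z \<in> pre D G" using l(2,3) by auto
        then obtain M where M: "M \<in> factors (pre D G)" "z \<in> M" using factors_Un[OF l(1)] by auto
        show "z \<in> ?Z"
        proof (cases "M = K")
          case False then show ?thesis using M by (intro UN_I[of M]) auto
        next
          case True
          have "z \<in> J S K"
          proof (cases "z \<in> J D G")
            case True2: True
            then obtain H where H: "H \<in> D" "H \<subset> G" "z \<in> H" by (auto simp: J_def)
            have "H \<subseteq> pre D G" using J_upper[OF H(1,2)] l(2) by auto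
            then have "H \<subseteq> K" using H M True nstG[OF n] by (intro in_one_fac[OF l(1) _ _ K(1)]) auto
            then have "H \<subset> K" using H(1) K(2) by auto
            then show ?thesis using J_upper[of H S K] H S(2) by auto
          next
            case False
            then have "pos z < lab D G" using z by (auto simp: bel_def)
            then show ?thesis using neg M True by auto
          qed
          then show ?thesis using K(1) by (intro UN_I[of K]) auto
        qed
      qed
      then have "pre D G \<subseteq> ?Z" using cl_least[OF _ Z] by (simp add: pre_def)
      have "K \<subseteq> J S K"
      proof
        fix z assume z: "z \<in> K"
        then have "z \<in> pre D G" using facsD(2)[OF K(1)] by auto
        then obtain M where M: "M \<in> factors (pre D G)" "z \<in> ?y M" using \<open>pre D G \<subseteq> ?Z\<close> by blast
        then have "z \<in> M" using J_sub[of S K] by (auto split: if_splits)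
        then have "M = K" using factors_disjoint[OF l(1) M(1) K(1)] z by auto
        then show "z \<in> J S K" using M by simp
      qed
      then show False using J_ne[OF nS KG] J_sub[of S K] by auto
    qed
    then obtain e where e: "e \<in> K" "e \<notin> J S K" "pos e < lab D G" by auto
    have "K \<in> S" using S by auto
    then have "lab S K \<le> pos e" by (rule full_lab_le[OF S(1) _ e(1,2)])
    then have "\<not> desc S K" using e labG parK by (auto simp: desc_def)
    then show ?thesis using S by blast
  qed
qed

text \<open>By \<open>key_pre\<close> the join below G in any admissible completion is
  \<open>pre D G\<close>, so the new factor K belongs to both completions and can be added to
  D.\<close>

lemma completion_unique:
  assumes "nst D" "E \<in> D" "full S" "D \<subseteq> S" "\<And>H. H \<in> S - D \<Longrightarrow> \<not> desc S H"
    "full S'" "D \<subseteq> S'" "\<And>H. H \<in> S' - D \<Longrightarrow> \<not> desc S' H"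
  shows "S = S'"
  using assms
proof (induction "rk E - card D" arbitrary: D rule: less_induct)
  case less
  have n: "nst D" using less.prems by simp
  show ?case
  proof (cases "\<forall>G\<in>D. dl D G = 1")
    case True
    then have "full D" using less.prems by (auto simp: full_def)
    then show ?thesis using full_maximal[of D S] full_maximal[of D S'] less.prems fullD(1) by metis
  next
    case False
    then obtain G where G: "G \<in> D" "dl D G \<noteq> 1" by auto
    obtain K where K: "K \<in> factors (pre D G)" "K \<notin> D" "nst (insert K D)" "factors (pre D G) \<subseteq> insert K D"
      "J (insert K D) G = pre D G" "K \<subset> G" by (rule newfac_pre[OF n G])
    have inS: "K \<in> T" if "full T" "D \<subseteq> T" "\<And>H. H \<in> T - D \<Longrightarrow> \<not> desc T H" for T
    proof -
      have "J T G = pre D G" by (rule key_pre(1)[OF that(1,2) G(1) that(3)])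
      then have "K \<in> ch T G" using K(1) factors_J[OF fullD(1)[OF that(1)], of G] by simp
      then show ?thesis by (rule chD(1))
    qed
    have "card (insert K D) = Suc (card D)" using K(2) nst_fin[OF n] by simp
    moreover have "card (insert K D) \<le> rk E" by (rule card_le_rk[OF K(3)]) (use less.prems in auto)
    ultimately have lt: "rk E - card (insert K D) < rk E - card D" by simp
    show ?thesis
      by (rule less.hyps[OF lt K(3)]) (use less.prems inS[of S] inS[of S'] in auto)
  qed
qed

text \<open>Remove all non-descent children of G from S. The join below G in S is still determined
  by what is left, as \<open>pre ?D G\<close>, and at most one factor of that flat is new.\<close>

lemma one_nondescent_child:
  assumes S: "full S" and G: "G \<in> S" and C: "C \<in> ch S G" "\<not> desc S C" and C': "C' \<in> ch S G" "\<not> desc S C'"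
  shows "C = C'"
proof -
  have n: "nst S" and E: "E \<in> S" using fullD S by auto
  let ?D = "S - {C\<in>ch S G. \<not> desc S C}"
  have D: "?D \<subseteq> S" by auto
  have nD: "nst ?D" by (rule nst_sub[OF n D])
  have GD: "G \<in> ?D" using G chD(2)[of G S G] by auto
  have GG: "G \<in> \<G>" "C \<in> \<G>" using G C chD(1) nstG[OF n] by blast+
  have pre: "J S G = pre ?D G" by (rule key_pre(1)[OF S D GD]) auto
  have "\<not> C \<subseteq> J ?D G" by (rule child_not_below[OF n D C(1)]) (use C in auto)
  then have ne: "pre ?D G \<noteq> J ?D G" using pre J_upper[OF chD[OF C(1)]] by auto
  then have "dl ?D G \<noteq> 1" using pre_J[OF nD GG(1)] by auto
  then obtain K where K: "factors (pre ?D G) \<subseteq> insert K ?D" using newfac_pre[OF nD GD] by metis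
  have "factors (pre ?D G) = ch S G" using factors_J[OF n, of G] pre by simp
  then have "C \<in> insert K ?D" "C' \<in> insert K ?D" using K C C' by auto
  then show ?thesis using C C' by auto
qed

end

section \<open>Summing over the interval below a maximal nested set\<close>

text \<open>Generating functions of the exponents allowed at local rank n: from 0 for E, which may
  be absent from a monomial, and from 1 in \<open>geom_from1\<close> for the other members.\<close>

definition geom_from0 :: "nat \<Rightarrow> rat poly" where "geom_from0 n = (\<Sum>j<n. monom 1 j)"
definition geom_from1 :: "nat \<Rightarrow> rat poly" where "geom_from1 n = (\<Sum>j\<in>{1..<n}. monom 1 j)"

lemma geom_from0_Suc: "geom_from0 (Suc n) = 1 + [:0, 1:] * geom_from0 n"
  unfolding geom_from0_def sum.lessThan_Suc_shift by (simp add: monom_Suc sum_distrib_left monom_0 one_pCons)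
lemma geom_from0_1: "geom_from0 (Suc 0) = 1" by (simp add: geom_from0_def monom_0 one_pCons)
lemma geom_from1_1: "geom_from1 (Suc 0) = 0" by (simp add: geom_from1_def)
lemma geom_from0_geom_from1: "geom_from0 (Suc n) = 1 + geom_from1 (Suc n)"
proof -
  have "{..<Suc n} = insert 0 {1..<Suc n}" by auto
  then show ?thesis by (simp add: geom_from0_def geom_from1_def monom_0 one_pCons)
qed
lemma geom_from1_Suc: "geom_from1 (Suc n) = [:0, 1:] * geom_from0 n" using geom_from0_geom_from1[of n] geom_from0_Suc[of n] by simp

text \<open>The gap at K depends on D only through the elements met when descending from K along c,
  and these are never in A.\<close>

lemma chain_agree:
  fixes c :: "'b \<Rightarrow> 'b option" and m :: "'b \<Rightarrow> nat" and d :: "'b set \<Rightarrow> 'b \<Rightarrow> nat"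
  assumes rec: "\<And>D G. d D G = (case c G of None \<Rightarrow> 1 | Some H \<Rightarrow> if H \<in> D then 1 else Suc (d D H))"
    and dec: "\<And>G H. c G = Some H \<Longrightarrow> m H < m G"
    and clos: "\<And>G H. G \<in> S \<Longrightarrow> c G = Some H \<Longrightarrow> H \<in> S \<and> H \<notin> A"
    and agree: "\<And>x. x \<in> S \<Longrightarrow> x \<notin> A \<Longrightarrow> x \<in> D \<longleftrightarrow> x \<in> D'" and K: "K \<in> S"
  shows "d D K = d D' K"
  using K
proof (induction "m K" arbitrary: K rule: less_induct)
  case less
  show ?case
  proof (cases "c K")
    case None then show ?thesis using rec[of D K] rec[of D' K] by simp
  next
    case (Some H)
    have H: "H \<in> S" "H \<notin> A" using clos[OF less.prems Some] by auto
    then have "d D H = d D' H" by (intro less.hyps dec[OF Some])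
    then show ?thesis using rec[of D K] rec[of D' K] Some agree[OF H] by simp
  qed
qed

text \<open>A disjoint union of chains, c being the covering relation downwards: A contains the tops of the
  chains, and d measures the gap from an element to the next one in D. The chains are peeled from the top:
  if H lies below the top G, then summing over whether H is in D turns the weight \<open>geom_from1\<close> or \<open>geom_from0\<close> of G into
  a constant times the weight \<open>geom_from0\<close> of H.\<close>

lemma chain_sum:
  fixes c :: "'b \<Rightarrow> 'b option" and m :: "'b \<Rightarrow> nat" and d :: "'b set \<Rightarrow> 'b \<Rightarrow> nat"
  assumes rec: "\<And>D G. d D G = (case c G of None \<Rightarrow> 1 | Some H \<Rightarrow> if H \<in> D then 1 else Suc (d D H))"
    and dec: "\<And>G H. c G = Some H \<Longrightarrow> m H < m G"
    and fin: "finite S" and AS: "A \<subseteq> S" and TA: "T \<subseteq> A"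
    and clos: "\<And>G H. G \<in> S \<Longrightarrow> c G = Some H \<Longrightarrow> H \<in> S \<and> H \<notin> A"
    and inj: "\<And>G G' H. G \<in> S \<Longrightarrow> G' \<in> S \<Longrightarrow> c G = Some H \<Longrightarrow> c G' = Some H \<Longrightarrow> G = G'"
    and surj: "\<And>H. H \<in> S \<Longrightarrow> H \<notin> A \<Longrightarrow> \<exists>G\<in>S. c G = Some H"
  shows "((\<forall>G\<in>T. c G \<noteq> None) \<longrightarrow> (\<exists>e. card S = card A + card T + e \<and>
      (\<Sum>D\<in>{D. A \<subseteq> D \<and> D \<subseteq> S}. \<Prod>G\<in>D. if G \<in> A - T then geom_from0 (d D G) else geom_from1 (d D G)) = [:0, 1:] ^ card T * [:1, 1:] ^ e)) \<and>
    (\<not> (\<forall>G\<in>T. c G \<noteq> None) \<longrightarrow>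
      (\<Sum>D\<in>{D. A \<subseteq> D \<and> D \<subseteq> S}. \<Prod>G\<in>D. if G \<in> A - T then geom_from0 (d D G) else geom_from1 (d D G)) = 0)"
  using fin AS TA clos inj surj
proof (induction "card S" arbitrary: S A T rule: less_induct)
  case less
  let ?w = "\<lambda>A T D G. if G \<in> A - T then geom_from0 (d D G) else geom_from1 (d D G)"
  let ?Z = "\<lambda>S A T. \<Sum>D\<in>{D. A \<subseteq> D \<and> D \<subseteq> S}. \<Prod>G\<in>D. ?w A T D G"
  note fS = less.prems(1) and AS = less.prems(2) and TA = less.prems(3) and clos = less.prems(4)
    and inj = less.prems(5) and surj = less.prems(6)
  have fA: "finite A" by (rule finite_subset[OF AS fS])
  have fT: "finite T" by (rule finite_subset[OF TA fA])
  show ?case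
  proof (cases "A = {}")
    case True
    \<comment> \<open>Without tops, an element of maximal measure would still be covered by one of
      larger measure.\<close>
    have "S = {}"
    proof (rule ccontr)
      assume ne: "S \<noteq> {}"
      obtain H where H: "H \<in> S" "m H = Max (m ` S)" using Max_in[of "m ` S"] fS ne by fastforce
      then obtain G where G: "G \<in> S" "c G = Some H" using surj[of H] True by auto
      have "m G \<le> Max (m ` S)" by (rule Max_ge) (use fS G in auto)
      then show False using dec[OF G(2)] H by simp
    qed
    then show ?thesis using True TA by auto
  next
    case False
    then obtain G where G: "G \<in> A" by auto
    define S' where "S' = S - {G}"
    have fS': "finite S'" using fS by (simp add: S'_def)
    have GS: "G \<in> S" using G AS by auto
    have cS: "card S = Suc (card S')" unfolding S'_def using card.remove[OF fS GS] by simp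
    have cA: "card A = Suc (card (A - {G}))" using card.remove[OF fA G] by simp
    have pos: "\<exists>n. d D K = Suc n" for D K using rec[of D K] by (auto split: option.splits)
    show ?thesis
    proof (cases "c G")
      case None
      have IH: "((\<forall>G\<in>T-{G}. c G \<noteq> None) \<longrightarrow> (\<exists>e. card S' = card (A-{G}) + card (T-{G}) + e \<and>
          ?Z S' (A-{G}) (T-{G}) = [:0, 1:] ^ card (T-{G}) * [:1, 1:] ^ e)) \<and>
        (\<not> (\<forall>G\<in>T-{G}. c G \<noteq> None) \<longrightarrow> ?Z S' (A-{G}) (T-{G}) = 0)"
      proof (rule less.hyps)
        show "card S' < card S" using cS by simp
        fix K H assume K: "K \<in> S'" "c K = Some H"
        then show "H \<in> S' \<and> H \<notin> A - {G}" using clos[of K H] G by (auto simp: S'_def)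
      next
        fix H assume H: "H \<in> S'" "H \<notin> A - {G}"
        then obtain K where "K \<in> S" "c K = Some H" using surj[of H] by (auto simp: S'_def)
        then show "\<exists>K\<in>S'. c K = Some H" using None by (auto simp: S'_def)
      qed (use fS' AS TA inj in \<open>auto simp: S'_def\<close>)
      have im: "{D. A \<subseteq> D \<and> D \<subseteq> S} = insert G ` {D. A - {G} \<subseteq> D \<and> D \<subseteq> S'}"
      proof
        show "{D. A \<subseteq> D \<and> D \<subseteq> S} \<subseteq> insert G ` {D. A - {G} \<subseteq> D \<and> D \<subseteq> S'}"
        proof
          fix D assume "D \<in> {D. A \<subseteq> D \<and> D \<subseteq> S}"
          then show "D \<in> insert G ` {D. A - {G} \<subseteq> D \<and> D \<subseteq> S'}"
            using G by (intro image_eqI[of _ _ "D - {G}"]) (auto simp: S'_def)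
        qed
      qed (use G GS in \<open>auto simp: S'_def\<close>)
      have ij: "inj_on (insert G) {D. A - {G} \<subseteq> D \<and> D \<subseteq> S'}" unfolding S'_def by (intro inj_onI) blast
      \<comment> \<open>G is a whole chain by itself, with gap 1: its factor is 1, or 0 if G is in
        T.\<close>
      have wt: "(\<Prod>K\<in>insert G D. ?w A T (insert G D) K) = (if G \<in> T then 0 else 1) * (\<Prod>K\<in>D. ?w (A-{G}) (T-{G}) D K)"
        if D: "A - {G} \<subseteq> D" "D \<subseteq> S'" for D
      proof -
        have GD: "G \<notin> D" "finite D" using D finite_subset[OF D(2) fS'] by (auto simp: S'_def)
        have "d (insert G D) G = Suc 0" using rec[of "insert G D" G] None by simp
        then have wG: "?w A T (insert G D) G = (if G \<in> T then 0 else 1)" using G by (simp add: geom_from0_1 geom_from1_1)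
        have "?w A T (insert G D) K = ?w (A-{G}) (T-{G}) D K" if K: "K \<in> D" for K
        proof -
          have "d (insert G D) K = d D K"
            by (rule chain_agree[where c = c and m = m and S = S and A = A, OF rec dec clos])
              (use G K D in \<open>auto simp: S'_def\<close>)
          then show ?thesis using K GD by auto
        qed
        then have e: "(\<Prod>K\<in>D. ?w A T (insert G D) K) = (\<Prod>K\<in>D. ?w (A-{G}) (T-{G}) D K)" by (rule prod.cong[OF refl])
        show ?thesis unfolding prod.insert[OF GD(2,1)] wG e ..
      qed
      have Z: "?Z S A T = (if G \<in> T then 0 else 1) * ?Z S' (A-{G}) (T-{G})"
        unfolding im sum.reindex[OF ij] o_def sum_distrib_left by (rule sum.cong) (use wt in auto)
      show ?thesis
      proof (cases "G \<in> T")
        case True then show ?thesis using Z None by auto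
      next
        case False
        then have TT: "T - {G} = T" by auto
        have Z': "?Z S A T = ?Z S' (A-{G}) (T-{G})" using Z False by (simp only: if_False mult_1)
        show ?thesis unfolding Z' using IH unfolding TT cA cS by simp
      qed
    next
      case (Some H)
      have H: "H \<in> S" "H \<notin> A" "H \<noteq> G" using clos[OF GS Some] G by auto
      \<comment> \<open>H becomes a top outside \<open>T'\<close>, so its new weight is
        \<open>geom_from0\<close> whichever weight G had.\<close>
      define A' where "A' = insert H (A - {G})"
      define T' where "T' = T - {G}"
      have HS': "H \<in> S'" using H by (simp add: S'_def)
      have cA': "card A' = card A" unfolding A'_def cA using H fA by simp
      have clos': "L \<in> S' \<and> L \<notin> A'" if K: "K \<in> S'" "c K = Some L" for K L
      proof -
        have "L \<in> S" "L \<notin> A" using clos[of K L] K by (auto simp: S'_def)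
        moreover have "L \<noteq> H" using inj[of K G H] K GS Some by (auto simp: S'_def)
        ultimately show ?thesis using G by (auto simp: S'_def A'_def)
      qed
      have IH: "((\<forall>G\<in>T'. c G \<noteq> None) \<longrightarrow> (\<exists>e. card S' = card A' + card T' + e \<and>
          ?Z S' A' T' = [:0, 1:] ^ card T' * [:1, 1:] ^ e)) \<and>
        (\<not> (\<forall>G\<in>T'. c G \<noteq> None) \<longrightarrow> ?Z S' A' T' = 0)"
      proof (rule less.hyps)
        show "card S' < card S" using cS by simp
        show "A' \<subseteq> S'" using AS H by (auto simp: A'_def S'_def)
        show "T' \<subseteq> A'" using TA by (auto simp: A'_def T'_def)
        fix L assume L: "L \<in> S'" "L \<notin> A'"
        then obtain K where "K \<in> S" "c K = Some L" using surj[of L] by (auto simp: S'_def A'_def)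
        then show "\<exists>K\<in>S'. c K = Some L" using Some L by (auto simp: S'_def A'_def)
      next
        show "finite S'" by (rule fS')
        show "L \<in> S' \<and> L \<notin> A'" if "K \<in> S'" "c K = Some L" for K L using that by (rule clos')
        show "K = K'" if "K \<in> S'" "K' \<in> S'" "c K = Some L" "c K' = Some L" for K K' L
          using inj[OF _ _ that(3,4)] that(1,2) unfolding S'_def by blast
      qed
      let ?I = "{D. A' \<subseteq> D \<and> D \<subseteq> S'}"
      \<comment> \<open>The sets D are split by whether they contain H. Both kinds arise from the
        same sets over \<open>S'\<close>, which all contain the new top H.\<close>
      let ?f = "insert G" and ?g = "\<lambda>D. insert G (D - {H})"
      have fI: "finite ?I" by (rule finite_subset[of _ "Pow S'"]) (use fS' in auto)
      have im: "{D. A \<subseteq> D \<and> D \<subseteq> S} = ?f ` ?I \<union> ?g ` ?I"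
      proof
        show "{D. A \<subseteq> D \<and> D \<subseteq> S} \<subseteq> ?f ` ?I \<union> ?g ` ?I"
        proof
          fix D assume D: "D \<in> {D. A \<subseteq> D \<and> D \<subseteq> S}"
          show "D \<in> ?f ` ?I \<union> ?g ` ?I"
          proof (cases "H \<in> D")
            case True
            have "D \<in> ?f ` ?I"
              by (rule image_eqI[of _ _ "D - {G}"]) (use D G H True in \<open>auto simp: S'_def A'_def\<close>)
            then show ?thesis by simp
          next
            case False
            have "D \<in> ?g ` ?I"
              by (rule image_eqI[of _ _ "insert H (D - {G})"]) (use D G H False in \<open>auto simp: S'_def A'_def\<close>)
            then show ?thesis by simp
          qed
        qed
        show "?f ` ?I \<union> ?g ` ?I \<subseteq> {D. A \<subseteq> D \<and> D \<subseteq> S}" using G GS H by (auto simp: S'_def A'_def)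
      qed
      have ij1: "inj_on ?f ?I" by (intro inj_onI) (auto simp: S'_def)
      have ij2: "inj_on ?g ?I"
      proof (rule inj_onI)
        fix D D' assume D: "D \<in> ?I" "D' \<in> ?I" "?g D = ?g D'"
        have "D = insert H (?g D - {G})" "D' = insert H (?g D' - {G})" using D H by (auto simp: S'_def A'_def)
        then show "D = D'" using D(3) by simp
      qed
      have disj: "?f ` ?I \<inter> ?g ` ?I = {}" using H by (auto simp: A'_def)
      let ?k = "if G \<in> T then [:0, 1:] else [:1, 1:] :: rat poly"
      have wt: "(\<Prod>K\<in>?f D. ?w A T (?f D) K) + (\<Prod>K\<in>?g D. ?w A T (?g D) K) = ?k * (\<Prod>K\<in>D. ?w A' T' D K)"
        if D: "D \<in> ?I" for D
      proof -
        have HD: "H \<in> D" and GD: "G \<notin> D" "finite D" using D finite_subset[of D S'] fS' by (auto simp: S'_def A'_def)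
        let ?n = "d D H" and ?B = "D - {H}"
        have d1: "d (?f D) K = d D K" if K: "K \<in> S'" for K
          by (rule chain_agree[where c = c and m = m and S = S' and A = A', OF rec dec clos'])
            (use K in \<open>auto simp: S'_def\<close>)
        have d2: "d (?g D) K = d D K" if K: "K \<in> S'" for K
          by (rule chain_agree[where c = c and m = m and S = S' and A = A', OF rec dec clos'])
            (use K in \<open>auto simp: S'_def A'_def\<close>)
        have d1G: "d (?f D) G = Suc 0" using rec[of "?f D" G] Some HD by simp
        have d2G: "d (?g D) G = Suc ?n" using rec[of "?g D" G] Some H d2[OF HS'] by simp
        have DS': "D \<subseteq> S'" using D by auto
        have w: "?w A T (?f D) K = ?w A' T' D K" "?w A T (?g D) K = ?w A' T' D K" if "K \<in> ?B" for K
        proof -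
          have K: "K \<in> S'" "K \<noteq> H" "K \<noteq> G" using that DS' by (auto simp: S'_def)
          have "K \<in> A - T \<longleftrightarrow> K \<in> A' - T'" using K by (auto simp: A'_def T'_def)
          then show "?w A T (?f D) K = ?w A' T' D K" "?w A T (?g D) K = ?w A' T' D K"
            using d1[OF K(1)] d2[OF K(1)] by simp_all
        qed
        define P where "P = (\<Prod>K\<in>?B. ?w A' T' D K)"
        have HT: "H \<in> A' - T'" "H \<notin> A - T" using H TA by (auto simp: A'_def T'_def)
        have "(\<Prod>K\<in>D. ?w A' T' D K) = ?w A' T' D H * P" unfolding P_def by (rule prod.remove[OF GD(2) HD])
        then have e0: "(\<Prod>K\<in>D. ?w A' T' D K) = geom_from0 ?n * P" using HT(1) by simp
        have "(\<Prod>K\<in>?f D. ?w A T (?f D) K) = ?w A T (?f D) G * (\<Prod>K\<in>D. ?w A T (?f D) K)"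
          by (rule prod.insert[OF GD(2,1)])
        also have "(\<Prod>K\<in>D. ?w A T (?f D) K) = ?w A T (?f D) H * (\<Prod>K\<in>?B. ?w A T (?f D) K)"
          by (rule prod.remove[OF GD(2) HD])
        also have "(\<Prod>K\<in>?B. ?w A T (?f D) K) = P" unfolding P_def by (rule prod.cong[OF refl w(1)])
        finally have "(\<Prod>K\<in>?f D. ?w A T (?f D) K) = ?w A T (?f D) G * (?w A T (?f D) H * P)" .
        then have e1: "(\<Prod>K\<in>?f D. ?w A T (?f D) K) = (if G \<in> T then 0 else 1) * (geom_from1 ?n * P)"
          using d1[OF HS'] d1G H(2) G by (simp add: geom_from1_1 geom_from0_1)
        have "(\<Prod>K\<in>?g D. ?w A T (?g D) K) = ?w A T (?g D) G * (\<Prod>K\<in>?B. ?w A T (?g D) K)"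
          by (rule prod.insert) (use GD in auto)
        also have "(\<Prod>K\<in>?B. ?w A T (?g D) K) = P" unfolding P_def by (rule prod.cong[OF refl w(2)])
        finally have "(\<Prod>K\<in>?g D. ?w A T (?g D) K) = ?w A T (?g D) G * P" .
        then have e2: "(\<Prod>K\<in>?g D. ?w A T (?g D) K) = (if G \<in> T then geom_from1 (Suc ?n) else geom_from0 (Suc ?n)) * P"
          using d2G G by simp
        obtain n where n: "?n = Suc n" using pos by blast
        \<comment> \<open>With n the gap below H: for G in T the two cases give 0 and t times
          \<open>geom_from0 n\<close>; otherwise \<open>geom_from1 n\<close> and 1 + t times
          \<open>geom_from0 n\<close> add up to (1 + t) times \<open>geom_from0 n\<close>.\<close>
        have "(if G \<in> T then 0 else 1) * geom_from1 ?n + (if G \<in> T then geom_from1 (Suc ?n) else geom_from0 (Suc ?n)) = ?k * geom_from0 ?n"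
        proof (cases "G \<in> T")
          case True then show ?thesis by (simp add: geom_from1_Suc)
        next
          case False
          have "[:1, 1:] = 1 + [:0, 1:: rat:]" by (simp add: one_pCons)
          then show ?thesis using False geom_from0_geom_from1[of n] by (simp add: geom_from0_Suc[of "Suc n"] n algebra_simps)
        qed
        then have "((if G \<in> T then 0 else 1) * geom_from1 ?n + (if G \<in> T then geom_from1 (Suc ?n) else geom_from0 (Suc ?n))) * P = ?k * geom_from0 ?n * P" by simp
        then show ?thesis unfolding e0 e1 e2 by (simp only: distrib_right mult.assoc)
      qed
      have "?Z S A T = (\<Sum>D\<in>?f ` ?I. \<Prod>K\<in>D. ?w A T D K) + (\<Sum>D\<in>?g ` ?I. \<Prod>K\<in>D. ?w A T D K)"
        unfolding im by (rule sum.union_disjoint[OF _ _ disj]) (use fI in auto)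
      also have "\<dots> = (\<Sum>D\<in>?I. (\<Prod>K\<in>?f D. ?w A T (?f D) K) + (\<Prod>K\<in>?g D. ?w A T (?g D) K))"
        unfolding sum.reindex[OF ij1] sum.reindex[OF ij2] o_def sum.distrib ..
      also have "\<dots> = ?k * ?Z S' A' T'" unfolding sum_distrib_left by (rule sum.cong[OF refl wt])
      finally have Z: "?Z S A T = ?k * ?Z S' A' T'" .
      have ct: "(\<forall>G\<in>T. c G \<noteq> None) \<longleftrightarrow> (\<forall>G\<in>T'. c G \<noteq> None)" using Some by (auto simp: T'_def)
      show ?thesis
      proof (cases "\<forall>G\<in>T'. c G \<noteq> None")
        case False
        then have "?Z S' A' T' = 0" using IH by blast
        then have "?Z S A T = 0" unfolding Z by simp
        then show ?thesis using False ct by blast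
      next
        case True
        then obtain e where e: "card S' = card A' + card T' + e" "?Z S' A' T' = [:0, 1:] ^ card T' * [:1, 1:] ^ e"
          using IH by blast
        have "\<exists>e. card S = card A + card T + e \<and> ?Z S A T = [:0, 1:] ^ card T * [:1, 1:] ^ e"
        proof (cases "G \<in> T")
          case True2: True
          have cT: "card T = Suc (card T')" unfolding T'_def using card.remove[OF fT True2] by simp
          have "?Z S A T = [:0, 1:] ^ card T * [:1, 1:] ^ e" unfolding Z e(2) cT using True2 by (simp only: if_True power_Suc mult.assoc)
          then show ?thesis using e(1) cS cA' cT by (intro exI[of _ e]) simp
        next
          case False
          have T': "T' = T" using False by (auto simp: T'_def)
          have "?Z S A T = [:0, 1:] ^ card T * [:1, 1:] ^ Suc e" unfolding Z e(2) unfolding T' using False by (simp only: if_False power_Suc ac_simps)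
          then show ?thesis using e(1) cS cA' T' by (intro exI[of _ "Suc e"]) simp
        qed
        then show ?thesis using True ct by blast
      qed
    qed
  qed
qed

text \<open>The recursion for the gap terminates only through the measure m, so a bound on the
  number of steps is carried along; by \<open>gap_fuel_eq\<close> any bound of at least
  \<open>m G\<close> gives the same value.\<close>

primrec gap_fuel :: "('b \<Rightarrow> 'b option) \<Rightarrow> 'b set \<Rightarrow> nat \<Rightarrow> 'b \<Rightarrow> nat" where
  "gap_fuel c D 0 G = 1"
| "gap_fuel c D (Suc k) G = (case c G of None \<Rightarrow> 1 | Some H \<Rightarrow> if H \<in> D then 1 else Suc (gap_fuel c D k H))"

lemma gap_fuel_eq:
  assumes dec: "\<And>G H. c G = Some H \<Longrightarrow> (m H :: nat) < m G"
  shows "m G \<le> k \<Longrightarrow> m G \<le> k' \<Longrightarrow> gap_fuel c D k G = gap_fuel c D k' G"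
proof (induction k arbitrary: k' G)
  case 0
  then have "c G = None" using dec[of G] by (cases "c G") auto
  then show ?case by (cases k') auto
next
  case (Suc k)
  show ?case
  proof (cases "c G")
    case None then show ?thesis by (cases k') auto
  next
    case (Some H)
    have lt: "m H < m G" by (rule dec[OF Some])
    then obtain l where l: "k' = Suc l" using Suc.prems by (cases k') auto
    have "gap_fuel c D k H = gap_fuel c D l H" by (rule Suc.IH) (use lt Suc.prems l in auto)
    then show ?thesis using Some l by simp
  qed
qed

lemma gap_exists:
  fixes c :: "'b \<Rightarrow> 'b option" and m :: "'b \<Rightarrow> nat"
  assumes dec: "\<And>G H. c G = Some H \<Longrightarrow> m H < m G"
  obtains d where "\<And>D G. d D G = (case c G of None \<Rightarrow> 1 | Some H \<Rightarrow> if H \<in> D then 1 else Suc (d D H))"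
proof (rule that)
  fix D G
  show "gap_fuel c D (m G) G = (case c G of None \<Rightarrow> 1 | Some H \<Rightarrow> if H \<in> D then 1 else Suc (gap_fuel c D (m H) H))"
  proof (cases "c G")
    case None then show ?thesis by (cases "m G") auto
  next
    case (Some H)
    have lt: "m H < m G" by (rule dec[OF Some])
    then obtain l where l: "m G = Suc l" by (cases "m G") auto
    have "gap_fuel c D l H = gap_fuel c D (m H) H" by (rule gap_fuel_eq[OF dec]) (use lt l in auto)
    then show ?thesis using Some l by simp
  qed
qed

section \<open>The Chow polynomial as a sum over maximal nested sets\<close>

context ordered_building
begin

definition wt :: "'a set \<Rightarrow> nat \<Rightarrow> rat poly" where "wt G n = (if G = E then geom_from0 n else geom_from1 n)"
definition rng :: "'a set \<Rightarrow> nat \<Rightarrow> nat set" where "rng G n = (if G = E then {..<n} else {1..<n})"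

lemma wt_rng: "wt G n = (\<Sum>j\<in>rng G n. monom 1 j)" by (simp add: wt_def rng_def geom_from0_def geom_from1_def)
lemma rng_fin: "finite (rng G n)" by (simp add: rng_def)

definition nested_with_E :: "'a set set set" where "nested_with_E = {D. nst D \<and> E \<in> D}"

lemma finND: "finite nested_with_E"
  by (rule finite_subset[of _ "Pow \<G>"]) (use finG nstG in \<open>auto simp: nested_with_E_def\<close>)

lemma dl_insert_E: "G \<in> \<G> \<Longrightarrow> dl (insert E D) G = dl D G"
proof -
  assume "G \<in> \<G>"
  then have "\<not> E \<subset> G" using G_E[of G] by auto
  then have "{H\<in>insert E D. H \<subset> G} = {H\<in>D. H \<subset> G}" by auto
  then show ?thesis by (simp add: dl_def J_def)
qed

lemma prod_monom: "finite D \<Longrightarrow> (\<Prod>G\<in>D. monom (1::rat) (g G)) = monom 1 (\<Sum>G\<in>D. g G)"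
  by (induction D rule: finite_induct) (auto simp: monom_0 one_pCons mult_monom)

definition mset_of :: "'a set set \<Rightarrow> ('a set \<Rightarrow> nat) \<Rightarrow> 'a set multiset" where
  "mset_of D g = (\<Sum>G\<in>D. replicate_mset (g G) G)"

lemma count_mset_of: "finite D \<Longrightarrow> count (mset_of D g) G = (if G \<in> D then g G else 0)"
  unfolding mset_of_def by (simp add: count_sum)

text \<open>Expanding the products enumerates pairs (D, g): D is the support of a basis monomial
  with E added, g its exponents. Exponent 0 at E stands for monomials without E; E is never strictly
  below a member, so adding it changes no local rank.\<close>

lemma chow_sum: "chow_poly E indep \<G> = (\<Sum>D\<in>nested_with_E. \<Prod>G\<in>D. wt G (dl D G))"
proof -
  have fD: "finite D" if "D \<in> nested_with_E" for D using that nst_fin by (auto simp: nested_with_E_def)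
  have "(\<Sum>D\<in>nested_with_E. \<Prod>G\<in>D. wt G (dl D G)) = (\<Sum>D\<in>nested_with_E. \<Sum>g\<in>PiE D (\<lambda>G. rng G (dl D G)). monom 1 (\<Sum>G\<in>D. g G))"
  proof (rule sum.cong[OF refl])
    fix D assume D: "D \<in> nested_with_E"
    have "(\<Prod>G\<in>D. wt G (dl D G)) = (\<Prod>G\<in>D. \<Sum>j\<in>rng G (dl D G). monom 1 j)" by (simp add: wt_rng)
    also have "\<dots> = (\<Sum>g\<in>PiE D (\<lambda>G. rng G (dl D G)). \<Prod>G\<in>D. monom 1 (g G))"
      by (rule prod_sum_PiE) (use fD[OF D] rng_fin in auto)
    finally show "(\<Prod>G\<in>D. wt G (dl D G)) = (\<Sum>g\<in>PiE D (\<lambda>G. rng G (dl D G)). monom 1 (\<Sum>G\<in>D. g G))"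
      by (simp add: prod_monom[OF fD[OF D]])
  qed
  also have "\<dots> = (\<Sum>(D, g)\<in>Sigma nested_with_E (\<lambda>D. PiE D (\<lambda>G. rng G (dl D G))). monom 1 (\<Sum>G\<in>D. g G))"
    by (rule sum.Sigma[OF finND]) (use fD rng_fin in \<open>auto intro!: finite_PiE\<close>)
  also have "\<dots> = (\<Sum>m\<in>FYm. monom 1 (size m))"
  proof (rule sum.reindex_bij_witness[where
        j = "\<lambda>(D, g). mset_of D g" and i = "\<lambda>m. (insert E (set_mset m), restrict (count m) (insert E (set_mset m)))"])
    fix p assume "p \<in> Sigma nested_with_E (\<lambda>D. PiE D (\<lambda>G. rng G (dl D G)))"
    then obtain D g where p: "p = (D, g)" and D: "D \<in> nested_with_E" and g: "g \<in> PiE D (\<lambda>G. rng G (dl D G))" by auto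
    have n: "nst D" and ED: "E \<in> D" using D by (auto simp: nested_with_E_def)
    note cnt = count_mset_of[OF fD[OF D], of g]
    have gm: "g G \<in> rng G (dl D G)" if "G \<in> D" for G by (rule PiE_mem[OF g that])
    have g1: "1 \<le> g G" if "G \<in> D" "G \<noteq> E" for G using gm[OF that(1)] that(2) by (simp add: rng_def)
    have g2: "g G < dl D G" if "G \<in> D" for G using gm[OF that] by (simp add: rng_def split: if_split_asm)
    have sm: "set_mset (mset_of D g) = {G\<in>D. 0 < g G}" by (auto simp: set_mset_def cnt)
    have iD: "insert E (set_mset (mset_of D g)) = D" unfolding sm using ED g1 by force
    have "restrict (count (mset_of D g)) D = g"
    proof
      fix x show "restrict (count (mset_of D g)) D x = g x" using g cnt by (auto simp: PiE_iff extensional_def)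
    qed
    then show "(case case p of (D, g) \<Rightarrow> mset_of D g of m \<Rightarrow> (insert E (set_mset m), restrict (count m) (insert E (set_mset m)))) = p"
      unfolding p by (simp add: iD)
    have dls: "dl (set_mset (mset_of D g)) G = dl D G" if "G \<in> D" for G
    proof -
      have "G \<in> \<G>" using that nstG[OF n] by auto
      from dl_insert_E[OF this, of "set_mset (mset_of D g)"] show ?thesis unfolding iD by simp
    qed
    have "nst (set_mset (mset_of D g))" by (rule nst_sub[OF n]) (auto simp: sm)
    then show "(case p of (D, g) \<Rightarrow> mset_of D g) \<in> FYm"
      unfolding p FY_def using nstG[OF n] g2 dls by (auto simp: sm cnt)
    have "size (mset_of D g) = (\<Sum>G\<in>D. g G)" unfolding mset_of_def by (simp add: size_multiset_sum)
    then show "monom 1 (size (case p of (D, g) \<Rightarrow> mset_of D g)) = (case p of (D, g) \<Rightarrow> monom (1::rat) (\<Sum>G\<in>D. g G))"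
      unfolding p by simp
  next
    fix m assume m: "m \<in> FYm"
    have mG: "set_mset m \<subseteq> \<G>" and n: "nst (set_mset m)" using m by (auto simp: FY_def)
    let ?D = "insert E (set_mset m)"
    have nD: "nst ?D" by (rule nst_insert_E[OF n EG])
    have D: "?D \<in> nested_with_E" using nD by (auto simp: nested_with_E_def)
    have cl: "count m G < dl ?D G" if "G \<in> ?D" for G
    proof -
      have GG: "G \<in> \<G>" using that mG EG by auto
      show ?thesis
      proof (cases "G \<in># m")
        case True then show ?thesis using m dl_insert_E[OF GG] by (auto simp: FY_def)
      next
        case False then show ?thesis using dl_pos[OF nD GG] by (simp add: not_in_iff)
      qed
    qed
    have "restrict (count m) ?D \<in> PiE ?D (\<lambda>G. rng G (dl ?D G))"
    proof (rule PiE_I)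
      fix G assume G: "G \<in> ?D"
      then have "G \<noteq> E \<Longrightarrow> 1 \<le> count m G" by (auto simp: Suc_le_eq)
      then show "restrict (count m) ?D G \<in> rng G (dl ?D G)" using cl[OF G] G by (auto simp: rng_def)
    qed auto
    then show "(?D, restrict (count m) ?D) \<in> Sigma nested_with_E (\<lambda>D. PiE D (\<lambda>G. rng G (dl D G)))" using D by simp
    show "(case (?D, restrict (count m) ?D) of (D, g) \<Rightarrow> mset_of D g) = m"
      by (rule multiset_eqI) (auto simp: count_mset_of not_in_iff)
  qed
  finally show ?thesis unfolding chow_poly_FY by simp
qed

section \<open>Descents and chains of non-descents\<close>

definition descs :: "'a set set \<Rightarrow> 'a set set" where "descs S = {G. desc S G}"

lemma descs_sub: "descs S \<subseteq> S" "E \<notin> descs S" by (auto simp: descs_def desc_def)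

text \<open>A descent without children and a descent all of whose children are descents are excluded
  by one condition; see \<open>stable_iff\<close>.\<close>

definition stable :: "'a set set \<Rightarrow> bool" where "stable S \<longleftrightarrow> (\<forall>G\<in>descs S. \<exists>C\<in>ch S G. \<not> desc S C)"

lemma J_children:
  assumes S: "nst S" and D: "D \<subseteq> S"
  shows "J D G = \<Union>((\<lambda>C. if C \<in> D then C else J D C) ` ch S G)"
proof
  show "J D G \<subseteq> \<Union>((\<lambda>C. if C \<in> D then C else J D C) ` ch S G)"
  proof
    fix z assume "z \<in> J D G"
    then obtain H where H: "H \<in> D" "H \<subset> G" "z \<in> H" by (auto simp: J_def)
    obtain C where C: "C \<in> ch S G" "H \<subseteq> C" using ch_above[OF S, of H G] H D by auto
    have "z \<in> (if C \<in> D then C else J D C)"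
    proof (cases "C \<in> D")
      case True then show ?thesis using C H by auto
    next
      case False
      then have "H \<subset> C" using C H by auto
      then show ?thesis using J_upper[OF H(1)] H(3) False by auto
    qed
    then show "z \<in> \<Union>((\<lambda>C. if C \<in> D then C else J D C) ` ch S G)" using C(1) by (intro UN_I)
  qed
  show "\<Union>((\<lambda>C. if C \<in> D then C else J D C) ` ch S G) \<subseteq> J D G"
  proof (rule UN_least)
    fix C assume C: "C \<in> ch S G"
    show "(if C \<in> D then C else J D C) \<subseteq> J D G"
    proof (cases "C \<in> D")
      case True then show ?thesis using J_upper[OF True chD(2)[OF C]] by simp
    next
      case False
      have "J D C \<subseteq> J D G" by (rule J_mono2) (use chD(2)[OF C] in auto)
      then show ?thesis using False by simp
    qed
  qed
qed

text \<open>In the join below G over D, a child C missing from D contributes only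
  \<open>J D C\<close>. As ranks add over the disjoint children, the local rank exceeds its value 1
  in S by the local ranks of the missing children.\<close>

lemma dl_children:
  assumes S: "full S" and D: "D \<subseteq> S" and G: "G \<in> S"
  shows "dl D G = 1 + (\<Sum>C\<in>{C\<in>ch S G. C \<notin> D}. dl D C)"
proof -
  have n: "nst S" using fullD S by auto
  have nD: "nst D" by (rule nst_sub[OF n D])
  have GG: "G \<in> \<G>" using G nstG[OF n] by auto
  let ?y = "\<lambda>C. if C \<in> D then C else J D C"
  have CG: "C \<in> \<G>" if "C \<in> ch S G" for C using chD(1)[OF that] nstG[OF n] by auto
  have y: "?y C \<in> Fl \<and> ?y C \<subseteq> C" if "C \<in> ch S G" for C
    using G_Fl[OF CG[OF that]] J_Fl[OF nD, of C] J_sub[of D C] by auto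
  have "rk (J D G) = (\<Sum>C\<in>ch S G. rk (?y C))"
    using arg_cong[OF J_children[OF n D, of G], of rk] nst_antichain_union(2)[OF n ch_sub[of S G] ch_ac y] by simp
  moreover have "rk G = 1 + (\<Sum>C\<in>ch S G. rk C)"
    using fullD(3)[OF S G] rk_J_ch[OF n, of G] rk_J[OF n GG] by (simp add: dl_def)
  moreover have "(\<Sum>C\<in>ch S G. rk C) = (\<Sum>C\<in>ch S G. rk (?y C)) + (\<Sum>C\<in>ch S G. if C \<notin> D then dl D C else 0)"
    unfolding sum.distrib[symmetric]
  proof (rule sum.cong[OF refl])
    fix C assume C: "C \<in> ch S G"
    show "rk C = rk (?y C) + (if C \<notin> D then dl D C else 0)" using rk_J[OF nD CG[OF C]] by (simp add: dl_def)
  qed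
  moreover have "(\<Sum>C\<in>ch S G. if C \<notin> D then dl D C else 0) = (\<Sum>C\<in>{C\<in>ch S G. C \<notin> D}. dl D C)"
    by (rule sum.inter_filter[symmetric, OF ch_fin[OF n]])
  ultimately show ?thesis by (simp add: dl_def)
qed

text \<open>Descending step in a chain: the non-descent child, unique by
  \<open>one_nondescent_child\<close>.\<close>

definition cov :: "'a set set \<Rightarrow> 'a set \<Rightarrow> 'a set option" where
  "cov S G = (if G \<in> S \<and> (\<exists>C\<in>ch S G. \<not> desc S C) then Some (SOME C. C \<in> ch S G \<and> \<not> desc S C) else None)"

lemma cov_Some: "cov S G = Some C \<Longrightarrow> G \<in> S \<and> C \<in> ch S G \<and> \<not> desc S C"
  unfolding cov_def using someI_ex[of "\<lambda>C. C \<in> ch S G \<and> \<not> desc S C"] by (auto split: if_splits)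

lemma cov_SomeI: assumes "full S" "G \<in> S" "C \<in> ch S G" "\<not> desc S C" shows "cov S G = Some C"
proof -
  have "cov S G = Some (SOME C. C \<in> ch S G \<and> \<not> desc S C)" using assms unfolding cov_def by auto
  then obtain C' where C': "cov S G = Some C'" by blast
  have "C' = C" using cov_Some[OF C'] one_nondescent_child[OF assms(1,2)] assms(3,4) by blast
  then show ?thesis using C' by simp
qed

text \<open>An instance of \<open>chain_sum\<close>: the tops are E and the descents, since every
  other member is a non-descent child of its parent, and T is the set of descents. Stability says
  that no descent is at the bottom of its chain.\<close>

lemma interval_sum:
  assumes S: "full S"
  shows "(stable S \<longrightarrow> (\<exists>e. rk E = 1 + 2 * card (descs S) + e \<and>
      (\<Sum>D\<in>{D. insert E (descs S) \<subseteq> D \<and> D \<subseteq> S}. \<Prod>G\<in>D. wt G (dl D G)) = [:0, 1:] ^ card (descs S) * [:1, 1:] ^ e)) \<and>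
    (\<not> stable S \<longrightarrow> (\<Sum>D\<in>{D. insert E (descs S) \<subseteq> D \<and> D \<subseteq> S}. \<Prod>G\<in>D. wt G (dl D G)) = 0)"
proof -
  have n: "nst S" and E: "E \<in> S" using fullD S by auto
  have fS: "finite S" by (rule nst_fin[OF n])
  have fin: "finite G" if "G \<in> S" for G using that nstG[OF n] Fl_fin[OF G_Fl] by auto
  have dec: "card H < card G" if "cov S G = Some H" for G H
    using cov_Some[OF that] psubset_card_mono[OF fin chD(2)] by auto
  obtain d where d: "\<And>D G. d D G = (case cov S G of None \<Rightarrow> 1 | Some H \<Rightarrow> if H \<in> D then 1 else Suc (d D H))"
    using gap_exists[of "cov S" card] dec by metis
  let ?A = "insert E (descs S)"
  have AS: "?A \<subseteq> S" using E descs_sub by auto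
  have nA: "\<not> desc S H" if "H \<notin> ?A" for H using that by (auto simp: descs_def)
  have main: "((\<forall>G\<in>descs S. cov S G \<noteq> None) \<longrightarrow> (\<exists>e. card S = card ?A + card (descs S) + e \<and>
      (\<Sum>D\<in>{D. ?A \<subseteq> D \<and> D \<subseteq> S}. \<Prod>G\<in>D. if G \<in> ?A - descs S then geom_from0 (d D G) else geom_from1 (d D G)) = [:0, 1:] ^ card (descs S) * [:1, 1:] ^ e)) \<and>
    (\<not> (\<forall>G\<in>descs S. cov S G \<noteq> None) \<longrightarrow>
      (\<Sum>D\<in>{D. ?A \<subseteq> D \<and> D \<subseteq> S}. \<Prod>G\<in>D. if G \<in> ?A - descs S then geom_from0 (d D G) else geom_from1 (d D G)) = 0)"
  proof (rule chain_sum[where m = card])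
    show "H \<in> S \<and> H \<notin> ?A" if "G \<in> S" "cov S G = Some H" for G H
    proof -
      have h: "H \<in> ch S G" "\<not> desc S H" using cov_Some[OF that(2)] by auto
      then show ?thesis using chD(1)[OF h(1)] par_ch(2)[OF n E that(1) h(1)] by (auto simp: descs_def)
    qed
    show "G = G'" if "G \<in> S" "G' \<in> S" "cov S G = Some H" "cov S G' = Some H" for G G' H
    proof -
      have h: "H \<in> ch S G" "H \<in> ch S G'" using cov_Some[OF that(3)] cov_Some[OF that(4)] by auto
      show ?thesis using par_ch(1)[OF n E that(1) h(1)] par_ch(1)[OF n E that(2) h(2)] by simp
    qed
    show "\<exists>G\<in>S. cov S G = Some H" if "H \<in> S" "H \<notin> ?A" for H
    proof -
      have HE: "H \<noteq> E" using that by auto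
      note p = par_props[OF n E that(1) HE]
      have "cov S (par S H) = Some H" by (rule cov_SomeI[OF S p(1,4) nA[OF that(2)]])
      then show ?thesis using p(1) by auto
    qed
  qed (use d dec fS AS in auto)
  \<comment> \<open>At most one child of G is missing from D, because missing children are
    non-descents; so \<open>dl_children\<close> becomes the recursion of d.\<close>
  have dld: "dl D G = d D G" if D: "?A \<subseteq> D" "D \<subseteq> S" and G: "G \<in> S" for D G
    using G
  proof (induction "card G" arbitrary: G rule: less_induct)
    case less
    have e: "dl D G = 1 + (\<Sum>C\<in>{C\<in>ch S G. C \<notin> D}. dl D C)" by (rule dl_children[OF S D(2) less.prems])
    show ?case
    proof (cases "cov S G")
      case None
      have "C \<in> D" if "C \<in> ch S G" for C
      proof (rule ccontr)
        assume "C \<notin> D"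
        then have "\<not> desc S C" using D(1) by (auto simp: descs_def)
        then show False using None less.prems that unfolding cov_def by (auto split: if_splits)
      qed
      then have z: "{C\<in>ch S G. C \<notin> D} = {}" by auto
      have "dl D G = 1" unfolding e z by simp
      then show ?thesis using d[of D G] None by simp
    next
      case (Some H)
      have h: "H \<in> ch S G" "\<not> desc S H" using cov_Some[OF Some] by auto
      have CH: "C = H" if "C \<in> ch S G" "C \<notin> D" for C
      proof -
        have "\<not> desc S C" using that(2) D(1) by (auto simp: descs_def)
        then show ?thesis by (rule one_nondescent_child[OF S less.prems that(1) _ h])
      qed
      have z: "{C\<in>ch S G. C \<notin> D} = (if H \<in> D then {} else {H})"
      proof (intro equalityI subsetI)
        fix C assume C: "C \<in> {C\<in>ch S G. C \<notin> D}"
        then have "C = H" by (intro CH) auto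
        then show "C \<in> (if H \<in> D then {} else {H})" using C by simp
      qed (use h(1) in \<open>simp split: if_split_asm\<close>)
      have "dl D G = (if H \<in> D then 1 else Suc (dl D H))" unfolding e z by simp
      moreover have "dl D H = d D H" by (rule less.hyps[OF dec[OF Some] chD(1)[OF h(1)]])
      ultimately show ?thesis using d[of D G] Some by simp
    qed
  qed
  have eq: "(\<Sum>D\<in>{D. ?A \<subseteq> D \<and> D \<subseteq> S}. \<Prod>G\<in>D. if G \<in> ?A - descs S then geom_from0 (d D G) else geom_from1 (d D G)) =
      (\<Sum>D\<in>{D. ?A \<subseteq> D \<and> D \<subseteq> S}. \<Prod>G\<in>D. wt G (dl D G))"
  proof (intro sum.cong prod.cong refl)
    fix D G assume D: "D \<in> {D. ?A \<subseteq> D \<and> D \<subseteq> S}" and G: "G \<in> D"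
    have "G \<in> ?A - descs S \<longleftrightarrow> G = E" using descs_sub(2) by auto
    moreover have "dl D G = d D G" by (rule dld) (use D G in auto)
    ultimately show "(if G \<in> ?A - descs S then geom_from0 (d D G) else geom_from1 (d D G)) = wt G (dl D G)" by (simp add: wt_def)
  qed
  have st: "stable S \<longleftrightarrow> (\<forall>G\<in>descs S. cov S G \<noteq> None)" using descs_sub(1) unfolding stable_def cov_def by auto
  have cA: "card ?A = 1 + card (descs S)" using descs_sub(2) finite_subset[OF descs_sub(1) fS] by simp
  \<comment> \<open>With i descents there are i + 1 tops and i elements of T, and S has
    \<open>rk E\<close> members; so e = rk E - 1 - 2i.\<close>
  show ?thesis using main unfolding eq st[symmetric] cA full_card[OF S] by (auto simp: mult_2)
qed

definition full_sets :: "'a set set set" where "full_sets = {S. full S}"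

lemma finFull: "finite full_sets"
proof (rule finite_subset)
  show "full_sets \<subseteq> Pow \<G>" unfolding full_sets_def using nstG[OF fullD(1)] by blast
qed (use finG in simp)

lemma chow_full: "chow_poly E indep \<G> = (\<Sum>S\<in>full_sets. \<Sum>D\<in>{D. insert E (descs S) \<subseteq> D \<and> D \<subseteq> S}. \<Prod>G\<in>D. wt G (dl D G))"
proof -
  let ?I = "\<lambda>S. {D. insert E (descs S) \<subseteq> D \<and> D \<subseteq> S}"
  have un: "nested_with_E = (\<Union>S\<in>full_sets. ?I S)"
  proof
    show "nested_with_E \<subseteq> (\<Union>S\<in>full_sets. ?I S)"
    proof
      fix D assume "D \<in> nested_with_E"
      then have D: "nst D" "E \<in> D" by (auto simp: nested_with_E_def)
      obtain S where S: "full S" "D \<subseteq> S" "\<forall>H\<in>S - D. \<not> desc S H" using completion_exists[OF D] by auto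
      have "descs S \<subseteq> D" using S(3) descs_sub(1)[of S] by (auto simp: descs_def)
      then show "D \<in> (\<Union>S\<in>full_sets. ?I S)" using S D by (auto simp: full_sets_def)
    qed
    show "(\<Union>S\<in>full_sets. ?I S) \<subseteq> nested_with_E"
    proof (rule UN_least, rule subsetI)
      fix S D assume S: "S \<in> full_sets" and D: "D \<in> ?I S"
      have f: "full S" using S by (simp add: full_sets_def)
      have "nst D" by (rule nst_sub[OF fullD(1)[OF f]]) (use D in auto)
      then show "D \<in> nested_with_E" using D by (auto simp: nested_with_E_def)
    qed
  qed
  have "(\<Sum>D\<in>(\<Union>S\<in>full_sets. ?I S). \<Prod>G\<in>D. wt G (dl D G)) = (\<Sum>S\<in>full_sets. \<Sum>D\<in>?I S. \<Prod>G\<in>D. wt G (dl D G))"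
  proof (rule sum.UNION_disjoint[OF finFull])
    show "\<forall>S\<in>full_sets. finite (?I S)"
    proof
      fix S assume "S \<in> full_sets"
      then have f: "full S" by (simp add: full_sets_def)
      have "finite S" by (rule nst_fin[OF fullD(1)[OF f]])
      then have fP: "finite (Pow S)" by simp
      show "finite (?I S)" by (rule finite_subset[OF _ fP]) auto
    qed
    show "\<forall>S\<in>full_sets. \<forall>S'\<in>full_sets. S \<noteq> S' \<longrightarrow> ?I S \<inter> ?I S' = {}"
    proof (intro ballI impI, rule ccontr)
      fix S S' assume S: "S \<in> full_sets" "S' \<in> full_sets" "S \<noteq> S'" and ne: "?I S \<inter> ?I S' \<noteq> {}"
      then obtain D where D: "insert E (descs S) \<subseteq> D" "D \<subseteq> S" "insert E (descs S') \<subseteq> D" "D \<subseteq> S'" by auto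
      have f: "full S" "full S'" using S by (auto simp: full_sets_def)
      have "S = S'"
      proof (rule completion_unique[OF nst_sub[OF fullD(1)[OF f(1)] D(2)] _ f(1) D(2) _ f(2) D(4)])
        show "E \<in> D" using D by auto
        show "\<not> desc S H" if "H \<in> S - D" for H using that D by (auto simp: descs_def)
        show "\<not> desc S' H" if "H \<in> S' - D" for H using that D by (auto simp: descs_def)
      qed
      then show False using S by simp
    qed
  qed
  then show ?thesis unfolding chow_sum un .
qed

text \<open>S is the completion of its own descents together with E.\<close>

lemma descs_inj: assumes "full S" "full S'" "descs S = descs S'" shows "S = S'"
proof (rule completion_unique[OF _ _ assms(1) _ _ assms(2)])
  show "nst (insert E (descs S))" by (rule nst_sub[OF fullD(1)[OF assms(1)]]) (use descs_sub fullD(2)[OF assms(1)] in auto)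
  show "insert E (descs S) \<subseteq> S" using descs_sub fullD(2)[OF assms(1)] by auto
  show "insert E (descs S) \<subseteq> S'" using descs_sub(1)[of S'] fullD(2)[OF assms(2)] assms(3) by auto
  show "\<not> desc S H" if "H \<in> S - insert E (descs S)" for H using that by (auto simp: descs_def)
  show "\<not> desc S' H" if "H \<in> S' - insert E (descs S)" for H using that assms(3) by (auto simp: descs_def)
qed simp

definition stable_full :: "'a set set set" where "stable_full = {S. full S \<and> stable S}"

lemma stable_full_rank: assumes "S \<in> stable_full" shows "2 * card (descs S) \<le> rk E - 1"
  using interval_sum[of S] assms by (auto simp: stable_full_def)

lemma chow_stable:
  "chow_poly E indep \<G> = (\<Sum>S\<in>stable_full. [:0, 1:] ^ card (descs S) * [:1, 1:] ^ (rk E - 1 - 2 * card (descs S)))"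
proof -
  have "chow_poly E indep \<G> = (\<Sum>S\<in>full_sets. if stable S then [:0, 1:] ^ card (descs S) * [:1, 1:] ^ (rk E - 1 - 2 * card (descs S)) else 0)"
    unfolding chow_full
  proof (rule sum.cong[OF refl])
    fix S assume "S \<in> full_sets"
    then have S: "full S" by (simp add: full_sets_def)
    show "(\<Sum>D\<in>{D. insert E (descs S) \<subseteq> D \<and> D \<subseteq> S}. \<Prod>G\<in>D. wt G (dl D G)) =
      (if stable S then [:0, 1:] ^ card (descs S) * [:1, 1:] ^ (rk E - 1 - 2 * card (descs S)) else 0)"
    proof (cases "stable S")
      case True
      then obtain e where e: "rk E = 1 + 2 * card (descs S) + e"
        "(\<Sum>D\<in>{D. insert E (descs S) \<subseteq> D \<and> D \<subseteq> S}. \<Prod>G\<in>D. wt G (dl D G)) = [:0, 1:] ^ card (descs S) * [:1, 1:] ^ e"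
        using interval_sum[OF S] by blast
      have "rk E - 1 - 2 * card (descs S) = e" using e(1) by simp
      then show ?thesis using e(2) True by simp
    next
      case False
      then show ?thesis using interval_sum[OF S] by simp
    qed
  qed
  also have "\<dots> = (\<Sum>S\<in>{S\<in>full_sets. stable S}. [:0, 1:] ^ card (descs S) * [:1, 1:] ^ (rk E - 1 - 2 * card (descs S)))"
    by (rule sum.inter_filter[symmetric, OF finFull])
  also have "{S\<in>full_sets. stable S} = stable_full" by (auto simp: full_sets_def stable_full_def)
  finally show ?thesis .
qed

section \<open>Removing descents\<close>

text \<open>If the label increased, \<open>pre A G\<close> would properly contain
  \<open>pre D G\<close>, although both have corank 1 in G.\<close>

lemma lab_anti:
  assumes n: "nst A" and D: "D \<subseteq> A" and G: "G \<in> \<G>" shows "lab A G \<le> lab D G"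
proof (rule ccontr)
  assume a: "\<not> lab A G \<le> lab D G"
  have nD: "nst D" by (rule nst_sub[OF n D])
  note lA = lab_props[OF n G] and lD = lab_props[OF nD G]
  obtain b where b: "b \<in> G" "b \<notin> pre D G" "pos b = lab D G" using lD(6) by auto
  have "b \<in> bel G (lab A G)" using b a by (auto simp: bel_def)
  then have bA: "b \<in> pre A G" using lA(3) by auto
  have "pre D G \<subseteq> pre A G"
  proof -
    have "bel G (lab D G) \<subseteq> bel G (lab A G)" by (rule bel_mono) (use a in simp)
    then have "J D G \<union> bel G (lab D G) \<subseteq> pre A G" using J_mono[OF D, of G] lA(2,3) by auto
    then show ?thesis using cl_least[OF _ lA(1)] by (simp add: pre_def)
  qed
  then have "pre D G \<subset> pre A G" using b bA by auto
  then have "rk (pre D G) < rk (pre A G)" by (rule rk_strict[OF lD(1) _ Fl_E[OF lA(1)]])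
  then show False using lA(5) lD(5) by simp
qed

text \<open>\<open>S'\<close> is the completion of B and E, so its descents lie in B. The work is to
  show that every G in B remains a descent; local rank at least 2 at G, inherited from stability of
  S, contradicts the alternative.\<close>

lemma remove_descents:
  assumes S: "full S" "stable S" and B: "B \<subseteq> descs S"
  shows "\<exists>S'. full S' \<and> stable S' \<and> descs S' = B"
proof -
  have n: "nst S" and E: "E \<in> S" using fullD S by auto
  let ?D = "insert E B" and ?A = "insert E (descs S)"
  have AS: "?A \<subseteq> S" using descs_sub E by auto
  have DA: "?D \<subseteq> ?A" using B by auto
  have DS: "?D \<subseteq> S" using DA AS by auto
  have nA: "nst ?A" and nD: "nst ?D" using nst_sub[OF n AS] nst_sub[OF n DS] by auto
  have ED: "E \<in> ?D" by simp
  obtain S' where S': "full S'" "?D \<subseteq> S'" "\<And>H. H \<in> S' - ?D \<Longrightarrow> \<not> desc S' H"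
    using completion_exists[OF nD ED] by auto
  have n': "nst S'" and E': "E \<in> S'" using fullD S' by auto
  have sub: "descs S' \<subseteq> B"
  proof
    fix G assume "G \<in> descs S'"
    then have G: "desc S' G" by (simp add: descs_def)
    then have "G \<in> S'" "G \<noteq> E" by (auto simp: desc_def)
    then show "G \<in> B" using S'(3)[of G] G by auto
  qed
  \<comment> \<open>A non-descent child of G in S is missing from \<open>?D\<close>, so the join
    below G is smaller there than in S.\<close>
  have d2: "dl ?D G \<noteq> 1" if G: "G \<in> B" for G
  proof -
    have GDs: "G \<in> descs S" using G B by auto
    have GS: "G \<in> S" using GDs descs_sub by auto
    have GG: "G \<in> \<G>" using GS nstG[OF n] by auto
    obtain C where C: "C \<in> ch S G" "\<not> desc S C" using S(2) GDs by (auto simp: stable_def)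
    have CE: "C \<noteq> E" by (rule par_ch(2)[OF n E GS C(1)])
    have CA: "C \<notin> ?A" using C CE by (auto simp: descs_def)
    have "\<not> C \<subseteq> J ?A G" by (rule child_not_below[OF n AS C(1) CA])
    then have "J ?A G \<subset> J S G" using J_upper[OF chD[OF C(1)]] J_mono[OF AS, of G] by auto
    then have "rk (J ?A G) < rk (J S G)"
      by (rule rk_strict[OF J_Fl[OF nA] _ Fl_E[OF J_Fl[OF n]]])
    moreover have "rk (J ?D G) \<le> rk (J ?A G)" by (rule rk_mono[OF J_mono[OF DA]])
    ultimately show ?thesis using fullD(3)[OF S(1) GS] by (simp add: dl_def)
  qed
  have desc: "desc S' G" if G: "G \<in> B" for G
  proof (rule ccontr)
    assume nd: "\<not> desc S' G"
    have GDs: "G \<in> descs S" using G B by auto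
    have GS: "G \<in> S" "G \<noteq> E" using GDs descs_sub by auto
    have GD: "G \<in> ?D" "G \<in> ?A" using G GDs by auto
    have GS': "G \<in> S'" using GD S' by auto
    have GG: "G \<in> \<G>" using GS nstG[OF n] by auto
    have Gne: "G \<noteq> {}" by (rule G_ne[OF GG])
    note k' = key_pre[OF S'(1,2) GD(1) S'(3)]
    have ndA: "\<not> desc S H" if "H \<in> S - ?A" for H using that by (auto simp: descs_def)
    note k = key_pre[OF S(1) AS GD(2) ndA]
    \<comment> \<open>Both labels are determined by descents and E alone, by \<open>key_pre\<close>,
      and fewer descents cannot lower the label. Hence the label e of the parent of G in S comes
      before the label of G in \<open>S'\<close>.\<close>
    have labs: "lab S G \<le> lab S' G" using lab_anti[OF nA DA GG] k(2) k'(2) by simp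
    note p = par_props[OF n E GS]
    have PG: "par S G \<in> \<G>" using p(1) nstG[OF n] by auto
    obtain e where e: "e \<in> par S G" "e \<notin> J S (par S G)" "pos e = lab S (par S G)" "e \<in> E"
      by (rule lab_witness[OF n PG])
    have elt: "pos e < lab S' G" using e(3) labs GDs by (auto simp: descs_def desc_def)
    have eG: "e \<notin> G" using e(2) J_upper[OF GS(1) p(2)] by auto
    note q = par_props[OF nD ED GD(1) GS(2)]
    let ?R = "par ?D G"
    have RS: "?R \<in> S" "?R \<in> S'" using q(1) DS S'(2) by auto
    have eR: "e \<in> ?R" using p(3)[OF RS(1) q(2)] e by auto
    note p' = par_props[OF n' E' GS' GS(2)]
    have top: "lab S' G < lab S' (par S' G)"
      using nd GS' GS(2) lab_par_ne[OF S'(1) GS' GS(2)] by (auto simp: desc_def)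
    \<comment> \<open>Strictly between G and \<open>?R\<close> there is no member of
      \<open>?D\<close>, so labels of \<open>S'\<close> do not decrease on the way up, and the first
      step is strict.\<close>
    have up: "lab S' G < lab S' H" if "H \<in> S'" "G \<subset> H" "H \<subseteq> ?R" for H
      using that
    proof (induction "card H" arbitrary: H rule: less_induct)
      case less
      have HG: "H \<in> \<G>" using less.prems nstG[OF n'] by auto
      obtain C where C: "C \<in> ch S' H" "G \<subseteq> C" using ch_above[OF n' GS' less.prems(2)] by auto
      have parC: "par S' C = H" "C \<noteq> E" using par_ch[OF n' E' less.prems(1) C(1)] by auto
      show ?case
      proof (cases "C = G")
        case True then show ?thesis using parC top by simp
      next
        case False
        then have GC: "G \<subset> C" using C by auto
        have CH: "C \<subset> H" "C \<in> S'" using chD[OF C(1)] by auto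
        have "lab S' G < lab S' C"
          by (rule less.hyps) (use psubset_card_mono[OF Fl_fin[OF G_Fl[OF HG]] CH(1)] CH GC less.prems in auto)
        moreover have "C \<notin> ?D" using q(3)[OF _ GC] CH(1) less.prems(3) by auto
        then have "\<not> desc S' C" using S'(3) CH by auto
        then have "lab S' C \<le> lab S' H" using CH(2) parC by (auto simp: desc_def)
        ultimately show ?thesis by simp
      qed
    qed
    \<comment> \<open>Going up from G in \<open>S'\<close>, M is where e enters: the child
      \<open>C1\<close> of M above G does not contain e.\<close>
    let ?M = "{H\<in>S'. G \<subset> H \<and> e \<in> H}"
    have fM: "finite ?M" and nM: "?M \<noteq> {}" using nst_fin[OF n'] RS q(2) eR by auto
    from finite_has_minimal[OF fM nM] obtain M where M1: "M \<in> ?M" and M2: "\<forall>H\<in>?M. H \<le> M \<longrightarrow> M = H" by (rule bexE)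
    have Mmin: "H = M" if "H \<in> S'" "G \<subset> H" "e \<in> H" "H \<subseteq> M" for H using M2 that by auto
    have MS: "M \<in> S'" "G \<subset> M" "e \<in> M" using M1 by auto
    have MG: "M \<in> \<G>" using MS nstG[OF n'] by auto
    have "M \<subseteq> ?R \<or> ?R \<subseteq> M" by (rule nst_cmp[OF n' MS(1) RS(2)]) (use MS q(2) Gne in auto)
    then have "M \<subseteq> ?R" using Mmin[OF RS(2) q(2) eR] by auto
    then have lM: "lab S' G < lab S' M" by (rule up[OF MS(1,2)])
    obtain C1 where C1: "C1 \<in> ch S' M" "G \<subseteq> C1" using ch_above[OF n' GS' MS(2)] by auto
    have C1S: "C1 \<in> S'" "C1 \<subset> M" using chD[OF C1(1)] by auto
    have eC1: "e \<notin> C1"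
    proof
      assume a: "e \<in> C1"
      then have "G \<subset> C1" using C1(2) eG by auto
      then show False using Mmin[OF C1S(1) _ a] C1S(2) by auto
    qed
    let ?F = "J ?D G" and ?b = "lab S' G"
    have F: "?F \<in> Fl" "?F \<subseteq> G" using J_Fl[OF nD] J_sub by auto
    \<comment> \<open>Completeness in the interval from the join below G to M. The elements before
      \<open>?b\<close> lie below M's own label, hence in children of M; Z then lies in a single
      child \<open>C2\<close>. But \<open>?Y\<close> contains e, so \<open>C2\<close> cannot be
      \<open>C1\<close>.\<close>
    let ?Y = "cl (?F \<union> {e\<in>M. pos e < ?b})"
    have FM: "?F \<subseteq> M" using F MS by auto
    have FbE: "?F \<union> {e\<in>M. pos e < ?b} \<subseteq> E" using FM G_E[OF MG] by auto
    have Yx: "?F \<subseteq> ?Y" "{e\<in>M. pos e < ?b} \<subseteq> ?Y" using cl_ext[OF FbE] by auto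
    have eY: "e \<in> ?Y" using Yx MS elt by auto
    have "?Y = ?F \<or> (\<exists>H\<in>\<G>. ?Y = cl (?F \<union> H))" by (rule complete[OF F(1) MG FM])
    moreover have "?Y \<noteq> ?F" using eY F eG by auto
    ultimately obtain Z where Z: "Z \<in> \<G>" "?Y = cl (?F \<union> Z)" by auto
    have FZE: "?F \<union> Z \<subseteq> E" using Fl_E[OF F(1)] G_E[OF Z(1)] by auto
    let ?X = "J S' M"
    have X: "?X \<in> Fl" "factors ?X = ch S' M" using J_Fl[OF n'] factors_J[OF n'] by auto
    have C1X: "C1 \<subseteq> ?X" by (rule J_upper[OF C1S])
    have "{e\<in>M. pos e < ?b} \<subseteq> bel M (lab S' M)" using lM by (auto simp: bel_def)
    also have "\<dots> \<subseteq> ?X" by (rule full_bel[OF S'(1) MS(1)])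
    finally have bX: "{e\<in>M. pos e < ?b} \<subseteq> ?X" .
    have "?Y \<subseteq> ?X" by (rule cl_least[OF _ X(1)]) (use bX F C1 C1X in auto)
    then have "Z \<subseteq> ?X" using cl_ext[OF FZE] Z(2) by auto
    then obtain C2 where C2: "C2 \<in> ch S' M" "Z \<subseteq> C2" using factors_above[OF Z(1)] X(2) by metis
    have C1F: "C1 \<in> Fl" using C1S nstG[OF n'] G_Fl by auto
    show False
    proof (cases "C2 = C1")
      case True
      have "?Y \<subseteq> C1" unfolding Z(2) by (rule cl_least[OF _ C1F]) (use True C2 F C1 in auto)
      then show False using eY eC1 by auto
    next
      case False
      have C2F: "C2 \<in> Fl" using chD(1)[OF C2(1)] nstG[OF n'] G_Fl by auto
      \<comment> \<open>This makes \<open>?F \<union> C2\<close> a flat containing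
        \<open>?Y\<close>. The elements of G before its label lie in \<open>C1\<close>, which is
        disjoint from \<open>C2\<close>, so they are all in \<open>?F\<close>; then G has local rank
        1.\<close>
      let ?y = "\<lambda>C. if C = C1 then ?F else if C = C2 then C2 else {}"
      have fl: "\<Union>(?y ` factors ?X) \<in> Fl"
        by (rule union_flat[OF X(1)]) (use F C1 C2F empty_Fl in auto)
      have "\<Union>(?y ` factors ?X) = ?F \<union> C2"
        unfolding X(2) using C1(1) C2(1) False by (auto split: if_splits)
      then have "?F \<union> C2 \<in> Fl" using fl by simp
      then have Y2: "?Y \<subseteq> ?F \<union> C2" unfolding Z(2) using C2(2) by (intro cl_least) auto
      have dj: "C1 \<inter> C2 = {}" by (rule ch_disj[OF n' C1(1) C2(1)]) (use False in auto)
      have "bel G ?b \<subseteq> ?F"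
      proof
        fix z assume z: "z \<in> bel G ?b"
        then have "z \<in> {e\<in>M. pos e < ?b}" using MS by (auto simp: bel_def)
        then have "z \<in> ?F \<union> C2" using Yx Y2 by auto
        moreover have "z \<in> C1" using z bel_sub C1 by auto
        ultimately show "z \<in> ?F" using dj by auto
      qed
      moreover have "lab ?D G = ?b" using k'(2) by simp
      ultimately have "?F \<union> bel G (lab ?D G) \<subseteq> ?F" by simp
      then have "pre ?D G \<subseteq> ?F" unfolding pre_def by (rule cl_least[OF _ F(1)])
      then have "pre ?D G = ?F" using lab_props(2)[OF nD GG] by auto
      then have "Suc (rk ?F) = rk G" using lab_props(5)[OF nD GG] by simp
      then show False using d2[OF G] by (simp add: dl_def)
    qed
  qed
  have Deq: "descs S' = B" using sub desc by (auto simp: descs_def)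
  have "stable S'"
    unfolding stable_def Deq
  proof
    fix G assume G: "G \<in> B"
    have GD: "G \<in> ?D" using G by auto
    \<comment> \<open>Local rank above 1 at G forces a new factor, which becomes a child of G in
      \<open>S'\<close> and is no descent.\<close>
    obtain K where K: "K \<in> factors (pre ?D G)" "K \<notin> ?D" using newfac_pre[OF nD GD d2[OF G]] by metis
    have "J S' G = pre ?D G" by (rule key_pre(1)[OF S'(1,2) GD S'(3)])
    then have Kc: "K \<in> ch S' G" using K(1) factors_J[OF n', of G] by simp
    have "\<not> desc S' K" using S'(3)[of K] K(2) chD(1)[OF Kc] by auto
    then show "\<exists>C\<in>ch S' G. \<not> desc S' C" using Kc by auto
  qed
  then show ?thesis using S'(1) Deq by auto
qed

text \<open>The completion of {E}. It makes the constant coefficient of the gamma polynomial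
  nonzero, which fixes the degree of the Chow polynomial.\<close>

lemma no_descents: obtains S where "full S" "stable S" "descs S = {}"
proof -
  have "nst {}" using card.empty by (auto simp: nst_iff)
  then have "nst {E}" using nst_insert_E[of "{}"] EG by simp
  then obtain S where S: "full S" "{E} \<subseteq> S" "\<forall>H\<in>S - {E}. \<not> desc S H" using completion_exists[of "{E}"] by auto
  have "descs S = {}" using S(3) by (auto simp: descs_def desc_def)
  then show ?thesis using that S(1) by (auto simp: stable_def)
qed

end

section \<open>The gamma polynomial\<close>

lemma gamma_coeff_high:
  fixes d i :: nat
  assumes "2 * i \<le> d"
  shows "Polynomial.degree (monom 1 i * [:1, 1:] ^ (d - 2 * i) :: rat poly) \<le> d - i"
    "coeff (monom 1 i * [:1, 1:] ^ (d - 2 * i) :: rat poly) d = (if i = 0 then 1 else 0)"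
proof -
  let ?q = "monom 1 i * [:1, 1:] ^ (d - 2 * i) :: rat poly"
  have "Polynomial.degree ([:1, 1:] ^ (d - 2 * i) :: rat poly) = d - 2 * i" by (rule degree_linear_power)
  then show dq: "Polynomial.degree ?q \<le> d - i"
    using degree_mult_le[of "monom (1::rat) i" "[:1, 1:] ^ (d - 2 * i)"] degree_monom_le[of "1::rat" i] assms by linarith
  show "coeff ?q d = (if i = 0 then 1 else 0)"
  proof (cases "i = 0")
    case True
    have "coeff ([:1, 1:] ^ d :: rat poly) d = 1"
      using lead_coeff_power[of "[:1, 1:] :: rat poly" d] by (simp add: degree_linear_power)
    then show ?thesis using True by (simp add: monom_0)
  next
    case False
    then have "Polynomial.degree ?q < d" using dq assms by linarith
    then show ?thesis using False by (simp add: coeff_eq_0)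
  qed
qed

lemma gamma_coeff_low:
  "j \<le> i \<Longrightarrow> coeff (monom 1 i * [:1, 1:] ^ k :: rat poly) j = (if i = j then 1 else 0)"
  by (auto simp: coeff_monom_mult coeff_0_power)

text \<open>The i-th summand starts in degree i with coefficient 1, so the system for the
  coefficients is triangular.\<close>

lemma gamma_unique:
  fixes a b :: "nat \<Rightarrow> rat"
  assumes eq: "(\<Sum>i\<le>n. smult (a i) (monom 1 i * [:1, 1:] ^ e i)) = (\<Sum>i\<le>n. smult (b i) (monom 1 i * [:1, 1:] ^ e i))"
  shows "j \<le> n \<Longrightarrow> a j = b j"
proof (induction j rule: less_induct)
  case (less j)
  have c: "coeff (\<Sum>i\<le>n. smult (c i) (monom 1 i * [:1, 1:] ^ e i)) j
      = c j + (\<Sum>i<j. c i * coeff (monom 1 i * [:1, 1:] ^ e i) j)" for c :: "nat \<Rightarrow> rat"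
  proof -
    have "{..n} = {..j} \<union> {j<..n}" using less.prems by auto
    then have "coeff (\<Sum>i\<le>n. smult (c i) (monom 1 i * [:1, 1:] ^ e i)) j =
        (\<Sum>i\<in>{..j} \<union> {j<..n}. c i * coeff (monom 1 i * [:1, 1:] ^ e i) j)" by (simp add: coeff_sum)
    also have "\<dots> = (\<Sum>i\<le>j. c i * coeff (monom 1 i * [:1, 1:] ^ e i) j) + (\<Sum>i\<in>{j<..n}. c i * coeff (monom 1 i * [:1, 1:] ^ e i) j)"
      by (rule sum.union_disjoint) auto
    also have "(\<Sum>i\<in>{j<..n}. c i * coeff (monom 1 i * [:1, 1:] ^ e i) j) = 0"
      by (rule sum.neutral) (auto simp: gamma_coeff_low)
    also have "(\<Sum>i\<le>j. c i * coeff (monom 1 i * [:1, 1:] ^ e i) j) = (\<Sum>i<j. c i * coeff (monom 1 i * [:1, 1:] ^ e i) j) + c j"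
      by (simp add: lessThan_Suc_atMost[symmetric] gamma_coeff_low)
    finally show ?thesis by simp
  qed
  have "(\<Sum>i<j. a i * coeff (monom 1 i * [:1, 1:] ^ e i) j) = (\<Sum>i<j. b i * coeff (monom 1 i * [:1, 1:] ^ e i) j)"
    by (rule sum.cong) (use less in auto)
  then show ?case using c[of a] c[of b] eq by simp
qed

text \<open>Only the summand i = 0 reaches degree d, so \<open>g 0 \<noteq> 0\<close> makes d the
  degree of f, the number on which \<open>gamma_poly\<close> is built.\<close>

lemma gamma_poly_eq:
  fixes g :: "nat \<Rightarrow> rat"
  assumes f: "f = (\<Sum>i\<le>d div 2. smult (g i) (monom 1 i * [:1, 1:] ^ (d - 2 * i)))" and g0: "g 0 \<noteq> 0"
  shows "coeff (gamma_poly f) i = (if i \<le> d div 2 then g i else 0)"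
proof -
  let ?q = "\<lambda>i. monom 1 i * [:1, 1:] ^ (d - 2 * i) :: rat poly"
  have "coeff f d = (\<Sum>i\<le>d div 2. g i * coeff (?q i) d)" unfolding f by (simp add: coeff_sum)
  also have "\<dots> = (\<Sum>i\<le>d div 2. if i = 0 then g 0 else 0)"
    by (rule sum.cong[OF refl]) (use gamma_coeff_high(2) in auto)
  also have "\<dots> = g 0" by simp
  finally have "d \<le> Polynomial.degree f" using g0 by (intro le_degree) simp
  moreover have "Polynomial.degree f \<le> d"
    unfolding f
  proof (rule degree_sum_le)
    fix i assume "i \<in> {..d div 2}"
    then have "Polynomial.degree (?q i) \<le> d - i" by (intro gamma_coeff_high(1)) auto
    then show "Polynomial.degree (smult (g i) (?q i)) \<le> d" using degree_smult_le[of "g i" "?q i"] by linarith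
  qed simp
  ultimately have deg: "Polynomial.degree f = d" by simp
  define p where "p = (\<Sum>i\<le>d div 2. monom (g i) i)"
  have cp: "coeff p i = (if i \<le> d div 2 then g i else 0)" for i
    unfolding p_def by (simp add: coeff_sum)
  have dp: "Polynomial.degree p \<le> d div 2" by (rule degree_le) (simp add: cp)
  have "gamma_poly f = p"
    unfolding gamma_poly_def deg
  proof (rule the_equality)
    show "2 * Polynomial.degree p \<le> d \<and> f = (\<Sum>i\<le>d div 2. smult (coeff p i) (?q i))"
      using dp f by (auto simp: cp)
    fix h assume h: "2 * Polynomial.degree h \<le> d \<and> f = (\<Sum>i\<le>d div 2. smult (coeff h i) (?q i))"
    show "h = p"
    proof (rule poly_eqI)
      fix j
      show "coeff h j = coeff p j"
      proof (cases "j \<le> d div 2")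
        case True
        have "(\<Sum>i\<le>d div 2. smult (coeff h i) (?q i)) = (\<Sum>i\<le>d div 2. smult (g i) (?q i))" using h f by simp
        then have "coeff h j = g j" by (rule gamma_unique[OF _ True])
        then show ?thesis using True by (simp add: cp)
      next
        case False
        then have "Polynomial.degree h < j" using h by linarith
        then show ?thesis using False by (simp add: cp coeff_eq_0)
      qed
    qed
  qed
  then show ?thesis using cp by simp
qed

section \<open>Ranks of elements in a linear order\<close>

definition opos :: "('a \<times> 'a) set \<Rightarrow> 'a set \<Rightarrow> 'a \<Rightarrow> nat" where "opos R E x = card {z\<in>E. (z, x) \<in> R}"

lemma opos_le_iff:
  assumes R: "linear_order_on E R" and fin: "finite E" and x: "x \<in> E" and y: "y \<in> E"
  shows "(x, y) \<in> R \<longleftrightarrow> opos R E x \<le> opos R E y"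
proof -
  have tr: "trans R" and rf: "\<And>x. x \<in> E \<Longrightarrow> (x, x) \<in> R" and tot: "total_on E R" and as: "antisym R"
    using R by (auto simp: order_on_defs refl_on_def)
  have mono: "{z\<in>E. (z, a) \<in> R} \<subseteq> {z\<in>E. (z, b) \<in> R}" if "(a, b) \<in> R" for a b using that tr by (auto dest: transD)
  show ?thesis
  proof
    assume "(x, y) \<in> R"
    then show "opos R E x \<le> opos R E y" unfolding opos_def using fin mono by (intro card_mono) auto
  next
    assume le: "opos R E x \<le> opos R E y"
    show "(x, y) \<in> R"
    proof (rule ccontr)
      assume n: "(x, y) \<notin> R"
      then have "x \<noteq> y" using rf x by auto
      then have yx: "(y, x) \<in> R" using tot x y n by (auto simp: total_on_def)
      have "{z\<in>E. (z, y) \<in> R} \<subset> {z\<in>E. (z, x) \<in> R}" using mono[OF yx] n x rf by blast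
      then have "opos R E y < opos R E x" unfolding opos_def using fin by (intro psubset_card_mono) auto
      then show False using le by simp
    qed
  qed
qed

lemma opos_inj: assumes "linear_order_on E R" "finite E" shows "inj_on (opos R E) E"
proof (rule inj_onI)
  fix x y assume xy: "x \<in> E" "y \<in> E" "opos R E x = opos R E y"
  then have "(x, y) \<in> R" "(y, x) \<in> R" using opos_le_iff[OF assms] by auto
  then show "x = y" using assms(1) by (auto simp: order_on_defs dest: antisymD)
qed

lemma olt_opos:
  assumes "linear_order_on E R" "finite E" "x \<in> E" "y \<in> E"
  shows "olt R x y \<longleftrightarrow> opos R E x < opos R E y"
proof -
  have "(x, y) \<in> R \<longleftrightarrow> opos R E x \<le> opos R E y" by (rule opos_le_iff[OF assms])
  moreover have "x = y \<longleftrightarrow> opos R E x = opos R E y" using inj_onD[OF opos_inj[OF assms(1,2)]] assms(3,4) by auto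
  ultimately show ?thesis by (auto simp: olt_def)
qed

lemma omin_opos:
  assumes R: "linear_order_on E R" "finite E" and b: "b \<in> A" "A \<subseteq> E" and le: "\<And>a. a \<in> A \<Longrightarrow> opos R E b \<le> opos R E a"
  shows "omin R A = b"
  unfolding omin_def
proof (rule the_equality)
  have iff: "(b, a) \<in> R" if "a \<in> A" for a using opos_le_iff[OF R, of b a] le[OF that] b that by auto
  then show "b \<in> A \<and> (\<forall>e\<in>A. (b, e) \<in> R)" using b by auto
  fix m assume m: "m \<in> A \<and> (\<forall>e\<in>A. (m, e) \<in> R)"
  have "antisym R" using R by (auto simp: order_on_defs)
  then show "m = b" using m iff b(1) by (auto dest: antisymD)
qed

section \<open>The gamma complex\<close>

locale tri_building = building +
  fixes R :: "('a \<times> 'a) set"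
  assumes EGR: "E \<in> \<G>" and R: "linear_order_on E R" and tri: "tri_complete E indep \<G> R"

text \<open>If the initial segment of G has elements outside F, let x be the last of them; up to x
  the elements of G outside F are exactly the segment, so its join with F is a member of
  \<open>Cchain\<close>.\<close>

sublocale tri_building \<subseteq> ordered_building E indep \<G> "opos R E"
proof unfold_locales
  show "E \<in> \<G>" by (rule EGR)
  show "inj_on (opos R E) E" by (rule opos_inj[OF R finE])
  fix F G n assume F: "F \<in> Fl" and G: "G \<in> \<G>" and FG: "F \<subseteq> G"
  let ?B = "{e\<in>G. opos R E e < n}"
  show "cl (F \<union> ?B) = F \<or> (\<exists>H\<in>\<G>. cl (F \<union> ?B) = cl (F \<union> H))"
  proof (cases "?B - F = {}")
    case True
    then have "F \<union> ?B = F" by auto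
    then show ?thesis using Fl_cl[OF F] by simp
  next
    case False
    have GE: "G \<subseteq> E" by (rule G_E[OF G])
    have fB: "finite (?B - F)" by (rule finite_subset[OF _ finE]) (use GE in auto)
    have "Max (opos R E ` (?B - F)) \<in> opos R E ` (?B - F)" by (rule Max_in) (use fB False in auto)
    then obtain x where x: "x \<in> ?B - F" "opos R E x = Max (opos R E ` (?B - F))" by auto
    have mx: "opos R E e \<le> opos R E x" if "e \<in> ?B - F" for e unfolding x(2) by (rule Max_ge) (use fB that in auto)
    have xE: "x \<in> E" using x GE by auto
    have "{e\<in>G - F. (e, x) \<in> R} = ?B - F"
    proof (intro equalityI subsetI)
      fix e assume e: "e \<in> {e\<in>G - F. (e, x) \<in> R}"
      then have "e \<in> E" "(e, x) \<in> R" using GE by auto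
      then have "opos R E e \<le> opos R E x" using opos_le_iff[OF R finE _ xE] by simp
      then show "e \<in> ?B - F" using e x(1) by simp
    next
      fix e assume e: "e \<in> ?B - F"
      then have "e \<in> E" using GE by auto
      then have "(e, x) \<in> R" using opos_le_iff[OF R finE _ xE] mx[OF e] by simp
      then show "e \<in> {e\<in>G - F. (e, x) \<in> R}" using e by simp
    qed
    then have eq: "cl (F \<union> {e\<in>G - F. (e, x) \<in> R}) = cl (F \<union> ?B)" by (simp add: Un_Diff_cancel)
    have "cl (F \<union> {e\<in>G - F. (e, x) \<in> R}) \<in> Cchain E indep R F G" unfolding Cchain_def using x by blast
    also have "\<dots> \<subseteq> GFG E indep \<G> F G \<union> {F}" using tri F G FG by (simp add: tri_complete_def)
    finally have "cl (F \<union> ?B) \<in> GFG E indep \<G> F G \<union> {F}" unfolding eq .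
    then show ?thesis unfolding GFG_def GF_def fjoin_def by auto
  qed
qed

context tri_building
begin

text \<open>Since the join below G has corank 1 in G, the elements that span G over it are exactly
  those of G outside it; the first of these is at position \<open>lab S G\<close>.\<close>

lemma lam_full:
  assumes S: "full S" and G: "G \<in> S" shows "lam E indep R S G \<in> E" "opos R E (lam E indep R S G) = lab S G"
proof -
  have n: "nst S" using fullD S by auto
  have GG: "G \<in> \<G>" using G nstG[OF n] by auto
  have GF: "G \<in> Fl" "G \<subseteq> E" using G_Fl[OF GG] G_E[OF GG] by auto
  have rG: "rk G = Suc (rk (J S G))" using fullD(3)[OF S G] by (simp add: dl_def)
  have A: "{e\<in>E. cl (insert e (Jbelow E indep S G)) = G} = G - J S G"
  proof (intro equalityI subsetI)
    fix e assume "e \<in> {e\<in>E. cl (insert e (Jbelow E indep S G)) = G}"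
    then have e: "e \<in> E" "cl (insert e (J S G)) = G" unfolding Jbelow_eq[OF n] by auto
    have "insert e (J S G) \<subseteq> E" using e J_sub[of S G] GF by auto
    then have "e \<in> G" using cl_ext[of "insert e (J S G)"] e by auto
    moreover have "e \<notin> J S G"
    proof
      assume "e \<in> J S G"
      then have "cl (insert e (J S G)) = J S G" using Fl_cl[OF J_Fl[OF n]] by (simp add: insert_absorb)
      then show False using e J_ne[OF n GG] by simp
    qed
    ultimately show "e \<in> G - J S G" by simp
  next
    fix e assume e: "e \<in> G - J S G"
    have eE: "e \<in> E" using e GF by auto
    have "rk (insert e (J S G)) = Suc (rk (J S G))" by (rule rk_flat_insert[OF J_Fl[OF n] eE]) (use e in auto)
    then have "cl (insert e (J S G)) = G" by (intro cl_eq_of_rk[OF _ GF(1)]) (use e J_sub[of S G] rG in auto)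
    then show "e \<in> {e\<in>E. cl (insert e (Jbelow E indep S G)) = G}" using eE unfolding Jbelow_eq[OF n] by simp
  qed
  obtain b where b: "b \<in> G" "b \<notin> J S G" "opos R E b = lab S G" "b \<in> E" by (rule lab_witness[OF n GG])
  have "lam E indep R S G = b"
    unfolding lam_def A
    by (rule omin_opos[OF R finE]) (use b GF full_lab_le[OF S G] in auto)
  then show "lam E indep R S G \<in> E" "opos R E (lam E indep R S G) = lab S G" using b by auto
qed

lemma is_max_in_E: assumes "full S" "G \<in> S" shows "is_max_in S G \<longleftrightarrow> G = E"
proof -
  have "H \<subseteq> E" if "H \<in> S" for H using that nstG[OF fullD(1)[OF assms(1)]] G_E by blast
  then show ?thesis using assms(2) fullD(2)[OF assms(1)] unfolding is_max_in_def by blast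
qed

lemma descent_desc: assumes S: "full S" shows "descent E indep R S G \<longleftrightarrow> desc S G"
proof (cases "G \<in> S \<and> G \<noteq> E")
  case True
  have n: "nst S" and E: "E \<in> S" using fullD S by auto
  have p: "par S G \<in> S" using par_props(1)[OF n E] True by auto
  have GS: "G \<in> S" using True by simp
  have "olt R (lam E indep R S (par S G)) (lam E indep R S G) \<longleftrightarrow> lab S (par S G) < lab S G"
    using olt_opos[OF R finE lam_full(1)[OF S p] lam_full(1)[OF S GS]] lam_full(2)[OF S p] lam_full(2)[OF S GS] by simp
  then show ?thesis using True is_max_in_E[OF S GS] by (simp add: descent_def desc_def)
next
  case False
  then show ?thesis using is_max_in_E[OF S, of G] by (auto simp: descent_def desc_def)
qed

lemma Des_descs: "full S \<Longrightarrow> Des E indep R S = descs S"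
  using descent_desc[of S] by (auto simp: Des_def descs_def desc_def)

text \<open>A bottom descent is a descent without children, a double descent one whose children
  exist and are all descents. Together they are the descents with no non-descent child.\<close>

lemma stable_iff: "S \<in> stable_max_nested E indep \<G> R \<longleftrightarrow> S \<in> stable_full"
proof (cases "full S")
  case False
  then show ?thesis unfolding stable_max_nested_def stable_full_def max_nested_full[OF EG] by simp
next
  case S: True
  have n: "nst S" and E: "E \<in> S" using fullD S by auto
  have mn: "is_min_in S G \<longleftrightarrow> ch S G = {}" if "G \<in> S" for G
  proof
    assume "is_min_in S G"
    then show "ch S G = {}" using chD(1,2)[of _ S G] unfolding is_min_in_def by blast
  next
    assume c: "ch S G = {}"
    have "\<not> H \<subset> G" if "H \<in> S" for H using ch_above[OF n that, of G] c by auto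
    then show "is_min_in S G" using \<open>G \<in> S\<close> unfolding is_min_in_def by blast
  qed
  have chs: "(C \<in> S \<and> \<not> is_max_in S C \<and> par S C = G) \<longleftrightarrow> C \<in> ch S G" if G: "G \<in> S" for C G
  proof
    assume "C \<in> S \<and> \<not> is_max_in S C \<and> par S C = G"
    then show "C \<in> ch S G" using is_max_in_E[OF S, of C] par_props(4)[OF n E, of C] by auto
  next
    assume "C \<in> ch S G"
    then show "C \<in> S \<and> \<not> is_max_in S C \<and> par S C = G"
      using chD(1)[of C S G] par_ch[OF n E G, of C] is_max_in_E[OF S, of C] by auto
  qed
  have bd: "bottom_descent E indep R S G \<or> double_descent E indep R S G \<longleftrightarrow> desc S G \<and> (\<forall>C\<in>ch S G. desc S C)"
    if G: "G \<in> S" for G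
  proof -
    have "(\<forall>C\<in>S. \<not> is_max_in S C \<and> par S C = G \<longrightarrow> descent E indep R S C) \<longleftrightarrow> (\<forall>C\<in>ch S G. desc S C)"
      unfolding descent_desc[OF S] using chs[OF G] by blast
    then show ?thesis unfolding bottom_descent_def double_descent_def descent_desc[OF S] mn[OF G] by auto
  qed
  have "stable S \<longleftrightarrow> (\<forall>G\<in>S. \<not> (desc S G \<and> (\<forall>C\<in>ch S G. desc S C)))"
    unfolding stable_def descs_def using desc_def by auto
  also have "\<dots> \<longleftrightarrow> (\<forall>G\<in>S. \<not> (bottom_descent E indep R S G \<or> double_descent E indep R S G))" using bd by blast
  finally show ?thesis unfolding stable_max_nested_def stable_full_def max_nested_full[OF EG] using S by auto
qed

lemma Gamma_cx_descs: "Gamma_cx E indep \<G> R = descs ` stable_full"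
proof -
  have "stable_max_nested E indep \<G> R = stable_full" using stable_iff by blast
  moreover have "Des E indep R S = descs S" if "S \<in> stable_full" for S using that Des_descs by (simp add: stable_full_def)
  ultimately show ?thesis unfolding Gamma_cx_def by (simp cong: image_cong_simp)
qed

text \<open>An atom has no children, but a stable descent has one. If G is spanned by the elements
  up to x, its label is at most x, and as a descent its parent has a smaller label; the element of
  that label would then lie in G.\<close>

lemma descs_Vset: assumes S: "full S" "stable S" shows "descs S \<subseteq> Vset E indep \<G> R"
proof
  fix G assume G: "G \<in> descs S"
  have n: "nst S" and E: "E \<in> S" using fullD S by auto
  have GS: "G \<in> S" "G \<noteq> E" using G descs_sub by auto
  have GG: "G \<in> \<G>" using GS nstG[OF n] by auto
  have "G \<notin> atoms E indep"
  proof
    assume "G \<in> atoms E indep"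
    then have "rk (J S G) = 0" using rk_J[OF n GG] by (simp add: atoms_def)
    then have J: "J S G = {}" using rk_pos[OF Fl_E[OF J_Fl[OF n]], of G] by auto
    obtain C where C: "C \<in> ch S G" using S(2) G by (auto simp: stable_def)
    then have "C \<subseteq> {}" using J_upper[OF chD[OF C]] J by simp
    moreover have "C \<noteq> {}" using chD(1)[OF C] nstG[OF n] G_ne by auto
    ultimately show False by simp
  qed
  moreover have "G \<notin> Cchain E indep R {} E"
  proof
    assume "G \<in> Cchain E indep R {} E"
    then obtain x where x: "x \<in> E" "G = cl {e\<in>E. (e, x) \<in> R}" using G_ne[OF GG] unfolding Cchain_def by auto
    let ?L = "{e\<in>E. (e, x) \<in> R}"
    have LE: "?L \<subseteq> E" by auto
    have LG: "?L \<subseteq> G" unfolding x(2) by (rule cl_ext[OF LE])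
    note p = par_props[OF n E GS]
    have PG: "par S G \<in> \<G>" using p(1) nstG[OF n] by auto
    obtain e where e: "e \<in> par S G" "e \<notin> J S (par S G)" "opos R E e = lab S (par S G)" "e \<in> E"
      by (rule lab_witness[OF n PG])
    have eG: "e \<notin> G" using e(2) J_upper[OF GS(1) p(2)] by auto
    have "\<not> ?L \<subseteq> J S G"
    proof
      assume "?L \<subseteq> J S G"
      then have "G \<subseteq> J S G" unfolding x(2) by (rule cl_least[OF _ J_Fl[OF n]])
      then show False using J_ne[OF n GG] J_sub[of S G] by auto
    qed
    then obtain y where y: "y \<in> ?L" "y \<notin> J S G" by auto
    have "lab S G \<le> opos R E y" by (rule full_lab_le[OF S(1) GS(1) _ y(2)]) (use y LG in auto)
    also have "\<dots> \<le> opos R E x" using opos_le_iff[OF R finE _ x(1)] y by auto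
    finally have "opos R E e \<le> opos R E x" using e(3) G by (simp add: descs_def desc_def)
    then have "e \<in> ?L" using opos_le_iff[OF R finE e(4) x(1)] e(4) by simp
    then show False using LG eG by auto
  qed
  ultimately show "G \<in> Vset E indep \<G> R" using GG by (simp add: Vset_def)
qed

lemma finStb: "finite stable_full" by (rule finite_subset[OF _ finFull]) (auto simp: stable_full_def full_sets_def)

lemma gamma_chow: "coeff (gamma_poly (chow_poly E indep \<G>)) i = of_nat (card {S\<in>stable_full. card (descs S) = i})"
proof -
  let ?d = "rk E - 1"
  let ?g = "\<lambda>i. of_nat (card {S\<in>stable_full. card (descs S) = i}) :: rat"
  have t: "[:0, 1:] ^ k = monom (1::rat) k" for k by (simp add: monom_altdef)
  have le: "card (descs S) \<le> ?d div 2" if "S \<in> stable_full" for S using stable_full_rank[OF that] by linarith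
  have "chow_poly E indep \<G> = (\<Sum>S\<in>stable_full. monom 1 (card (descs S)) * [:1, 1:] ^ (?d - 2 * card (descs S)))"
    unfolding chow_stable t ..
  also have "\<dots> = (\<Sum>i\<le>?d div 2. \<Sum>S\<in>{S\<in>stable_full. card (descs S) = i}. monom 1 (card (descs S)) * [:1, 1:] ^ (?d - 2 * card (descs S)))"
    by (rule sum.group[symmetric, OF finStb]) (use le in auto)
  also have "\<dots> = (\<Sum>i\<le>?d div 2. smult (?g i) (monom 1 i * [:1, 1:] ^ (?d - 2 * i)))"
  proof (rule sum.cong[OF refl])
    fix i
    have "(\<Sum>S\<in>{S\<in>stable_full. card (descs S) = i}. monom 1 (card (descs S)) * [:1, 1:] ^ (?d - 2 * card (descs S))) =
        (\<Sum>S\<in>{S\<in>stable_full. card (descs S) = i}. monom 1 i * [:1, 1:] ^ (?d - 2 * i) :: rat poly)" by (rule sum.cong) auto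
    then show "(\<Sum>S\<in>{S\<in>stable_full. card (descs S) = i}. monom 1 (card (descs S)) * [:1, 1:] ^ (?d - 2 * card (descs S))) =
        smult (?g i) (monom 1 i * [:1, 1:] ^ (?d - 2 * i))" by (simp add: of_nat_poly)
  qed
  finally have f: "chow_poly E indep \<G> = (\<Sum>i\<le>?d div 2. smult (?g i) (monom 1 i * [:1, 1:] ^ (?d - 2 * i)))" .
  obtain S0 where "full S0" "stable S0" "descs S0 = {}" by (rule no_descents)
  then have "S0 \<in> {S\<in>stable_full. card (descs S) = 0}" by (simp add: stable_full_def)
  then have "card {S\<in>stable_full. card (descs S) = 0} \<noteq> 0" using finStb by auto
  then have g0: "?g 0 \<noteq> 0" by simp
  have "?g i = 0" if "\<not> i \<le> ?d div 2"
  proof -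
    have z: "{S\<in>stable_full. card (descs S) = i} = {}" using le that by auto
    show ?thesis unfolding z by simp
  qed
  then show ?thesis using gamma_poly_eq[OF f g0, of i] by auto
qed

lemma card_Gamma: "card {A\<in>Gamma_cx E indep \<G> R. card A = i} = card {S\<in>stable_full. card (descs S) = i}"
proof -
  have "{A\<in>Gamma_cx E indep \<G> R. card A = i} = descs ` {S\<in>stable_full. card (descs S) = i}" unfolding Gamma_cx_descs by auto
  moreover have "inj_on descs {S\<in>stable_full. card (descs S) = i}"
  proof (rule inj_onI)
    fix S S' assume S: "S \<in> {S\<in>stable_full. card (descs S) = i}" and S': "S' \<in> {S\<in>stable_full. card (descs S) = i}" and eq: "descs S = descs S'"
    have "full S" "full S'" using S S' by (simp_all add: stable_full_def)
    then show "S = S'" using eq by (rule descs_inj)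
  qed
  ultimately show ?thesis by (simp add: card_image)
qed

end

theorem theorem5p17:
  fixes E :: "'a set" and indep :: "'a set \<Rightarrow> bool"
    and \<G> :: "'a set set" and R :: "('a \<times> 'a) set"
  assumes "matroid E indep"
    and "loopless E indep"
    and "building_set E indep \<G>"
    and "E \<in> \<G>"
    and "linear_order_on E R"
    and "tri_complete E indep \<G> R"
  shows "Gamma_cx E indep \<G> R \<subseteq> Pow (Vset E indep \<G> R)
    \<and> (\<forall>A\<in>Gamma_cx E indep \<G> R. \<forall>B. B \<subseteq> A \<longrightarrow> B \<in> Gamma_cx E indep \<G> R)
    \<and> (\<forall>i. of_nat (card {A\<in>Gamma_cx E indep \<G> R. card A = i})
            = coeff (gamma_poly (chow_poly E indep \<G>)) i)"
proof -
  interpret tri_building E indep \<G> R by unfold_locales (use assms in auto)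
  show ?thesis
  proof (intro conjI ballI allI impI)
    show "Gamma_cx E indep \<G> R \<subseteq> Pow (Vset E indep \<G> R)"
      unfolding Gamma_cx_descs using descs_Vset by (auto simp: stable_full_def)
    fix A B assume "A \<in> Gamma_cx E indep \<G> R" "B \<subseteq> A"
    then obtain S where "full S" "stable S" "B \<subseteq> descs S" unfolding Gamma_cx_descs stable_full_def by auto
    from remove_descents[OF this] show "B \<in> Gamma_cx E indep \<G> R" unfolding Gamma_cx_descs stable_full_def by auto
  next
    fix i show "of_nat (card {A\<in>Gamma_cx E indep \<G> R. card A = i}) = coeff (gamma_poly (chow_poly E indep \<G>)) i"
      unfolding card_Gamma gamma_chow ..
  qed
qed

end
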